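(* Let $n\ge2$, let $m\ge2$ be even, and let $\mathcal{T}=(t_{i_1\ldots i_m})\in\mathbb{S}(\mathbb{R}^n,m)$ be positive semidefinite. Let $D:=\mathrm{Diag}\{t_{1\ldots1},\ldots,t_{n\ldots n}\}$ be the diagonal matrix of the diagonal elements of $\mathcal{T}$, where $D$ is invertible, and let $\mathcal{K}:=D^{-\frac1m}\circ\mathcal{T}\circ D^{-\frac1m}$. Suppose that each of the tensors $\mathcal{S}\in\{\mathcal{T},\mathcal{K}\}$ satisfies both of the following: (a) for every negative eigenvalue $\lambda$ of $\mathcal{S}$, $\mathcal{S}$ possesses a real eigenvector associated with $\lambda$; (b) all eigenvalues of $\mathcal{S}$ are real. Then $$0\leq\mathrm{Edet}(\mathcal{T})\leq\left(\prod_{i=1}^nt_{i\ldots i}\right)^{(m-1)^{n-1}}.$$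
   Context: $\mathbb{S}(\mathbb{R}^n,m)$ is the space of real symmetric $m$-th order $n$-dimensional tensors (entries invariant under permutation of indices). For a tensor $\mathcal{T}$ and $\mathbf{x}\in\mathbb{C}^n$, $\mathcal{T}\mathbf{x}^{m-1}$ has $i$-th entry $\sum_{i_2,\ldots,i_m=1}^n t_{ii_2\ldots i_m}x_{i_2}\cdots x_{i_m}$. $\mathcal{T}$ is positive semidefinite if $\mathbf{x}^T(\mathcal{T}\mathbf{x}^{m-1})\ge0$ for all $\mathbf{x}\in\mathbb{R}^n$ (so the diagonal elements are nonnegative, and $D$ invertible means they are positive). $\mathcal{E}$ is the identity tensor ($e_{i_1\ldots i_m}=1$ if $i_1=\cdots=i_m$, else $0$). $\lambda\in\mathbb{C}$ is an eigenvalue of $\mathcal{T}$ with eigenvector $\mathbf{x}\in\mathbb{C}^n\setminus\{\mathbf{0}\}$ if $(\lambda\mathcal{E}-\mathcal{T})\mathbf{x}^{m-1}=\mathbf{0}$. The resultant of $n$ homogeneous polynomials in $n$ variables, each of degree $m-1$, is the irreducible polynomial in their coefficients that vanishes iff they have a common zero in $\mathbb{C}^n\setminus\{\mathbf{0}\}$, normalized to be $1$ on $(x_1^{m-1},\ldots,x_n^{m-1})$; $\mathrm{Edet}(\mathcal{T})$ is the resultant of the components of $\mathcal{T}\mathbf{x}^{m-1}$. For $n\times n$ matrices $G,H$, $G\circ\mathcal{T}\circ H$ is the tensor with entries $(G\circ\mathcal{T}\circ H)_{ij_2\ldots j_m}=\sum_{l,i_2,\ldots,i_m=1}^n g_{il}t_{li_2\ldots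 i_m}h_{i_2j_2}\cdots h_{i_mj_m}$; thus $\mathcal{K}$ has entries $t_{i_1\ldots i_m}\prod_{l=1}^m (t_{i_l\ldots i_l})^{-1/m}$. *)

theory Defs
  imports
    "HOL-Analysis.Analysis"
    "HOL-Library.Poly_Mapping"
    "HOL-Library.Multiset"
    "HOL-Computational_Algebra.Factorial_Ring"
begin

text \<open>
  A tensor of order \<open>m\<close> and dimension \<open>n = CARD('n)\<close> is a function on index lists over the
  finite type \<open>'n\<close>.  Only its values on lists of length \<open>m\<close> are meaningful, and no definition
  below looks at any other value when it is used at order \<open>m\<close>.
\<close>

type_synonym ('n, 'a) tensor = "'n list \<Rightarrow> 'a"

definition symmetric_tensor :: "nat \<Rightarrow> ('n::finite, real) tensor \<Rightarrow> bool" where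
  "symmetric_tensor m T \<longleftrightarrow>
     (\<forall>is js. length is = m \<longrightarrow> mset js = mset is \<longrightarrow> T js = T is)"

definition tensor_apply :: "nat \<Rightarrow> ('n::finite, 'a::comm_ring_1) tensor \<Rightarrow> 'a ^ 'n \<Rightarrow> 'a ^ 'n" where
  "tensor_apply m T x =
     (\<chi> i. \<Sum>js | length js = m - 1. T (i # js) * (\<Prod>j\<leftarrow>js. x $ j))"

definition psd_tensor :: "nat \<Rightarrow> ('n::finite, real) tensor \<Rightarrow> bool" where
  "psd_tensor m T \<longleftrightarrow> (\<forall>x :: real ^ 'n. x \<bullet> tensor_apply m T x \<ge> 0)"

definition identity_tensor :: "('n::finite, 'a::comm_ring_1) tensor" where
  "identity_tensor is = (if \<forall>i\<in>set is. \<forall>j\<in>set is. i = j then 1 else 0)"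

definition eigenpair :: "nat \<Rightarrow> ('n::finite, real) tensor \<Rightarrow> complex \<Rightarrow> complex ^ 'n \<Rightarrow> bool" where
  "eigenpair m T \<mu> x \<longleftrightarrow>
     x \<noteq> 0 \<and> tensor_apply m (\<lambda>is. \<mu> * identity_tensor is - complex_of_real (T is)) x = 0"

definition tensor_eigenvalue :: "nat \<Rightarrow> ('n::finite, real) tensor \<Rightarrow> complex \<Rightarrow> bool" where
  "tensor_eigenvalue m T \<mu> \<longleftrightarrow> (\<exists>x. eigenpair m T \<mu> x)"

definition complex_vec :: "real ^ 'n \<Rightarrow> complex ^ 'n" where
  "complex_vec x = (\<chi> i. complex_of_real (x $ i))"

text \<open>
  The product \<open>G \<circ> T \<circ> H\<close>; the index list of an entry is \<open>i # js\<close> with \<open>js = [j_2, \<dots>, j_m]\<close>.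
\<close>

fun mat_tensor_mat ::
  "'a ^ 'n ^ 'n \<Rightarrow> ('n::finite, 'a::comm_ring_1) tensor \<Rightarrow> 'a ^ 'n ^ 'n \<Rightarrow> ('n, 'a) tensor" where
  "mat_tensor_mat G T H [] = 0"
| "mat_tensor_mat G T H (i # js) =
     (\<Sum>l\<in>UNIV. \<Sum>is | length is = length js.
        G $ i $ l * T (l # is) * (\<Prod>k<length js. H $ (is ! k) $ (js ! k)))"

definition diag_matrix :: "nat \<Rightarrow> ('n::finite, real) tensor \<Rightarrow> real ^ 'n ^ 'n" where
  "diag_matrix m T = (\<chi> i j. if i = j then T (replicate m i) else 0)"

text \<open>Real power of a diagonal matrix with positive diagonal.\<close>

definition diag_powr :: "real ^ 'n ^ 'n \<Rightarrow> real \<Rightarrow> real ^ 'n::finite ^ 'n" where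
  "diag_powr D p = (\<chi> i j. if i = j then (D $ i $ i) powr p else 0)"

text \<open>
  A monomial of degree \<open>d\<close> in the variables \<open>x_i\<close>, \<open>i :: 'n\<close>, is a multiset of size \<open>d\<close>
  over \<open>'n\<close>, so a system of \<open>n\<close> forms of degree \<open>d\<close> in \<open>n\<close> variables is given by its
  coefficients \<open>c (i, \<alpha>)\<close>: the coefficient of the monomial \<open>\<alpha>\<close> in the \<open>i\<close>-th form.
\<close>

definition form_eval ::
  "nat \<Rightarrow> ('n::finite \<times> 'n multiset \<Rightarrow> complex) \<Rightarrow> 'n \<Rightarrow> complex ^ 'n \<Rightarrow> complex" where
  "form_eval d c i x = (\<Sum>\<alpha> | size \<alpha> = d. c (i, \<alpha>) * (\<Prod>j\<in>#\<alpha>. x $ j))"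

text \<open>
  Multivariate polynomials over \<open>'a\<close> with variables \<open>'v\<close> are finitely supported maps from
  exponent vectors to coefficients; their multiplication in \<open>Poly_Mapping\<close> is convolution.
\<close>

type_synonym ('v, 'a) mpoly = "('v \<Rightarrow>\<^sub>0 nat) \<Rightarrow>\<^sub>0 'a"

definition mpoly_eval :: "('v, 'a::comm_ring_1) mpoly \<Rightarrow> ('v \<Rightarrow> 'a) \<Rightarrow> 'a" where
  "mpoly_eval P a =
     (\<Sum>e\<in>Poly_Mapping.keys P. Poly_Mapping.lookup P e *
        (\<Prod>v\<in>Poly_Mapping.keys e. a v ^ Poly_Mapping.lookup e v))"

definition mpoly_vars :: "('v, 'a::zero) mpoly \<Rightarrow> 'v set" where
  "mpoly_vars P = (\<Union>e\<in>Poly_Mapping.keys P. Poly_Mapping.keys e)"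

text \<open>
  The last condition says that the resultant is 1 on \<open>(x_1^d, \<dots>, x_n^d)\<close>.
\<close>

definition is_resultant :: "nat \<Rightarrow> ('n::finite \<times> 'n multiset, complex) mpoly \<Rightarrow> bool" where
  "is_resultant d R \<longleftrightarrow>
     mpoly_vars R \<subseteq> {(i, \<alpha>). size \<alpha> = d} \<and>
     irreducible R \<and>
     (\<forall>c. mpoly_eval R c = 0 \<longleftrightarrow> (\<exists>x. x \<noteq> 0 \<and> (\<forall>i. form_eval d c i x = 0))) \<and>
     mpoly_eval R (\<lambda>(i, \<alpha>). if \<alpha> = replicate_mset d i then 1 else 0) = 1"

definition resultant :: "nat \<Rightarrow> ('n::finite \<times> 'n multiset, complex) mpoly" where
  "resultant d = (THE R. is_resultant d R)"

text \<open>
  The coefficients of the components of \<open>T x^(m-1)\<close>, obtained by collecting equal monomials.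
\<close>

definition tensor_coeffs ::
  "nat \<Rightarrow> ('n::finite, complex) tensor \<Rightarrow> 'n \<times> 'n multiset \<Rightarrow> complex" where
  "tensor_coeffs m T = (\<lambda>(i, \<alpha>). \<Sum>js | length js = m - 1 \<and> mset js = \<alpha>. T (i # js))"

lemma form_eval_tensor_coeffs:
  "form_eval (m - 1) (tensor_coeffs m T) i x = tensor_apply m T x $ i"
proof -
  let ?L = "{js :: 'a list. length js = m - 1}"
  have fin: "finite ?L"
    using finite_lists_length_eq[of "UNIV :: 'a set" "m - 1"] by simp
  have img: "{\<alpha>. size \<alpha> = m - 1} = mset ` ?L"
    by (auto simp: image_iff) (metis ex_mset size_mset)
  have "tensor_apply m T x $ i =
      (\<Sum>\<alpha>\<in>mset ` ?L. \<Sum>js | js \<in> ?L \<and> mset js = \<alpha>. T (i # js) * (\<Prod>j\<leftarrow>js. x $ j))"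
    using sum.image_gen[OF fin, of "\<lambda>js. T (i # js) * (\<Prod>j\<leftarrow>js. x $ j)" mset]
    by (simp add: tensor_apply_def)
  also have "\<dots> = (\<Sum>\<alpha>\<in>mset ` ?L.
      (\<Sum>js | js \<in> ?L \<and> mset js = \<alpha>. T (i # js)) * (\<Prod>j\<in>#\<alpha>. x $ j))"
    unfolding sum_distrib_right
    by (intro sum.cong refl) (auto simp flip: prod_mset_prod_list)
  finally show ?thesis
    by (simp only: form_eval_def tensor_coeffs_def img prod.case mem_Collect_eq)
qed

definition Edet :: "nat \<Rightarrow> ('n::finite, real) tensor \<Rightarrow> complex" where
  "Edet m T = mpoly_eval (resultant (m - 1)) (tensor_coeffs m (\<lambda>is. complex_of_real (T is)))"

end

theory Submission
  imports
    Defs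
    "HOL-Computational_Algebra.Fundamental_Theorem_Algebra"
    "Jordan_Normal_Form.Determinant"
begin

text \<open>
  Write \<open>d = m - 1\<close> and \<open>E\<close> for the system \<open>(x_1^d, \<dots>, x_n^d)\<close>, and call a system of forms singular if it
  has a nonzero common zero.

  The polynomials vanishing on the singular systems form a prime ideal. It contains Macaulay's
  determinants, and none of its nonzero elements is free of the coefficient of \<open>x_k^d\<close> in the \<open>k\<close>-th
  form, so that an element \<open>R\<close> of minimal degree is irreducible and generates it. The partial
  derivatives of \<open>R\<close> recover the common zero of a generic point of \<open>R = 0\<close>; the singular systems being
  closed, they are exactly the zeros of \<open>R\<close>, and \<open>R\<close> is the resultant. Comparing with Macaulay's
  determinants from above and with an explicit system from below, \<open>R\<close> has degree \<open>d^(n-1)\<close> in the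
  coefficients of each form.

  The polynomial \<open>R (\<lambda> E - S)\<close> in \<open>\<lambda>\<close> has the eigenvalues of \<open>S\<close> as its roots. Moving a
  non-diagonal coefficient of \<open>E\<close> never makes the system singular, hence leaves \<open>R\<close> constant, and so the
  sum of the eigenvalues is \<open>d^(n-1)\<close> times the trace of \<open>S\<close>. Under the hypotheses the eigenvalues of
  \<open>T\<close> and \<open>K\<close> are real and nonnegative; those of \<open>K\<close> have mean \<open>1\<close>, so their product is at most \<open>1\<close>.
  Homogeneity of \<open>R\<close> in the rows and columns gives \<open>Edet T = (\<Prod>i. t_i)^(d^(n-1)) Edet K\<close>, where
  \<open>t_i\<close> are the diagonal entries of \<open>T\<close>.
\<close>

section \<open>Polynomials in several variables\<close>

text \<open>\<open>resultant\<close> is a definite description, so nothing can be said about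
  \<open>Edet\<close> before a polynomial with all four properties is constructed and shown to be
  unique. The delicate property is the zero set: vanishing on singular systems comes with the ideal,
  whereas the converse is obtained by analysis over the complex numbers, from the fundamental
  theorem of algebra and the compactness of the unit sphere. The passage to \<open>K\<close> turns a
  mean into a product. The eigenvalues of \<open>T\<close> have the mean of the diagonal entries as
  their mean, so the same argument applied to \<open>T\<close> would bound \<open>Edet\<close> only
  by a power of that arithmetic mean. Hypothesis (a) enters because positive semidefiniteness
  constrains real vectors only.\<close>

definition rhom :: "('a::comm_ring_1 \<Rightarrow> 'r::comm_ring_1) \<Rightarrow> bool" where
  "rhom h \<longleftrightarrow> h 1 = 1 \<and> (\<forall>x y. h (x + y) = h x + h y) \<and> (\<forall>x y. h (x * y) = h x * h y)"

lemma rhomI: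
  "h 1 = 1 \<Longrightarrow> (\<And>x y. h (x + y) = h x + h y) \<Longrightarrow> (\<And>x y. h (x * y) = h x * h y) \<Longrightarrow> rhom h"
  by (simp add: rhom_def)

lemma rhom_simps:
  assumes "rhom h"
  shows "h 1 = 1" "h (x + y) = h x + h y" "h (x * y) = h x * h y" "h 0 = 0"
    "h (- x) = - h x" "h (x - y) = h x - h y" "h (x ^ n) = h x ^ n"
    "h (sum f A) = (\<Sum>a\<in>A. h (f a))" "h (prod f A) = (\<Prod>a\<in>A. h (f a))"
proof -
  show 1: "h 1 = 1" and add: "h (x + y) = h x + h y" and mult: "h (x * y) = h x * h y" for x y
    using assms by (auto simp: rhom_def)
  show 0: "h 0 = 0" using add[of 0 0] by simp
  show minus: "h (- x) = - h x" for x using add[of x "- x"] 0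
    by (metis add.right_inverse neg_eq_iff_add_eq_0)
  show "h (x - y) = h x - h y" using add[of x "- y"] minus by simp
  show "h (x ^ n) = h x ^ n" by (induction n) (auto simp: 1 mult)
  show "h (sum f A) = (\<Sum>a\<in>A. h (f a))"
    by (induction A rule: infinite_finite_induct) (auto simp: 0 add)
  show "h (prod f A) = (\<Prod>a\<in>A. h (f a))"
    by (induction A rule: infinite_finite_induct) (auto simp: 1 mult)
qed

lemma rhom_id [simp]: "rhom (\<lambda>x. x)" "rhom id"
  by (simp_all add: rhom_def)

lemma rhom_comp: "rhom g \<Longrightarrow> rhom h \<Longrightarrow> rhom (\<lambda>x. g (h x))"
  by (simp add: rhom_def)

lemma rhom_pconst [simp]: "rhom (\<lambda>x::'a::comm_ring_1. [:x:])"
  by (simp add: rhom_def one_pCons)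

lemma rhom_poly [simp]: "rhom (\<lambda>p. poly p (t::'a::comm_ring_1))"
  by (simp add: rhom_def)

section \<open>Substitution homomorphisms\<close>

definition mon_eval :: "('v \<Rightarrow> 'r::comm_ring_1) \<Rightarrow> ('v \<Rightarrow>\<^sub>0 nat) \<Rightarrow> 'r" where
  "mon_eval s e = (\<Prod>v\<in>Poly_Mapping.keys e. s v ^ Poly_Mapping.lookup e v)"

text \<open>The homomorphism given by \<open>h\<close> on coefficients and \<open>s\<close> on
  variables. Evaluation, \<open>uni\<close>, \<open>graded\<close>, \<open>along\<close> and all
  changes of variables below are instances, which \<open>rhom_msubst_comp\<close> composes.\<close>

definition msubst :: "('a::comm_ring_1 \<Rightarrow> 'r::comm_ring_1) \<Rightarrow> ('v \<Rightarrow> 'r) \<Rightarrow> ('v, 'a) mpoly \<Rightarrow> 'r" where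
  "msubst h s p = (\<Sum>e\<in>Poly_Mapping.keys p. h (Poly_Mapping.lookup p e) * mon_eval s e)"

abbreviation mconst :: "'a::comm_ring_1 \<Rightarrow> ('v, 'a) mpoly" where
  "mconst a \<equiv> Poly_Mapping.single 0 a"

definition mvar :: "'v \<Rightarrow> ('v, 'a::comm_ring_1) mpoly" where
  "mvar v = Poly_Mapping.single (Poly_Mapping.single v 1) 1"

lemma mpoly_eval_msubst: "mpoly_eval p a = msubst (\<lambda>x. x) a p"
  by (simp add: mpoly_eval_def msubst_def mon_eval_def)

lemma mon_eval_superset:
  "finite A \<Longrightarrow> Poly_Mapping.keys e \<subseteq> A \<Longrightarrow> mon_eval s e = (\<Prod>v\<in>A. s v ^ Poly_Mapping.lookup e v)"
  unfolding mon_eval_def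
  by (rule prod.mono_neutral_left) (auto simp: in_keys_iff)

lemma mon_eval_0 [simp]: "mon_eval s 0 = 1"
  by (simp add: mon_eval_def)

lemma mon_eval_add: "mon_eval s (a + b) = mon_eval s a * mon_eval s b"
proof -
  let ?A = "Poly_Mapping.keys a \<union> Poly_Mapping.keys b"
  have "Poly_Mapping.keys (a + b) \<subseteq> ?A" by (rule Poly_Mapping.keys_add)
  then have "mon_eval s (a + b) = (\<Prod>v\<in>?A. s v ^ Poly_Mapping.lookup (a + b) v)"
    by (intro mon_eval_superset) auto
  also have "\<dots> = (\<Prod>v\<in>?A. s v ^ Poly_Mapping.lookup a v) * (\<Prod>v\<in>?A. s v ^ Poly_Mapping.lookup b v)"
    by (simp add: lookup_add power_add prod.distrib)
  also have "\<dots> = mon_eval s a * mon_eval s b"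
    by (subst (1 2) mon_eval_superset[where A = ?A]) auto
  finally show ?thesis .
qed

lemma msubst_superset:
  assumes "rhom h" "finite A" "Poly_Mapping.keys p \<subseteq> A"
  shows "msubst h s p = (\<Sum>e\<in>A. h (Poly_Mapping.lookup p e) * mon_eval s e)"
  unfolding msubst_def
  by (rule sum.mono_neutral_left) (use assms in \<open>auto simp: in_keys_iff rhom_simps(4)\<close>)

lemma msubst_add:
  assumes "rhom h"
  shows "msubst h s (p + q) = msubst h s p + msubst h s q"
proof -
  let ?A = "Poly_Mapping.keys p \<union> Poly_Mapping.keys q"
  have "msubst h s (p + q) = (\<Sum>e\<in>?A. h (Poly_Mapping.lookup (p + q) e) * mon_eval s e)"
    using Poly_Mapping.keys_add[of p q] by (intro msubst_superset assms) auto
  also have "\<dots> = (\<Sum>e\<in>?A. h (Poly_Mapping.lookup p e) * mon_eval s e) +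
                (\<Sum>e\<in>?A. h (Poly_Mapping.lookup q e) * mon_eval s e)"
    by (simp add: lookup_add rhom_simps(2)[OF assms] algebra_simps sum.distrib)
  also have "\<dots> = msubst h s p + msubst h s q"
    by (subst (1 2) msubst_superset[OF assms, where A = ?A]) auto
  finally show ?thesis .
qed

lemma msubst_0 [simp]: "msubst h s 0 = 0"
  by (simp add: msubst_def)

lemma msubst_sum: "rhom h \<Longrightarrow> msubst h s (sum f A) = (\<Sum>a\<in>A. msubst h s (f a))"
  by (induction A rule: infinite_finite_induct) (auto simp: msubst_add)

lemma msubst_single:
  "rhom h \<Longrightarrow> msubst h s (Poly_Mapping.single e a) = h a * mon_eval s e"
  by (cases "a = 0") (auto simp: msubst_def rhom_simps(4))

lemma mpoly_sum_single: "p = (\<Sum>e\<in>Poly_Mapping.keys p. Poly_Mapping.single e (Poly_Mapping.lookup p e))"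
proof (rule poly_mapping_eqI)
  fix k
  show "Poly_Mapping.lookup p k = Poly_Mapping.lookup (\<Sum>e\<in>Poly_Mapping.keys p. Poly_Mapping.single e (Poly_Mapping.lookup p e)) k"
    by (cases "k \<in> Poly_Mapping.keys p")
      (auto simp: lookup_sum lookup_single when_def in_keys_iff)
qed

lemma msubst_mult:
  assumes "rhom h"
  shows "msubst h s (p * q) = msubst h s p * msubst h s q"
proof -
  have "p * q = (\<Sum>e\<in>Poly_Mapping.keys p. \<Sum>f\<in>Poly_Mapping.keys q.
      Poly_Mapping.single (e + f) (Poly_Mapping.lookup p e * Poly_Mapping.lookup q f))"
    by (subst mpoly_sum_single[of p], subst mpoly_sum_single[of q])
      (simp add: sum_product mult_single)
  then have "msubst h s (p * q) = (\<Sum>e\<in>Poly_Mapping.keys p. \<Sum>f\<in>Poly_Mapping.keys q.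
      h (Poly_Mapping.lookup p e * Poly_Mapping.lookup q f) * mon_eval s (e + f))"
    using assms by (simp add: msubst_sum msubst_single)
  also have "\<dots> = msubst h s p * msubst h s q"
    unfolding msubst_def sum_product mon_eval_add rhom_simps(3)[OF assms]
    by (intro sum.cong refl) (simp add: algebra_simps)
  finally show ?thesis .
qed

lemma msubst_mconst [simp]: "rhom h \<Longrightarrow> msubst h s (mconst a) = h a"
  by (simp add: msubst_single)

lemma msubst_mvar [simp]: "rhom h \<Longrightarrow> msubst h s (mvar v) = s v"
  by (simp add: msubst_single mvar_def rhom_simps(1) mon_eval_def)

lemma rhom_msubst: "rhom h \<Longrightarrow> rhom (msubst h s)"
  by (intro rhomI) (auto simp: msubst_add msubst_mult rhom_simps(1) simp flip: single_one)

lemma rhom_mconst [simp]: "rhom mconst"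
  by (auto intro!: rhomI simp: single_add mult_single)

lemma rhom_eval: "rhom (\<lambda>p. mpoly_eval p a)"
  unfolding mpoly_eval_msubst by (rule rhom_msubst) simp

lemmas mpoly_eval_simps [simp] = rhom_simps[OF rhom_eval]

lemma mpoly_eval_mconst [simp]: "mpoly_eval (mconst b) a = b"
  and mpoly_eval_mvar [simp]: "mpoly_eval (mvar v) a = a v"
  by (simp_all add: mpoly_eval_msubst)

lemma rhom_msubst_comp:
  assumes "rhom g" "rhom h"
  shows "g (msubst h s p) = msubst (\<lambda>x. g (h x)) (\<lambda>v. g (s v)) p"
  by (simp add: msubst_def mon_eval_def rhom_simps[OF assms(1)])

lemma mpoly_vars_mconst [simp]: "mpoly_vars (mconst a) = {}"
  by (auto simp: mpoly_vars_def)

lemma mpoly_vars_mvar: "mpoly_vars (mvar v :: ('v, 'a::comm_ring_1) mpoly) \<subseteq> {v}"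
  by (auto simp: mpoly_vars_def mvar_def split: if_splits)

lemma mpoly_vars_add: "mpoly_vars (p + q) \<subseteq> mpoly_vars p \<union> mpoly_vars q"
  using Poly_Mapping.keys_add[of p q] by (auto simp: mpoly_vars_def)

lemma mpoly_vars_mult: "mpoly_vars (p * q) \<subseteq> mpoly_vars p \<union> mpoly_vars (q::('v,'a::comm_ring_1) mpoly)"
proof
  fix v assume "v \<in> mpoly_vars (p * q)"
  then obtain e where e: "e \<in> Poly_Mapping.keys (p * q)" "v \<in> Poly_Mapping.keys e"
    by (auto simp: mpoly_vars_def)
  obtain a b where ab: "e = a + b" "a \<in> Poly_Mapping.keys p" "b \<in> Poly_Mapping.keys q"
    using e(1) keys_mult[of p q] by blast
  then show "v \<in> mpoly_vars p \<union> mpoly_vars q"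
    using e(2) Poly_Mapping.keys_add[of a b] by (auto simp: mpoly_vars_def)
qed

lemma finite_mpoly_vars [simp]: "finite (mpoly_vars p)"
  by (simp add: mpoly_vars_def)

lemma mon_eval_mvar: "mon_eval mvar e = (Poly_Mapping.single e 1 :: ('v,'a::comm_ring_1) mpoly)"
proof -
  have pow: "Poly_Mapping.single (Poly_Mapping.single v 1) (1::'a) ^ n
      = Poly_Mapping.single (Poly_Mapping.single v n) 1" for v :: 'v and n
    by (induction n) (auto simp: mult_single simp flip: single_add)
  have prods: "(\<Prod>v\<in>A. Poly_Mapping.single (Poly_Mapping.single v (f v)) (1::'a)) =
     Poly_Mapping.single (\<Sum>v\<in>A. Poly_Mapping.single v (f v)) 1" for A :: "'v set" and f
    by (induction A rule: infinite_finite_induct) (auto simp: mult_single)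
  show ?thesis
    unfolding mon_eval_def mvar_def pow by (subst (3) mpoly_sum_single[of e]) (rule prods)
qed

lemma msubst_id: "msubst mconst mvar p = p"
  unfolding msubst_def mon_eval_mvar using mpoly_sum_single[of p] by (simp add: mult_single)

lemma msubst_in:
  assumes "mpoly_vars p \<subseteq> V" "\<And>a. h a \<in> S" "\<And>v. v \<in> V \<Longrightarrow> s v \<in> S"
    and "0 \<in> S" "1 \<in> S" "\<And>x y. x \<in> S \<Longrightarrow> y \<in> S \<Longrightarrow> x + y \<in> S" "\<And>x y. x \<in> S \<Longrightarrow> y \<in> S \<Longrightarrow> x * y \<in> S"
  shows "msubst h s p \<in> S"
proof -
  have pow: "x ^ n \<in> S" if "x \<in> S" for x n
    using that assms by (induction n) auto
  have "mon_eval s e \<in> S" if "e \<in> Poly_Mapping.keys p" for e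
  proof -
    have "(\<Prod>v\<in>B. s v ^ Poly_Mapping.lookup e v) \<in> S" if "B \<subseteq> Poly_Mapping.keys e" for B
      using \<open>e \<in> _\<close> assms(1) that
      by (induction B rule: infinite_finite_induct) (auto intro!: assms pow simp: mpoly_vars_def)
    then show ?thesis by (simp add: mon_eval_def)
  qed
  then have "(\<Sum>e\<in>B. h (Poly_Mapping.lookup p e) * mon_eval s e) \<in> S"
    if "B \<subseteq> Poly_Mapping.keys p" for B
    using that by (induction B rule: infinite_finite_induct) (auto intro!: assms)
  then show ?thesis by (simp add: msubst_def)
qed

lemma mpoly_induct [consumes 1, case_names const var add mult]:
  assumes "mpoly_vars p \<subseteq> V" "\<And>a. P (mconst a)" "\<And>v. v \<in> V \<Longrightarrow> P (mvar v)"
    "\<And>p q. P p \<Longrightarrow> P q \<Longrightarrow> P (p + q)" "\<And>p q. P p \<Longrightarrow> P q \<Longrightarrow> P (p * q)"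
  shows "P p"
proof -
  have "msubst mconst mvar p \<in> Collect P"
    by (rule msubst_in[OF assms(1)]) (use assms(2)[of 0] assms(2)[of 1] assms in auto)
  then show ?thesis by (simp add: msubst_id)
qed

lemma msubst_cong:
  assumes "\<And>v. v \<in> mpoly_vars p \<Longrightarrow> s v = s' v"
  shows "msubst h s p = msubst h s' p"
  unfolding msubst_def mon_eval_def
  by (intro sum.cong prod.cong refl arg_cong2[of _ _ _ _ "(*)"] arg_cong2[of _ _ _ _ "(^)"])
    (use assms in \<open>auto simp: mpoly_vars_def\<close>)

lemma mpoly_eval_cong:
  "(\<And>v. v \<in> mpoly_vars p \<Longrightarrow> a v = b v) \<Longrightarrow> mpoly_eval p a = mpoly_eval p b"
  unfolding mpoly_eval_msubst by (rule msubst_cong)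

section \<open>Polynomials in a given set of variables\<close>

definition Pol :: "'v set \<Rightarrow> ('v, 'a::comm_ring_1) mpoly set" where
  "Pol V = {p. mpoly_vars p \<subseteq> V}"

lemma Pol_mconst [simp]: "mconst a \<in> Pol V" and Pol_mvar: "v \<in> V \<Longrightarrow> mvar v \<in> Pol V"
  and Pol_add: "p \<in> Pol V \<Longrightarrow> q \<in> Pol V \<Longrightarrow> p + q \<in> Pol V"
  and Pol_mult: "p \<in> Pol V \<Longrightarrow> q \<in> Pol V \<Longrightarrow> p * q \<in> Pol V"
  and Pol_mono: "V \<subseteq> W \<Longrightarrow> p \<in> Pol V \<Longrightarrow> p \<in> Pol W"
  using mpoly_vars_add[of p q] mpoly_vars_mult[of p q] mpoly_vars_mvar[of v]
  by (auto simp: Pol_def)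

lemma Pol_0 [simp]: "0 \<in> Pol V" and Pol_1 [simp]: "1 \<in> Pol V"
  using Pol_mconst[of 0 V] Pol_mconst[of 1 V] by (auto simp del: Pol_mconst)

lemma Pol_uminus: "p \<in> Pol V \<Longrightarrow> - p \<in> Pol V"
  using Pol_mult[OF Pol_mconst[of "-1" V], of p] by (simp add: single_uminus)

lemma Pol_diff: "p \<in> Pol V \<Longrightarrow> q \<in> Pol V \<Longrightarrow> p - q \<in> Pol V"
  using Pol_add[OF _ Pol_uminus, of p V q] by simp

lemma Pol_sum: "(\<And>i. i \<in> I \<Longrightarrow> f i \<in> Pol V) \<Longrightarrow> sum f I \<in> Pol V"
  by (induction I rule: infinite_finite_induct) (auto intro: Pol_add)

lemma Pol_prod: "(\<And>i. i \<in> I \<Longrightarrow> f i \<in> Pol V) \<Longrightarrow> prod f I \<in> Pol V"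
  by (induction I rule: infinite_finite_induct) (auto intro: Pol_mult)

lemma Pol_power: "p \<in> Pol V \<Longrightarrow> p ^ n \<in> Pol V"
  by (induction n) (auto intro: Pol_mult)

lemma msubst_Pol:
  "p \<in> Pol V \<Longrightarrow> (\<And>v. v \<in> V \<Longrightarrow> s v \<in> Pol W) \<Longrightarrow> msubst mconst s p \<in> Pol W"
  by (rule msubst_in[of _ V]) (auto simp: Pol_def[of V] intro: Pol_add Pol_mult)

text \<open>Makes \<open>y\<close> the main variable. The coefficients keep the type
  \<open>mpoly\<close>, so no type changes along an induction on the set of variables.\<close>

definition uni :: "'v \<Rightarrow> ('v, 'a::comm_ring_1) mpoly \<Rightarrow> ('v, 'a) mpoly poly" where
  "uni y = msubst (\<lambda>a. [:mconst a:]) (\<lambda>v. if v = y then [:0, 1:] else [:mvar v:])"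

lemma rhom_uni: "rhom (uni y)"
  unfolding uni_def by (intro rhom_msubst rhom_comp[OF rhom_pconst]) simp

lemmas uni_simps = rhom_simps[OF rhom_uni]

lemma poly_uni: "poly (uni y p) q = msubst mconst (mvar(y := q)) p"
  unfolding uni_def
  by (subst rhom_msubst_comp[OF rhom_poly])
    (auto intro!: msubst_cong rhom_comp[OF rhom_pconst])

lemma poly_uni_mvar [simp]: "poly (uni y p) (mvar y) = p"
  by (simp add: poly_uni msubst_id)

definition Cpol :: "'v set \<Rightarrow> ('v, 'a::comm_ring_1) mpoly poly set" where
  "Cpol V = {f. \<forall>i. coeff f i \<in> Pol V}"

lemma Cpol_add: "f \<in> Cpol V \<Longrightarrow> g \<in> Cpol V \<Longrightarrow> f + g \<in> Cpol V"
  and Cpol_mult: "f \<in> Cpol V \<Longrightarrow> g \<in> Cpol V \<Longrightarrow> f * g \<in> Cpol V"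
  and Cpol_0 [simp]: "0 \<in> Cpol V"
  and Cpol_pCons: "a \<in> Pol V \<Longrightarrow> f \<in> Cpol V \<Longrightarrow> pCons a f \<in> Cpol V"
  by (auto simp: Cpol_def coeff_mult coeff_pCons split: nat.splits intro!: Pol_sum Pol_add Pol_mult Pol_diff)

lemma uni_Cpol: "p \<in> Pol (insert y V) \<Longrightarrow> uni y p \<in> Cpol V"
  unfolding uni_def
  by (rule msubst_in[of _ "insert y V"])
    (auto simp: Pol_def[of "insert y V"] Cpol_mult Cpol_add intro!: Cpol_pCons Pol_mvar simp: one_pCons)

lemma uni_const:
  assumes "p \<in> Pol V" "y \<notin> V"
  shows "uni y p = [:p:]"
proof -
  have "uni y p = msubst (\<lambda>a. [:mconst a:]) (\<lambda>v. [:mvar v:]) p"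
    unfolding uni_def by (rule msubst_cong) (use assms in \<open>auto simp: Pol_def\<close>)
  also have "\<dots> = [:msubst mconst mvar p:]"
    by (subst rhom_msubst_comp[OF rhom_pconst]) auto
  finally show ?thesis by (simp add: msubst_id)
qed

lemma uni_mvar_self [simp]: "uni y (mvar y) = [:0, 1:]"
  unfolding uni_def by (subst msubst_mvar) (auto intro: rhom_comp[OF rhom_pconst])

lemma rhom_poly_map: "rhom h \<Longrightarrow> h (poly f q) = poly (map_poly h f) (h q)"
  by (induction f) (auto simp: rhom_simps map_poly_pCons)

text \<open>Induction on the variables: with the others fixed, a univariate polynomial has
  infinitely many zeros. Arbitrary infinite sets \<open>B v\<close> are allowed because a polynomial
  will later be known to vanish only on a product of small discs.\<close>

lemma infinite_box_zero:
  fixes p :: "('v, 'a::{field_char_0}) mpoly"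
  assumes "finite V" "p \<in> Pol V" "\<And>v. v \<in> V \<Longrightarrow> infinite (B v)"
    and "\<And>a. (\<And>v. v \<in> V \<Longrightarrow> a v \<in> B v) \<Longrightarrow> mpoly_eval p a = 0"
  shows "p = 0"
  using assms
proof (induction V arbitrary: p rule: finite_induct)
  case empty
  then have "mpoly_vars p = {}" by (auto simp: Pol_def)
  then have "\<forall>e\<in>Poly_Mapping.keys p. e = 0" by (auto simp: mpoly_vars_def)
  then have p: "p = mconst (Poly_Mapping.lookup p 0)"
    by (intro poly_mapping_eqI) (auto simp: lookup_single when_def in_keys_iff)
  then have "mpoly_eval p (\<lambda>_. 0) = Poly_Mapping.lookup p 0"
    by (metis mpoly_eval_mconst)
  with empty show ?case using p by auto
next
  case (insert y V)
  let ?f = "uni y p"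
  have f: "?f \<in> Cpol V" by (rule uni_Cpol) fact
  have ev: "mpoly_eval (poly ?f (mvar y)) (a(y := t)) =
      poly (map_poly (\<lambda>q. mpoly_eval q a) ?f) t" for a t
  proof -
    have "mpoly_eval (coeff ?f i) (a(y := t)) = mpoly_eval (coeff ?f i) a" for i
      by (rule mpoly_eval_cong) (use f insert(2) in \<open>auto simp: Cpol_def Pol_def\<close>)
    then have "map_poly (\<lambda>q. mpoly_eval q (a(y := t))) ?f = map_poly (\<lambda>q. mpoly_eval q a) ?f"
      by (intro poly_eqI) (simp add: coeff_map_poly)
    then show ?thesis using rhom_poly_map[OF rhom_eval, of ?f "mvar y" "a(y := t)"] by simp
  qed
  have "coeff ?f i = 0" for i
  proof (rule insert.IH)
    show "coeff ?f i \<in> Pol V" using f by (auto simp: Cpol_def)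
    show "infinite (B v)" if "v \<in> V" for v using insert that by auto
    fix a assume a: "\<And>v. v \<in> V \<Longrightarrow> a v \<in> B v"
    have "poly (map_poly (\<lambda>q. mpoly_eval q a) ?f) t = 0" if "t \<in> B y" for t
      unfolding ev[symmetric] poly_uni_mvar
      by (rule insert.prems) (use a that in auto)
    then have "B y \<subseteq> {t. poly (map_poly (\<lambda>q. mpoly_eval q a) ?f) t = 0}" by auto
    moreover have "infinite (B y)" using insert by auto
    ultimately have "map_poly (\<lambda>q. mpoly_eval q a) ?f = 0"
      using finite_subset poly_roots_finite by blast
    then show "mpoly_eval (coeff ?f i) a = 0"
      by (metis coeff_0 coeff_map_poly mpoly_eval_simps(4))
  qed
  then have "?f = 0" by (simp add: poly_eq_iff)
  then show ?case using poly_uni_mvar[of y p] by simp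
qed

lemma mpoly_eqI:
  fixes p q :: "('v, 'a::field_char_0) mpoly"
  assumes "\<And>a. mpoly_eval p a = mpoly_eval q a"
  shows "p = q"
proof -
  have "p - q = 0"
    by (rule infinite_box_zero[of "mpoly_vars (p - q)" _ "\<lambda>_. UNIV"])
      (auto simp: Pol_def assms infinite_UNIV_char_0)
  then show ?thesis by simp
qed

text \<open>Restriction to the polynomial curve \<open>\<gamma>\<close>; it reduces questions in
  several variables to roots of polynomials in one.\<close>

definition along :: "('v \<Rightarrow> 'a::comm_ring_1 poly) \<Rightarrow> ('v, 'a) mpoly \<Rightarrow> 'a poly" where
  "along = msubst (\<lambda>x. [:x:])"

lemma poly_along [simp]: "poly (along \<gamma> p) s = mpoly_eval p (\<lambda>v. poly (\<gamma> v) s)"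
  unfolding along_def mpoly_eval_msubst by (subst rhom_msubst_comp[OF rhom_poly]) auto

text \<open>\<open>Poly_Mapping\<close> provides the class \<open>idom\<close> only for linearly ordered variables, which
  \<open>'n \<times> 'n multiset\<close> are not.\<close>

lemma mpoly_mult_eq_0:
  fixes p q :: "('v, 'a::field_char_0) mpoly"
  assumes "p * q = 0"
  shows "p = 0 \<or> q = 0"
proof (rule ccontr)
  assume "\<not> ?thesis"
  then obtain a b where ab: "mpoly_eval p a \<noteq> 0" "mpoly_eval q b \<noteq> 0"
    by (metis mpoly_eqI mpoly_eval_simps(4))
  \<comment> \<open>The line from \<open>a\<close> at parameter 0 to \<open>b\<close> at parameter
    1; neither restriction vanishes identically.\<close>
  define \<gamma> where "\<gamma> v = [:a v, b v - a v:]" for v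
  have "poly (along \<gamma> p) 0 \<noteq> 0" "poly (along \<gamma> q) 1 \<noteq> 0"
    using ab by (auto simp: \<gamma>_def)
  then have "along \<gamma> p * along \<gamma> q \<noteq> 0" by (metis mult_eq_0_iff poly_0)
  moreover have "poly (along \<gamma> p * along \<gamma> q) s = 0" for s
    using arg_cong[OF assms, of "\<lambda>p. mpoly_eval p (\<lambda>v. poly (\<gamma> v) s)"] by simp
  ultimately show False using poly_all_0_iff_0 by blast
qed

lemma mpoly_mult_cancel:
  fixes p q r :: "('v, 'a::field_char_0) mpoly"
  assumes "p \<noteq> 0" "p * q = p * r"
  shows "q = r"
  using mpoly_mult_eq_0[of p "q - r"] assms by (simp add: algebra_simps)

lemma degree_mult_mpoly:
  fixes f g :: "('v, 'a::field_char_0) mpoly poly"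
  assumes "f \<noteq> 0" "g \<noteq> 0"
  shows "Polynomial.degree (f * g) = Polynomial.degree f + Polynomial.degree g"
proof (rule antisym)
  show "Polynomial.degree (f * g) \<le> Polynomial.degree f + Polynomial.degree g"
    by (rule degree_mult_le)
  have "coeff (f * g) (Polynomial.degree f + Polynomial.degree g) \<noteq> 0"
    unfolding coeff_mult_degree_sum using assms mpoly_mult_eq_0[of "lead_coeff f" "lead_coeff g"] by auto
  then show "Polynomial.degree f + Polynomial.degree g \<le> Polynomial.degree (f * g)"
    by (rule le_degree)
qed

lemma uni_eq_0_iff [simp]: "uni y p = 0 \<longleftrightarrow> p = 0"
  using poly_uni_mvar[of y p] by (metis poly_0 uni_simps(4))

lemma Pol_iff_degree_uni:
  assumes "p \<in> Pol (insert y V)" "y \<notin> V"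
  shows "p \<in> Pol V \<longleftrightarrow> Polynomial.degree (uni y p) = 0"
proof
  assume "p \<in> Pol V" then show "Polynomial.degree (uni y p) = 0"
    using uni_const assms by fastforce
next
  assume "Polynomial.degree (uni y p) = 0"
  then obtain c where c: "uni y p = [:c:]" by (rule degree_eq_zeroE)
  then have "c \<in> Pol V" using uni_Cpol[OF assms(1)] by (auto simp: Cpol_def dest: spec[of _ 0])
  moreover have "p = c" using poly_uni_mvar[of y p] c by simp
  ultimately show "p \<in> Pol V" by simp
qed

text \<open>Degrees in each variable add up in a product of nonzero factors, so a variable occurring
  in \<open>p\<close> occurs in \<open>p * q\<close>.\<close>

lemma Pol_factor:
  fixes p q :: "('v, 'a::field_char_0) mpoly"
  assumes "p * q \<in> Pol V" "p \<noteq> 0" "q \<noteq> 0"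
  shows "p \<in> Pol V"
proof (rule ccontr)
  assume "p \<notin> Pol V"
  then obtain y where y: "y \<in> mpoly_vars p" "y \<notin> V" by (auto simp: Pol_def)
  define W where "W = mpoly_vars p - {y}"
  have "p \<in> Pol (insert y W)" "p \<notin> Pol W" "y \<notin> W" using y by (auto simp: Pol_def W_def)
  then have "Polynomial.degree (uni y p) \<noteq> 0" using Pol_iff_degree_uni[of p y W] by simp
  moreover have "Polynomial.degree (uni y (p * q)) = 0"
    using uni_const[OF assms(1) y(2)] by simp
  ultimately show False
    using degree_mult_mpoly[of "uni y p" "uni y q"] assms by (simp add: uni_simps)
qed

text \<open>A marker variable records the weight: the coefficient at \<open>j\<close> is the
  component of \<open>p\<close> of weight \<open>j\<close>.\<close>

definition graded :: "('v \<Rightarrow> nat) \<Rightarrow> ('v, 'a::comm_ring_1) mpoly \<Rightarrow> ('v, 'a) mpoly poly" where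
  "graded w = msubst (\<lambda>a. [:mconst a:]) (\<lambda>v. monom (mvar v) (w v))"

lemma rhom_graded: "rhom (graded w)"
  unfolding graded_def by (intro rhom_msubst rhom_comp[OF rhom_pconst]) simp

lemma poly_graded: "poly (graded w p) q = msubst mconst (\<lambda>v. mvar v * q ^ w v) p"
  unfolding graded_def
  by (subst rhom_msubst_comp[OF rhom_poly]) (auto simp: poly_monom intro: rhom_comp[OF rhom_pconst])

lemma poly_graded_1 [simp]: "poly (graded w p) 1 = p"
  by (simp add: poly_graded msubst_id)

lemma graded_eq_0_iff [simp]: "graded w p = 0 \<longleftrightarrow> p = 0"
  using poly_graded_1[of w p] by (metis poly_0 rhom_simps(4)[OF rhom_graded])

definition tdeg :: "('v, 'a::comm_ring_1) mpoly \<Rightarrow> nat" where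
  "tdeg p = Polynomial.degree (graded (\<lambda>_. 1) p)"

lemma tdeg_mult:
  fixes p q :: "('v, 'a::field_char_0) mpoly"
  shows "p \<noteq> 0 \<Longrightarrow> q \<noteq> 0 \<Longrightarrow> tdeg (p * q) = tdeg p + tdeg q"
  by (simp add: tdeg_def rhom_simps[OF rhom_graded] degree_mult_mpoly)

lemma tdeg_mconst [simp]: "tdeg (mconst a :: ('v, 'a::comm_ring_1) mpoly) = 0"
proof -
  have "graded w (mconst a) = [:mconst a:]" for w :: "'v \<Rightarrow> nat"
    unfolding graded_def by (subst msubst_mconst) (auto intro: rhom_comp[OF rhom_pconst])
  then show ?thesis by (simp add: tdeg_def)
qed

lemma tdeg_eq_0:
  assumes "tdeg p = 0"
  obtains a where "p = mconst a"
proof -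
  obtain c where c: "graded (\<lambda>_. 1) p = [:c:]"
    using assms unfolding tdeg_def by (rule degree_eq_zeroE)
  then have "p = poly (graded (\<lambda>_. 1) p) 0" using poly_graded_1[of "\<lambda>_. 1" p] by simp
  also have "\<dots> = mconst (mpoly_eval p (\<lambda>_. 0))"
    unfolding poly_graded mpoly_eval_msubst
    by (subst rhom_msubst_comp[OF rhom_mconst]) (auto intro!: msubst_cong)
  finally show ?thesis by (rule that)
qed

lemma mpoly_unit_iff:
  fixes p :: "('v, 'a::field_char_0) mpoly"
  shows "p dvd 1 \<longleftrightarrow> p \<noteq> 0 \<and> tdeg p = 0"
proof
  assume "p dvd 1"
  then obtain q where q: "1 = p * q" by (rule dvdE)
  then have "p \<noteq> 0" "q \<noteq> 0" by auto
  moreover have "tdeg (1 :: ('v, 'a) mpoly) = 0" by (metis single_one tdeg_mconst)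
  ultimately show "p \<noteq> 0 \<and> tdeg p = 0" using tdeg_mult[of p q] by (simp flip: q)
next
  assume p: "p \<noteq> 0 \<and> tdeg p = 0"
  then obtain a where a: "p = mconst a" using tdeg_eq_0 by blast
  with p have "a \<noteq> 0" by auto
  then have "1 = p * mconst (inverse a)" by (simp add: a mult_single)
  then show "p dvd 1" by (rule dvdI)
qed

lemma irreducible_factor_ex:
  fixes a :: "('v, 'a::field_char_0) mpoly"
  assumes "a \<in> Pol V" "a \<noteq> 0" "tdeg a \<noteq> 0"
  obtains p b where "irreducible p" "p \<in> Pol V" "b \<in> Pol V" "a = p * b" "b \<noteq> 0" "tdeg b < tdeg a"
proof -
  have "\<exists>p. irreducible p \<and> p dvd a"
    using assms
  proof (induction "tdeg a" arbitrary: a rule: less_induct)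
    case less
    show ?case
    proof (cases "irreducible a")
      case False
      then obtain b c where bc: "a = b * c" "\<not> b dvd 1" "\<not> c dvd 1"
        using less.prems by (auto simp: irreducible_def mpoly_unit_iff)
      then have nz: "b \<noteq> 0" "c \<noteq> 0" using less.prems by auto
      then have "tdeg b < tdeg a" "tdeg b \<noteq> 0"
        using bc by (auto simp: tdeg_mult mpoly_unit_iff)
      then have "\<exists>p. irreducible p \<and> p dvd b"
        using less.hyps[of b] Pol_factor[of b c V] less.prems bc nz by auto
      then show ?thesis using bc by auto
    qed auto
  qed
  then obtain p b where p: "irreducible p" "a = p * b" by auto
  then have "p \<noteq> 0" "b \<noteq> 0" "tdeg p \<noteq> 0"
    using assms by (auto simp: irreducible_def mpoly_unit_iff)
  then show ?thesis
    using that[of p b] p Pol_factor[of p b V] Pol_factor[of b p V] assms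
    by (auto simp: tdeg_mult mult.commute)
qed

section \<open>Unique factorization\<close>

text \<open>Relative to \<open>V\<close>, since irreducible polynomials are shown to be prime by
  induction on the set of variables.\<close>

definition prime_on :: "'v set \<Rightarrow> ('v, 'a::field_char_0) mpoly \<Rightarrow> bool" where
  "prime_on V p \<longleftrightarrow> (\<forall>G\<in>Pol V. \<forall>H\<in>Pol V. p dvd G * H \<longrightarrow> p dvd G \<or> p dvd H)"

lemma dvd_iff_coeffs:
  assumes "p \<in> Pol V" "y \<notin> V"
  shows "p dvd G \<longleftrightarrow> (\<forall>i. p dvd coeff (uni y G) i)"
proof
  assume "p dvd G"
  then obtain q where "G = p * q" ..
  then have "uni y G = [:p:] * uni y q" using uni_const[OF assms] by (simp add: uni_simps)
  then show "\<forall>i. p dvd coeff (uni y G) i" by simp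
next
  assume "\<forall>i. p dvd coeff (uni y G) i"
  then have "p dvd poly (uni y G) (mvar y)" unfolding poly_altdef by (intro dvd_sum dvd_mult2) auto
  then show "p dvd G" by simp
qed

text \<open>Gauss's lemma: with \<open>i\<close> and \<open>j\<close> the first coefficients of
  \<open>G\<close> and \<open>H\<close> not divisible by \<open>p\<close>, all other terms of
  coefficient \<open>i + j\<close> of the product are divisible by \<open>p\<close>.\<close>

lemma prime_on_insert:
  assumes "p \<in> Pol V" "y \<notin> V" "prime_on V p"
  shows "prime_on (insert y V) p"
  unfolding prime_on_def
proof (intro ballI impI, rule ccontr)
  fix G H assume G: "G \<in> Pol (insert y V)" and H: "H \<in> Pol (insert y V)" and dvd: "p dvd G * H"
    and n: "\<not> (p dvd G \<or> p dvd H)"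
  let ?f = "uni y G" and ?g = "uni y H"
  define i where "i = (LEAST i. \<not> p dvd coeff ?f i)"
  define j where "j = (LEAST j. \<not> p dvd coeff ?g j)"
  have i: "\<not> p dvd coeff ?f i" and j: "\<not> p dvd coeff ?g j"
    using n dvd_iff_coeffs[OF assms(1,2)] unfolding i_def j_def by (metis LeastI)+
  have i': "p dvd coeff ?f k" if "k < i" for k using not_less_Least that unfolding i_def by blast
  have j': "p dvd coeff ?g k" if "k < j" for k using not_less_Least that unfolding j_def by blast
  have "coeff (?f * ?g) (i + j) = (\<Sum>k\<le>i + j. coeff ?f k * coeff ?g (i + j - k))"
    by (rule coeff_mult)
  also have "\<dots> = coeff ?f i * coeff ?g j + (\<Sum>k\<in>{..i + j} - {i}. coeff ?f k * coeff ?g (i + j - k))"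
    by (subst sum.remove[of _ i]) auto
  finally have eq: "coeff ?f i * coeff ?g j =
      coeff (?f * ?g) (i + j) - (\<Sum>k\<in>{..i + j} - {i}. coeff ?f k * coeff ?g (i + j - k))" by simp
  have "p dvd coeff ?f k * coeff ?g (i + j - k)" if "k \<in> {..i + j} - {i}" for k
    using that i'[of k] j'[of "i + j - k"] by (cases "k < i") auto
  then have "p dvd coeff ?f i * coeff ?g j"
    unfolding eq using dvd dvd_iff_coeffs[OF assms(1,2), of "G * H"]
    by (intro dvd_diff dvd_sum) (auto simp: uni_simps)
  moreover have "coeff ?f i \<in> Pol V" "coeff ?g j \<in> Pol V"
    using uni_Cpol[OF G] uni_Cpol[OF H] by (auto simp: Cpol_def)
  ultimately show False using assms(3) i j by (auto simp: prime_on_def)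
qed

text \<open>Pseudo-division in \<open>y\<close>: as leading coefficients cannot be divided,
  \<open>F\<close> is multiplied by that of \<open>S\<close> in each step. The accumulated factor
  \<open>a\<close> is free of \<open>y\<close>.\<close>

lemma mpoly_pseudo_div:
  fixes F S :: "('v, 'a::field_char_0) mpoly"
  assumes "F \<in> Pol (insert y V)" "S \<in> Pol (insert y V)" "S \<noteq> 0" "y \<notin> V"
  shows "\<exists>a\<in>Pol V. \<exists>q\<in>Pol (insert y V). a \<noteq> 0 \<and> (a * F - q * S = 0 \<or>
    Polynomial.degree (uni y (a * F - q * S)) < Polynomial.degree (uni y S))"
  using assms(1)
proof (induction "Polynomial.degree (uni y F)" arbitrary: F rule: less_induct)
  case less
  show ?case
  proof (cases "F = 0 \<or> Polynomial.degree (uni y F) < Polynomial.degree (uni y S)")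
    case True
    then show ?thesis by (intro bexI[of _ 1] bexI[of _ 0]) auto
  next
    case False
    let ?f = "uni y F" and ?s = "uni y S"
    define n where "n = Polynomial.degree ?f"
    define k where "k = n - Polynomial.degree ?s"
    define b where "b = lead_coeff ?s"
    define q where "q = lead_coeff ?f * mvar y ^ k"
    have b: "b \<in> Pol V" "b \<noteq> 0" and lf: "lead_coeff ?f \<in> Pol V"
      using uni_Cpol[OF assms(2)] uni_Cpol[OF less.prems] assms(3) by (auto simp: Cpol_def b_def)
    have q: "q \<in> Pol (insert y V)"
      unfolding q_def by (intro Pol_mult Pol_power Pol_mvar Pol_mono[OF _ lf]) auto
    define F' where "F' = b * F - q * S"
    have F': "F' \<in> Pol (insert y V)"
      unfolding F'_def by (intro Pol_mult Pol_diff q assms less.prems Pol_mono[OF _ b(1)]) auto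
    have uF': "uni y F' = Polynomial.smult b ?f - monom (lead_coeff ?f) k * ?s"
      using uni_const[OF b(1) assms(4)] uni_const[OF lf assms(4)]
      by (simp add: F'_def q_def uni_simps monom_altdef)
    have "Polynomial.degree (uni y F') \<le> n"
      unfolding uF'
    proof (rule degree_diff_le)
      show "Polynomial.degree (Polynomial.smult b ?f) \<le> n" by (simp add: n_def degree_smult_le)
      have "Polynomial.degree (monom (lead_coeff ?f) k * ?s) \<le> k + Polynomial.degree ?s"
        by (rule order.trans[OF degree_mult_le add_right_mono[OF degree_monom_le]])
      then show "Polynomial.degree (monom (lead_coeff ?f) k * ?s) \<le> n"
        using False by (auto simp: k_def n_def)
    qed
    moreover have "coeff (uni y F') n = 0"
      using False mult.commute[of "lead_coeff ?s" "lead_coeff ?f"]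
      by (simp add: uF' coeff_monom_mult n_def k_def b_def not_less)
    ultimately have cs: "F' = 0 \<or> Polynomial.degree (uni y F') < Polynomial.degree (uni y F)"
      using eq_zero_or_degree_less[of "uni y F'" n] by (auto simp: n_def)
    show ?thesis
    proof (cases "F' = 0")
      case True
      then show ?thesis using b q by (auto simp: F'_def)
    next
      case False
      with cs less.hyps[of F'] F' obtain a r where ar: "a \<in> Pol V" "a \<noteq> 0" "r \<in> Pol (insert y V)"
        "a * F' - r * S = 0 \<or> Polynomial.degree (uni y (a * F' - r * S)) < Polynomial.degree ?s" by auto
      have eq: "a * F' - r * S = (a * b) * F - (a * q + r) * S"
        by (simp add: F'_def algebra_simps)
      have "a * b \<noteq> 0" using mpoly_mult_eq_0 ar b by blast
      moreover have "a * q + r \<in> Pol (insert y V)"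
        by (intro Pol_add Pol_mult ar q Pol_mono[OF _ ar(1)]) auto
      moreover have "a * b \<in> Pol V" using ar b by (intro Pol_mult)
      ultimately show ?thesis using ar(4) unfolding eq by blast
    qed
  qed
qed

lemma irreducible_mult_notin_Pol:
  fixes p w :: "('v, 'a::field_char_0) mpoly"
  assumes "irreducible (p * w)" "\<not> p dvd 1" "p \<in> Pol V"
  shows "p * w \<in> Pol V"
proof -
  have "w dvd 1" using assms by (auto simp: irreducible_def)
  then obtain a where "w = mconst a" by (auto simp: mpoly_unit_iff elim: tdeg_eq_0)
  then show ?thesis using assms by (auto intro: Pol_mult)
qed

section \<open>The induction step: an irreducible \<open>R\<close> involving the new variable
  \<open>y\<close>\<close>

context
  fixes V :: "'v set" and y :: 'v and R :: "('v, 'a::field_char_0) mpoly"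
  assumes ufd: "\<And>p::('v, 'a) mpoly. p \<in> Pol V \<Longrightarrow> irreducible p \<Longrightarrow> prime_on V p"
    and y: "y \<notin> V" and R: "R \<in> Pol (insert y V)" "irreducible R" "R \<notin> Pol V"
begin

lemma prime_factor_cases:
  fixes p G H :: "('v, 'a) mpoly"
  assumes "p \<in> Pol V" "irreducible p" "G \<in> Pol (insert y V)" "H \<in> Pol (insert y V)" "p dvd G * H"
  shows "p dvd G \<or> p dvd H"
  using prime_on_insert[OF assms(1) y ufd[OF assms(1,2)]] assms unfolding prime_on_def by blast

text \<open>Irreducible factors \<open>p\<close> of \<open>a\<close> are stripped one by one: by
  Gauss's lemma \<open>p\<close> divides \<open>R\<close> or the cofactor \<open>s\<close>, and it
  cannot divide \<open>R\<close>, which is irreducible and involves \<open>y\<close>.\<close>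

lemma dvd_cancel_free:
  assumes "a \<in> Pol V" "a \<noteq> 0" "Q \<in> Pol (insert y V)" "R dvd a * Q"
  shows "R dvd Q"
  using assms
proof (induction "tdeg a" arbitrary: a rule: less_induct)
  case less
  show ?case
  proof (cases "tdeg a = 0")
    case True
    then have "a dvd 1" using less.prems mpoly_unit_iff by blast
    then obtain a' where a': "1 = a * a'" ..
    have "R dvd a' * (a * Q)" using less.prems(4) by (rule dvd_mult)
    moreover have "a' * (a * Q) = (a * a') * Q" by (simp add: algebra_simps)
    ultimately show ?thesis using a' by simp
  next
    case False
    obtain p b where p: "irreducible p" "p \<in> Pol V" "b \<in> Pol V" "a = p * b" "b \<noteq> 0" "tdeg b < tdeg a"
      using irreducible_factor_ex[of a V] less.prems False by blast
    have p0: "p \<noteq> 0" "\<not> p dvd 1" using p(1) by (auto simp: irreducible_def)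
    obtain s where s: "a * Q = R * s" using less.prems by (auto elim: dvdE)
    show ?thesis
    proof (cases "Q = 0")
      case False
      then have "a * Q \<noteq> 0" using less.prems mpoly_mult_eq_0 by blast
      then have s0: "s \<noteq> 0" "R \<noteq> 0" using s by auto
      have "s * R \<in> Pol (insert y V)"
        using less.prems s Pol_mult[OF Pol_mono[OF _ less.prems(1)] less.prems(3)]
        by (auto simp: mult.commute)
      then have "s \<in> Pol (insert y V)" using Pol_factor s0 by blast
      moreover have "p dvd R * s" by (simp add: p flip: s)
      ultimately have "p dvd R \<or> p dvd s" using prime_factor_cases[OF p(2,1) R(1)] by blast
      moreover have "\<not> p dvd R"
      proof
        assume "p dvd R"
        then obtain w where "R = p * w" ..
        then show False using irreducible_mult_notin_Pol[of p w V] R p0 p by simp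
      qed
      ultimately obtain s' where "s = p * s'" by auto
      then have "p * (b * Q) = p * (R * s')" using s p by (simp add: algebra_simps)
      then have "b * Q = R * s'" using mpoly_mult_cancel p0 by blast
      then show ?thesis using less.hyps[OF p(6,3,5)] less.prems by simp
    qed simp
  qed
qed

text \<open>The irreducible factors of \<open>a\<close> are stripped from \<open>q\<close> or from
  \<open>S\<close>. What remains of \<open>S\<close> still involves \<open>y\<close>, so it is a
  nonunit factor of the irreducible \<open>R\<close> and equals \<open>R\<close> up to a
  unit.\<close>

lemma dvd_split_free:
  assumes "a \<in> Pol V" "a \<noteq> 0" "q \<in> Pol (insert y V)" "S \<in> Pol (insert y V)" "S \<notin> Pol V" "a * R = q * S"
  shows "R dvd S"
  using assms
proof (induction "tdeg a" arbitrary: a q S rule: less_induct)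
  case less
  show ?case
  proof (cases "tdeg a = 0")
    case True
    then have "a dvd 1" using less.prems mpoly_unit_iff by blast
    then obtain a' where a': "1 = a * a'" ..
    have "R = (a * a') * R" using a' by simp
    also have "\<dots> = a' * (a * R)" by (simp add: algebra_simps)
    finally have Req: "R = (a' * q) * S" unfolding less.prems(6) by (simp only: mult.assoc)
    moreover have "\<not> S dvd 1"
      using less.prems(5) mpoly_unit_iff[of S] by (metis Pol_mconst tdeg_eq_0)
    ultimately have "a' * q dvd 1" using irreducibleD[OF R(2), of "a' * q" S] by blast
    then obtain w where "1 = (a' * q) * w" ..
    then have "S = (a' * q * w) * S" by simp
    also have "\<dots> = (a' * q * S) * w" by (simp add: algebra_simps)
    finally have "S = R * w" using Req by simp
    then show ?thesis by simp
  next
    case False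
    obtain p b where p: "irreducible p" "p \<in> Pol V" "b \<in> Pol V" "a = p * b" "b \<noteq> 0" "tdeg b < tdeg a"
      using irreducible_factor_ex[of a V] less.prems False by blast
    have p0: "p \<noteq> 0" "\<not> p dvd 1" using p(1) by (auto simp: irreducible_def)
    have pV: "p * r \<in> Pol (insert y V) \<Longrightarrow> p * r \<noteq> 0 \<Longrightarrow> r \<in> Pol (insert y V)" for r
      using Pol_factor[of r p "insert y V"] by (cases "p = 0"; cases "r = 0") (auto simp: mult.commute)
    have nz: "q \<noteq> 0" "S \<noteq> 0"
      using less.prems R(2) mpoly_mult_eq_0[of a R] by (auto simp: irreducible_def)
    have "p dvd q * S" by (simp add: p flip: less.prems(6))
    then consider "p dvd q" | "p dvd S" using prime_factor_cases[OF p(2,1)] less.prems by blast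
    then show ?thesis
    proof cases
      case 1
      then obtain q' where q': "q = p * q'" ..
      then have "p * (b * R) = p * (q' * S)" using less.prems(6) p by (simp add: algebra_simps)
      then have "b * R = q' * S" using mpoly_mult_cancel p0 by blast
      moreover have "q' \<in> Pol (insert y V)" using pV q' less.prems nz by blast
      ultimately show ?thesis using less.hyps[OF p(6,3,5)] less.prems by blast
    next
      case 2
      then obtain S' where S': "S = p * S'" ..
      then have "p * (b * R) = p * (q * S')" using less.prems(6) p by (simp add: algebra_simps)
      then have "b * R = q * S'" using mpoly_mult_cancel p0 by blast
      moreover have "S' \<in> Pol (insert y V)" using pV S' less.prems nz by blast
      moreover have "S' \<notin> Pol V" using Pol_mult[OF p(2)] S' less.prems by blast
      ultimately have "R dvd S'" using less.hyps[OF p(6,3,5)] less.prems by blast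
      then show ?thesis using S' by simp
    qed
  qed
qed

text \<open>An element \<open>S\<close> of least \<open>y\<close>-degree in the ideal \<open>(R, G)\<close> divides multiples of \<open>R\<close> and \<open>G\<close> by
  polynomials free of \<open>y\<close>, so \<open>R dvd S\<close> and \<open>R dvd G\<close> unless \<open>S\<close> is itself free of \<open>y\<close>.\<close>

lemma bezout_free_aux:
  assumes G: "G \<in> Pol (insert y V)" and ndvd: "\<not> R dvd G"
  shows "\<exists>u\<in>Pol (insert y V). \<exists>v\<in>Pol (insert y V). u * R + v * G \<in> Pol V \<and> u * R + v * G \<noteq> 0"
proof -
  define I where "I = {u * R + v * G | u v. u \<in> Pol (insert y V) \<and> v \<in> Pol (insert y V)}"
  have IV: "I \<subseteq> Pol (insert y V)" by (auto simp: I_def intro!: Pol_add Pol_mult R G)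
  have RI: "R \<in> I" and GI: "G \<in> I"
    unfolding I_def
    by (rule CollectI, rule exI[of _ 1], rule exI[of _ 0], simp,
        rule CollectI, rule exI[of _ 0], rule exI[of _ 1], simp)
  have Icl: "a * F - q * S \<in> I" if th: "a \<in> Pol V" "q \<in> Pol (insert y V)" "F \<in> I" "S \<in> I" for a q F S
  proof -
    obtain u v u' v' where *: "F = u * R + v * G" "S = u' * R + v' * G"
      "u \<in> Pol (insert y V)" "v \<in> Pol (insert y V)" "u' \<in> Pol (insert y V)" "v' \<in> Pol (insert y V)"
      using th(3,4) unfolding I_def by blast
    have "a * F - q * S = (a * u - q * u') * R + (a * v - q * v') * G"
      by (simp add: * algebra_simps)
    moreover have "a * u - q * u' \<in> Pol (insert y V)" "a * v - q * v' \<in> Pol (insert y V)"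
      by (intro Pol_diff Pol_mult * th Pol_mono[OF _ th(1)] subset_insertI)+
    ultimately show ?thesis by (auto simp: I_def)
  qed
  have "R \<noteq> 0" using R by (auto simp: irreducible_def)
  then obtain S where S: "S \<in> I" "S \<noteq> 0"
    and Smin: "\<And>F. F \<in> I \<Longrightarrow> F \<noteq> 0 \<Longrightarrow> Polynomial.degree (uni y S) \<le> Polynomial.degree (uni y F)"
    using ex_has_least_nat[of "\<lambda>F. F \<in> I \<and> F \<noteq> 0" R "\<lambda>F. Polynomial.degree (uni y F)"] RI by blast
  have div: "\<exists>a\<in>Pol V. \<exists>q\<in>Pol (insert y V). a \<noteq> 0 \<and> a * F = q * S" if FI: "F \<in> I" for F
  proof -
    obtain a q where aq: "a \<in> Pol V" "q \<in> Pol (insert y V)" "a \<noteq> 0" "a * F - q * S = 0 \<or>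
      Polynomial.degree (uni y (a * F - q * S)) < Polynomial.degree (uni y S)"
      using mpoly_pseudo_div[of F y V S] IV S FI y by blast
    then have "a * F - q * S = 0" using Smin[OF Icl[OF aq(1,2) FI S(1)]] by fastforce
    then show ?thesis using aq by auto
  qed
  have "S \<in> Pol V"
  proof (rule ccontr)
    assume nS: "S \<notin> Pol V"
    obtain a q where "a \<in> Pol V" "q \<in> Pol (insert y V)" "a \<noteq> 0" "a * R = q * S" using div RI by blast
    then have "R dvd S" using dvd_split_free nS S IV by blast
    obtain b q' where b: "b \<in> Pol V" "b \<noteq> 0" "b * G = q' * S" using div GI by blast
    then have "R dvd b * G" using \<open>R dvd S\<close> by simp
    then show False using dvd_cancel_free b G ndvd by blast
  qed
  then show ?thesis using S by (auto simp: I_def)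
qed

end

text \<open>If \<open>R\<close> involves \<open>y\<close> and does not divide \<open>G\<close>, some
  nonzero \<open>u * R + v * G\<close> is free of \<open>y\<close>; its product with
  \<open>H\<close> is a multiple of \<open>R\<close>, and the free factor cancels. If
  \<open>R\<close> is free of \<open>y\<close>, Gauss's lemma lifts primality from
  \<open>V\<close>.\<close>

lemma irreducible_prime_on:
  fixes p :: "('v, 'a::field_char_0) mpoly"
  assumes "finite V" "p \<in> Pol V" "irreducible p"
  shows "prime_on V p"
  using assms
proof (induction V arbitrary: p rule: finite_induct)
  case empty
  have "p = mconst (mpoly_eval p (\<lambda>_. 0))"
    by (rule mpoly_eqI) (use empty in \<open>auto simp: Pol_def intro!: mpoly_eval_cong\<close>)
  then have "tdeg p = 0" by (metis tdeg_mconst)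
  then show ?case using empty by (auto simp: irreducible_def mpoly_unit_iff)
next
  case (insert y V R)
  show ?case
  proof (cases "R \<in> Pol V")
    case True
    then show ?thesis using prime_on_insert[OF _ insert(2) insert.IH] insert.prems by simp
  next
    case False
    show ?thesis unfolding prime_on_def
    proof (intro ballI impI)
      fix G H assume GH: "G \<in> Pol (insert y V)" "H \<in> Pol (insert y V)" "R dvd G * H"
      show "R dvd G \<or> R dvd H"
      proof (cases "R dvd G")
        case ndvd: False
        obtain u v where uv: "u * R + v * G \<in> Pol V" "u * R + v * G \<noteq> 0"
          using bezout_free_aux[OF insert.IH insert(2) insert(4,5) False GH(1) ndvd] by blast
        have "R dvd u * R * H + v * (G * H)" using GH by (intro dvd_add) auto
        then have "R dvd (u * R + v * G) * H" by (simp add: algebra_simps)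
        then show ?thesis
          using dvd_cancel_free[OF insert.IH insert(2) insert(4,5) False uv GH(2)] by blast
      qed simp
    qed
  qed
qed

text \<open>Elimination of \<open>y\<close>. It serves twice: with a coefficient of the forms as
  \<open>y\<close>, to show that a minimal element generates the ideal, and with the parameter of a
  pencil as \<open>y\<close>, to find where its roots give singular systems.\<close>

theorem bezout_free:
  fixes R G :: "('v, 'a::field_char_0) mpoly"
  assumes "finite V" "y \<notin> V" "R \<in> Pol (insert y V)" "irreducible R" "R \<notin> Pol V"
    and "G \<in> Pol (insert y V)" "\<not> R dvd G"
  obtains u v where "u * R + v * G \<in> Pol V" "u * R + v * G \<noteq> 0"
  using bezout_free_aux[OF irreducible_prime_on[OF assms(1)] assms(2-7)] by blast

section \<open>Singular systems of forms\<close>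

definition monom_at :: "'n multiset \<Rightarrow> complex ^ 'n::finite \<Rightarrow> complex" where
  "monom_at \<alpha> x = (\<Prod>j\<in>#\<alpha>. x $ j)"

lemma monom_at_simps [simp]:
  "monom_at {#} x = 1" "monom_at (add_mset j \<alpha>) x = x $ j * monom_at \<alpha> x"
  "monom_at (\<alpha> + \<beta>) x = monom_at \<alpha> x * monom_at \<beta> x" "monom_at (replicate_mset n j) x = x $ j ^ n"
proof -
  show "monom_at {#} x = 1" "monom_at (add_mset j \<alpha>) x = x $ j * monom_at \<alpha> x"
    "monom_at (\<alpha> + \<beta>) x = monom_at \<alpha> x * monom_at \<beta> x" by (simp_all add: monom_at_def)
  show "monom_at (replicate_mset n j) x = x $ j ^ n" by (induction n) (auto simp: monom_at_def)
qed

lemma monom_at_scale: "monom_at \<alpha> (z *s x) = z ^ size \<alpha> * monom_at \<alpha> x"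
  by (induction \<alpha>) (auto simp: algebra_simps)

lemma finite_size_eq [simp]: "finite {\<alpha> :: 'n::finite multiset. size \<alpha> = d}"
proof -
  have "{\<alpha> :: 'n multiset. size \<alpha> = d} \<subseteq> mset ` {js. set js \<subseteq> UNIV \<and> length js = d}"
    by (auto simp: image_iff) (metis ex_mset size_mset)
  with finite_lists_length_eq[of "UNIV :: 'n set" d] show ?thesis by (intro finite_surj[of _ _ mset]) auto
qed

lemma form_eval_monom_at: "form_eval d c i x = (\<Sum>\<alpha> | size \<alpha> = d. c (i, \<alpha>) * monom_at \<alpha> x)"
  by (simp add: form_eval_def monom_at_def)

lemma form_eval_scale: "form_eval d c i (z *s x) = z ^ d * form_eval d c i x"
  unfolding form_eval_monom_at sum_distrib_left
  by (intro sum.cong) (auto simp: monom_at_scale)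

lemma form_eval_lin:
  "form_eval d (\<lambda>v. a v + s * b v) i x = form_eval d a i x + s * form_eval d b i x"
  by (simp add: form_eval_monom_at algebra_simps sum.distrib sum_distrib_left)

lemma form_eval_delta:
  assumes "size \<beta> = d"
  shows "form_eval d (\<lambda>v. if v = (k, \<beta>) then a else 0) i x = (if i = k then a * monom_at \<beta> x else 0)"
  using assms by (auto simp: form_eval_monom_at if_distrib[of "\<lambda>a. a * _"] sum.delta cong: if_cong)

definition cvars :: "nat \<Rightarrow> ('n::finite \<times> 'n multiset) set" where
  "cvars d = {(i, \<alpha>). size \<alpha> = d}"

lemma finite_cvars [simp]: "finite (cvars d :: ('n::finite \<times> 'n multiset) set)"
proof -
  have "cvars d = (UNIV :: 'n set) \<times> {\<alpha>. size \<alpha> = d}" by (auto simp: cvars_def)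
  then show ?thesis by simp
qed

definition singular :: "nat \<Rightarrow> ('n::finite \<times> 'n multiset \<Rightarrow> complex) set" where
  "singular d = {c. \<exists>x. x \<noteq> 0 \<and> (\<forall>i. form_eval d c i x = 0)}"

definition Ecoef :: "nat \<Rightarrow> 'n::finite \<times> 'n multiset \<Rightarrow> complex" where
  "Ecoef d = (\<lambda>(i, \<alpha>). if \<alpha> = replicate_mset d i then 1 else 0)"

lemma form_eval_Ecoef: "form_eval d (Ecoef d) i x = x $ i ^ d"
  by (simp add: form_eval_monom_at Ecoef_def if_distrib[of "\<lambda>a. a * _"] sum.delta cong: if_cong)

lemma singular_scale:
  assumes "c \<in> singular d"
  shows "(\<lambda>v. t * c v) \<in> singular d"
proof -
  have "form_eval d (\<lambda>v. t * c v) i x = t * form_eval d c i x" for i x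
    using form_eval_lin[of d "\<lambda>_. 0" t c i x] by (simp add: form_eval_monom_at)
  then show ?thesis using assms by (auto simp: singular_def)
qed

definition resideal :: "nat \<Rightarrow> ('n::finite \<times> 'n multiset, complex) mpoly set" where
  "resideal d = {p \<in> Pol (cvars d). \<forall>c\<in>singular d. mpoly_eval p c = 0}"

lemma poly_prod_mset: "poly (\<Prod>j\<in>#\<alpha>. f j) s = (\<Prod>j\<in>#\<alpha>. poly (f j) s)"
  by (induction \<alpha>) auto

text \<open>Two points of the incidence variety are joined by a polynomial curve in it; the curve of
  coefficients is corrected by a form that does not vanish at either of the two zeros.\<close>

lemma resideal_prime:
  fixes F G :: "('n::finite \<times> 'n multiset, complex) mpoly"
  assumes d: "d > 0" and "F \<in> Pol (cvars d)" "G \<in> Pol (cvars d)" "F * G \<in> resideal d"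
  shows "F \<in> resideal d \<or> G \<in> resideal d"
proof (rule ccontr)
  assume "\<not> ?thesis"
  then obtain c1 c2 where c1: "c1 \<in> singular d" "mpoly_eval F c1 \<noteq> 0"
    and c2: "c2 \<in> singular d" "mpoly_eval G c2 \<noteq> 0"
    using assms by (auto simp: resideal_def)
  from c1 c2 obtain y1 y2 where y1: "y1 \<noteq> 0" "\<And>i. form_eval d c1 i y1 = 0"
    and y2: "y2 \<noteq> 0" "\<And>i. form_eval d c2 i y2 = 0" by (auto simp: singular_def)
  define g where "g J x = (\<Sum>j\<in>J. x $ j ^ d)" for J :: "'n set" and x :: "complex ^ 'n"
  \<comment> \<open>If \<open>j1\<close> or \<open>j2\<close> is a nonzero coordinate of both zeros,
    one power suffices. Otherwise \<open>J\<close> has two elements, and exactly one term of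
    \<open>g J\<close> survives at each zero.\<close>
  obtain J where J: "g J y1 \<noteq> 0" "g J y2 \<noteq> 0"
  proof -
    obtain j1 where j1: "y1 $ j1 \<noteq> 0" using y1(1) by (auto simp: Finite_Cartesian_Product.vec_eq_iff)
    obtain j2 where j2: "y2 $ j2 \<noteq> 0" using y2(1) by (auto simp: Finite_Cartesian_Product.vec_eq_iff)
    note j = j1 j2
    consider "y1 $ j2 \<noteq> 0" | "y2 $ j1 \<noteq> 0" | "y1 $ j2 = 0" "y2 $ j1 = 0" by blast
    then show ?thesis
    proof cases
      case 1 then show ?thesis using j by (intro that[of "{j2}"]) (auto simp: g_def)
    next
      case 2 then show ?thesis using j by (intro that[of "{j1}"]) (auto simp: g_def)
    next
      case 3
      then have "j1 \<noteq> j2" using j by auto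
      then show ?thesis using j 3 d by (intro that[of "{j1, j2}"]) (auto simp: g_def zero_power)
    qed
  qed
  have norm1: "\<exists>x. g J x = 1 \<and> (\<forall>i. form_eval d c i x = 0)"
    if "g J y \<noteq> 0" "\<And>i. form_eval d c i y = 0" for c y
  proof -
    obtain z where z: "1 / g J y = z ^ d" using exists_complex_root d by blast
    have "g J (z *s y) = z ^ d * g J y"
      by (simp add: g_def power_mult_distrib sum_distrib_left)
    then have "g J (z *s y) = 1" using that(1) by (simp flip: z)
    then show ?thesis using that(2) by (intro exI[of _ "z *s y"]) (simp add: form_eval_scale)
  qed
  obtain x1 where x1: "g J x1 = 1" "\<And>i. form_eval d c1 i x1 = 0" using norm1 J(1) y1 by blast
  obtain x2 where x2: "g J x2 = 1" "\<And>i. form_eval d c2 i x2 = 0" using norm1 J(2) y2 by blast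
  define xp where "xp j = [:x1 $ j, x2 $ j - x1 $ j:]" for j
  define x where "x s = (\<chi> j. poly (xp j) s)" for s
  define cp where "cp v = [:c1 v, c2 v - c1 v:]" for v
  define c where "c s = (\<lambda>v. poly (cp v) s)" for s
  define fp where "fp i = (\<Sum>\<alpha> | size \<alpha> = d. cp (i, \<alpha>) * (\<Prod>j\<in>#\<alpha>. xp j))" for i
  define gp where "gp = (\<Sum>j\<in>J. xp j ^ d)"
  \<comment> \<open>Form \<open>i\<close> becomes
    \<open>gp * f_i - fp i * (\<Sum>j\<in>J. x_j^d)\<close>, which vanishes at \<open>x s\<close>
    because \<open>fp i\<close> and \<open>gp\<close> are the values there of \<open>f_i\<close> and
    of the sum. At both ends \<open>fp i = 0\<close> and, by the normalization of the zeros,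
    \<open>gp = 1\<close>, so the curve joins \<open>c1\<close> to \<open>c2\<close>.\<close>
  define \<gamma> where "\<gamma> = (\<lambda>(i, \<alpha>). gp * cp (i, \<alpha>) - (if \<alpha> \<in> replicate_mset d ` J then fp i else 0))"
  have fp: "poly (fp i) s = form_eval d (c s) i (x s)" for i s
    by (simp add: fp_def form_eval_def poly_sum poly_prod_mset c_def x_def)
  have gp: "poly gp s = g J (x s)" for s by (simp add: gp_def g_def poly_sum x_def)
  have inj: "inj_on (replicate_mset d) J"
    using d by (auto simp: inj_on_def) (metis in_replicate_mset)
  have \<gamma>: "form_eval d (\<lambda>v. poly (\<gamma> v) s) i (x s) = 0" for s i
  proof -
    let ?R = "\<lambda>\<alpha>. if \<alpha> \<in> replicate_mset d ` J then 1 else 0"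
    have "form_eval d (\<lambda>v. poly (\<gamma> v) s) i (x s) =
      (\<Sum>\<alpha> | size \<alpha> = d. g J (x s) * (c s (i, \<alpha>) * monom_at \<alpha> (x s)) -
         form_eval d (c s) i (x s) * (?R \<alpha> * monom_at \<alpha> (x s)))"
      unfolding form_eval_monom_at[of d "\<lambda>v. poly (\<gamma> v) s"]
      by (intro sum.cong refl) (simp add: \<gamma>_def gp fp c_def algebra_simps)
    also have "\<dots> = g J (x s) * form_eval d (c s) i (x s) -
       form_eval d (c s) i (x s) * (\<Sum>\<alpha> | size \<alpha> = d. ?R \<alpha> * monom_at \<alpha> (x s))"
      by (simp add: sum_subtractf form_eval_monom_at flip: sum_distrib_left)
    also have "(\<Sum>\<alpha> | size \<alpha> = d. ?R \<alpha> * monom_at \<alpha> (x s)) =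
      (\<Sum>\<alpha>\<in>replicate_mset d ` J. monom_at \<alpha> (x s))"
      by (rule sum.mono_neutral_cong_right) auto
    also have "\<dots> = g J (x s)"
      by (subst sum.reindex[OF inj]) (simp add: g_def)
    finally show ?thesis by simp
  qed
  \<comment> \<open>The factor \<open>gp\<close> covers the parameters with
    \<open>g J (x s) = 0\<close>, where \<open>x s\<close> may be 0 and the system
    nonsingular.\<close>
  have "poly (along \<gamma> F * along \<gamma> G * gp) s = 0" for s
  proof (cases "poly gp s = 0")
    case False
    have "x s \<noteq> 0"
    proof
      assume "x s = 0"
      then have "g J (x s) = 0" using d by (simp add: g_def)
      then show False using False gp by simp
    qed
    then have "(\<lambda>v. poly (\<gamma> v) s) \<in> singular d" using \<gamma> by (auto simp: singular_def)
    then have "mpoly_eval (F * G) (\<lambda>v. poly (\<gamma> v) s) = 0"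
      using assms(4) unfolding resideal_def by blast
    then show ?thesis by simp
  qed simp
  then have "along \<gamma> F * along \<gamma> G * gp = 0" using poly_all_0_iff_0 by blast
  moreover have x01: "x 0 = x1" "x 1 = x2" and c01: "c 0 = c1" "c 1 = c2"
    by (auto simp: x_def xp_def c_def cp_def Finite_Cartesian_Product.vec_eq_iff)
  have "poly (fp i) 0 = 0" "poly (fp i) 1 = 0" "poly gp 1 = 1" for i
    using fp[of i 0] fp[of i 1] gp[of 1] x1 x2 by (simp_all add: x01 c01)
  note ends = this
  have "poly gp 0 = 1" using gp[of 0] x01 x1 by simp
  then have "gp \<noteq> 0" by auto
  moreover have "(\<lambda>v. poly (\<gamma> v) 0) = c1"
  proof
    fix v show "poly (\<gamma> v) 0 = c1 v"
      using \<open>poly gp 0 = 1\<close> by (cases v) (simp add: \<gamma>_def cp_def ends)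
  qed
  then have "poly (along \<gamma> F) 0 \<noteq> 0" using c1 by simp
  then have "along \<gamma> F \<noteq> 0" by (metis poly_0)
  moreover have "(\<lambda>v. poly (\<gamma> v) 1) = c2"
  proof
    fix v show "poly (\<gamma> v) 1 = c2 v"
      by (cases v) (simp add: \<gamma>_def cp_def ends)
  qed
  then have "poly (along \<gamma> G) 1 \<noteq> 0" using c2 by simp
  then have "along \<gamma> G \<noteq> 0" by (metis poly_0)
  ultimately show False by simp
qed

section \<open>Macaulay's determinant\<close>

text \<open>The rows of Macaulay's matrix are the multiples \<open>x^(\<gamma> - d i) f_i\<close>, where \<open>i\<close> depends on \<open>\<gamma>\<close>
  and is \<open>i0\<close> only if there is no other choice; this happens for \<open>d^(n-1)\<close> monomials \<open>\<gamma>\<close> only.\<close>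

definition macaulay_pick :: "nat \<Rightarrow> 'n \<Rightarrow> 'n multiset \<Rightarrow> 'n" where
  "macaulay_pick d i0 \<gamma> = (if \<exists>i. i \<noteq> i0 \<and> count \<gamma> i \<ge> d then SOME i. i \<noteq> i0 \<and> count \<gamma> i \<ge> d else i0)"

text \<open>The least degree in which every monomial is divisible by some
  \<open>x_i^d\<close>.\<close>

definition macaulay_degree :: "'n::finite itself \<Rightarrow> nat \<Rightarrow> nat" where
  "macaulay_degree _ d = CARD('n) * (d - 1) + 1"

definition macaulay_entry ::
  "nat \<Rightarrow> 'n::finite \<Rightarrow> 'n multiset \<Rightarrow> 'n multiset \<Rightarrow> ('n \<times> 'n multiset, complex) mpoly" where
  "macaulay_entry d i0 \<gamma> \<delta> =
     (let i = macaulay_pick d i0 \<gamma>; \<beta> = \<gamma> - replicate_mset d i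
      in if \<beta> \<subseteq># \<delta> then mvar (i, \<delta> - \<beta>) else 0)"

lemma size_eq_sum_count: "size \<gamma> = (\<Sum>i\<in>UNIV. count \<gamma> (i::'n::finite))"
proof (induction \<gamma>)
  case (add x \<gamma>)
  have "(\<Sum>i\<in>UNIV. count (add_mset x \<gamma>) i) = (\<Sum>i\<in>UNIV. (if x = i then 1 else 0) + count \<gamma> i)"
    by (intro sum.cong) auto
  then show ?case using add by (simp add: sum.distrib)
qed simp

text \<open>If all exponents other than that of \<open>i0\<close> are below \<open>d\<close>, they
  add up to at most \<open>(n - 1) (d - 1)\<close>, which leaves at least \<open>d\<close> for
  \<open>i0\<close>.\<close>

lemma macaulay_pick:
  fixes i0 :: "'n::finite"
  assumes d: "d > 0" and \<gamma>: "size \<gamma> = macaulay_degree TYPE('n) d"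
  shows "replicate_mset d (macaulay_pick d i0 \<gamma>) \<subseteq># \<gamma>"
    "macaulay_pick d i0 \<gamma> = i0 \<longleftrightarrow> (\<forall>i. i \<noteq> i0 \<longrightarrow> count \<gamma> i < d)"
proof -
  have "d \<le> count \<gamma> (macaulay_pick d i0 \<gamma>)"
  proof (cases "\<exists>i. i \<noteq> i0 \<and> count \<gamma> i \<ge> d")
    case True
    then show ?thesis using someI_ex[OF True] by (simp add: macaulay_pick_def)
  next
    case False
    have "size \<gamma> = count \<gamma> i0 + (\<Sum>i\<in>UNIV - {i0}. count \<gamma> i)"
      by (simp add: size_eq_sum_count sum.remove[of UNIV i0])
    also have "(\<Sum>i\<in>UNIV - {i0}. count \<gamma> i) \<le> (\<Sum>i\<in>UNIV - {i0}. d - 1)"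
      using False d by (intro sum_mono) (fastforce simp: not_le)
    also have "\<dots> = (CARD('n) - 1) * (d - 1)" by simp
    finally have "CARD('n) * (d - 1) + 1 \<le> count \<gamma> i0 + (CARD('n) - 1) * (d - 1)"
      using \<gamma> by (simp add: macaulay_degree_def)
    moreover have "CARD('n) * (d - 1) = (CARD('n) - 1) * (d - 1) + (d - 1)"
      using zero_less_card_finite[where 'a = 'n] by (metis Suc_pred' add.commute mult_Suc)
    ultimately have "d \<le> count \<gamma> i0" using d by linarith
    moreover have "macaulay_pick d i0 \<gamma> = i0"
      unfolding macaulay_pick_def using False by (rule if_not_P)
    ultimately show ?thesis by simp
  qed
  then show "replicate_mset d (macaulay_pick d i0 \<gamma>) \<subseteq># \<gamma>"
    by (simp add: subseteq_mset_def)
  show "macaulay_pick d i0 \<gamma> = i0 \<longleftrightarrow> (\<forall>i. i \<noteq> i0 \<longrightarrow> count \<gamma> i < d)"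
  proof (cases "\<exists>i. i \<noteq> i0 \<and> count \<gamma> i \<ge> d")
    case True
    then show ?thesis using someI_ex[OF True] by (auto simp: macaulay_pick_def not_le not_less)
  next
    case False
    then show ?thesis by (auto simp: macaulay_pick_def not_le)
  qed
qed

text \<open>Such a \<open>\<gamma>\<close> is determined by its exponents away from
  \<open>i0\<close>, all of which lie below \<open>d\<close>.\<close>

lemma card_macaulay_pick:
  fixes i0 :: "'n::finite"
  assumes d: "d > 0"
  shows "card {\<gamma>. size \<gamma> = macaulay_degree TYPE('n) d \<and> macaulay_pick d i0 \<gamma> = i0} \<le> d ^ (CARD('n) - 1)"
proof -
  let ?S = "{\<gamma>. size \<gamma> = macaulay_degree TYPE('n) d \<and> macaulay_pick d i0 \<gamma> = i0}"
  let ?T = "(UNIV - {i0}) \<rightarrow>\<^sub>E {..<d}"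
  have "card ?S \<le> card ?T"
  proof (rule card_inj_on_le)
    show "inj_on (\<lambda>\<gamma>. restrict (count \<gamma>) (UNIV - {i0})) ?S"
    proof (rule inj_onI)
      fix \<gamma> \<delta> assume \<gamma>: "\<gamma> \<in> ?S" and \<delta>: "\<delta> \<in> ?S"
        and eq: "restrict (count \<gamma>) (UNIV - {i0}) = restrict (count \<delta>) (UNIV - {i0})"
      have c: "count \<gamma> i = count \<delta> i" if "i \<noteq> i0" for i
        using fun_cong[OF eq, of i] that by simp
      have "(\<Sum>i\<in>UNIV. count \<gamma> i) = (\<Sum>i\<in>UNIV. count \<delta> i)"
        using \<gamma> \<delta> by (simp flip: size_eq_sum_count)
      then have "count \<gamma> i0 = count \<delta> i0"
        using c by (simp add: sum.remove[of UNIV i0])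
      with c show "\<gamma> = \<delta>" by (metis multiset_eqI)
    qed
    show "(\<lambda>\<gamma>. restrict (count \<gamma>) (UNIV - {i0})) ` ?S \<subseteq> ?T"
      by (intro image_subsetI restrict_PiE_iff[THEN iffD2] ballI) (use macaulay_pick(2)[OF d, of _ i0] in auto)
    show "finite ?T" by (rule finite_PiE) auto
  qed
  also have "card ?T = d ^ (CARD('n) - 1)" by (simp add: card_PiE)
  finally show ?thesis .
qed

lemma eval_macaulay_entry:
  fixes i0 :: "'n::finite"
  assumes d: "d > 0" and \<gamma>: "size \<gamma> = macaulay_degree TYPE('n) d" and \<delta>: "size \<delta> = macaulay_degree TYPE('n) d"
  shows "macaulay_entry d i0 \<gamma> \<delta> \<in> Pol (cvars d)"
    and "mpoly_eval (macaulay_entry d i0 \<gamma> \<delta>) (Ecoef d) = (if \<delta> = \<gamma> then 1 else 0)"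
    and "mpoly_eval (macaulay_entry d i0 \<gamma> \<delta>) (\<lambda>v. (if fst v = i0 then t else 1) * c v) =
         (if macaulay_pick d i0 \<gamma> = i0 then t else 1) * mpoly_eval (macaulay_entry d i0 \<gamma> \<delta>) c"
proof -
  define i where "i = macaulay_pick d i0 \<gamma>"
  define \<beta> where "\<beta> = \<gamma> - replicate_mset d i"
  have \<gamma>\<beta>: "\<gamma> = replicate_mset d i + \<beta>"
    using macaulay_pick(1)[OF d \<gamma>, of i0] by (simp add: i_def \<beta>_def)
  have sz: "\<beta> \<subseteq># \<delta> \<Longrightarrow> size (\<delta> - \<beta>) = d"
    using \<gamma> \<delta> \<gamma>\<beta> by (simp add: size_Diff_submset)
  have entry: "macaulay_entry d i0 \<gamma> \<delta> = (if \<beta> \<subseteq># \<delta> then mvar (i, \<delta> - \<beta>) else 0)"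
    by (simp add: macaulay_entry_def Let_def i_def \<beta>_def)
  show "macaulay_entry d i0 \<gamma> \<delta> \<in> Pol (cvars d)"
    unfolding entry using sz by (auto intro!: Pol_mvar simp: cvars_def)
  have "\<beta> \<subseteq># \<delta> \<and> \<delta> - \<beta> = replicate_mset d i \<longleftrightarrow> \<delta> = \<gamma>"
    unfolding \<gamma>\<beta>
    by (metis add_diff_cancel_right' mset_subset_eq_add_right subset_mset.diff_add)
  then show "mpoly_eval (macaulay_entry d i0 \<gamma> \<delta>) (Ecoef d) = (if \<delta> = \<gamma> then 1 else 0)"
    unfolding entry Ecoef_def by auto
  show "mpoly_eval (macaulay_entry d i0 \<gamma> \<delta>) (\<lambda>v. (if fst v = i0 then t else 1) * c v) =
         (if macaulay_pick d i0 \<gamma> = i0 then t else 1) * mpoly_eval (macaulay_entry d i0 \<gamma> \<delta>) c"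
    unfolding entry by (simp flip: i_def)
qed

lemma macaulay_row:
  fixes i0 :: "'n::finite"
  assumes d: "d > 0" and \<gamma>: "size \<gamma> = macaulay_degree TYPE('n) d"
  shows "(\<Sum>\<delta> | size \<delta> = macaulay_degree TYPE('n) d. mpoly_eval (macaulay_entry d i0 \<gamma> \<delta>) c * monom_at \<delta> x) =
    monom_at (\<gamma> - replicate_mset d (macaulay_pick d i0 \<gamma>)) x * form_eval d c (macaulay_pick d i0 \<gamma>) x"
proof -
  define i where "i = macaulay_pick d i0 \<gamma>"
  define \<beta> where "\<beta> = \<gamma> - replicate_mset d i"
  let ?D = "macaulay_degree TYPE('n) d"
  have \<gamma>\<beta>: "\<gamma> = replicate_mset d i + \<beta>"
    using macaulay_pick(1)[OF d \<gamma>, of i0] by (simp add: i_def \<beta>_def)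
  have entry: "macaulay_entry d i0 \<gamma> \<delta> = (if \<beta> \<subseteq># \<delta> then mvar (i, \<delta> - \<beta>) else 0)" for \<delta>
    by (simp add: macaulay_entry_def Let_def i_def \<beta>_def)
  have "(\<Sum>\<delta> | size \<delta> = ?D. mpoly_eval (macaulay_entry d i0 \<gamma> \<delta>) c * monom_at \<delta> x) =
    (\<Sum>\<delta> | size \<delta> = ?D \<and> \<beta> \<subseteq># \<delta>. c (i, \<delta> - \<beta>) * monom_at \<delta> x)"
    by (rule sum.mono_neutral_cong_right) (auto simp: entry)
  also have "\<dots> = (\<Sum>\<alpha> | size \<alpha> = d. c (i, \<alpha>) * monom_at (\<alpha> + \<beta>) x)"
    by (rule sum.reindex_bij_witness[of _ "\<lambda>\<alpha>. \<alpha> + \<beta>" "\<lambda>\<delta>. \<delta> - \<beta>"])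
      (use \<gamma> \<gamma>\<beta> in \<open>auto simp: size_Diff_submset\<close>)
  also have "\<dots> = monom_at \<beta> x * form_eval d c i x"
    by (simp add: form_eval_monom_at sum_distrib_left algebra_simps)
  finally show ?thesis by (simp add: i_def \<beta>_def)
qed

text \<open>The determinant vanishes on singular systems because the monomials at a common zero form
  a kernel vector. At \<open>Ecoef d\<close> the matrix is the identity, and scaling form
  \<open>i0\<close> scales exactly the \<open>k\<close> rows that picked \<open>i0\<close>.\<close>

lemma macaulay_det_ex:
  fixes i0 :: "'n::finite"
  assumes d: "d > 0"
  obtains M k where "M \<in> resideal d" "mpoly_eval M (Ecoef d) = 1" "k \<le> d ^ (CARD('n) - 1)"
    "\<And>t c. mpoly_eval M (\<lambda>v. (if fst v = i0 then t else 1) * c v) = t ^ k * mpoly_eval M c"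
proof -
  let ?D = "macaulay_degree TYPE('n) d"
  define \<Gamma> where "\<Gamma> = {\<gamma> :: 'n multiset. size \<gamma> = ?D}"
  define N where "N = card \<Gamma>"
  have fin: "finite \<Gamma>" by (simp add: \<Gamma>_def)
  obtain h where h: "bij_betw h {0..<N} \<Gamma>" using ex_bij_betw_nat_finite[OF fin] by (auto simp: N_def)
  have hG: "a < N \<Longrightarrow> size (h a) = ?D" for a using bij_betwE[OF h] by (auto simp: \<Gamma>_def)
  define A where "A = Matrix.mat N N (\<lambda>(a, b). macaulay_entry d i0 (h a) (h b))"
  have A: "A \<in> carrier_mat N N" by (simp add: A_def)
  define M where "M = Determinant.det A"
  have M: "M = (\<Sum>p | p permutes {0..<N}. signof p * (\<Prod>a = 0..<N. macaulay_entry d i0 (h a) (h (p a))))"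
    unfolding M_def det_def'[OF A]
    by (intro sum.cong refl arg_cong2[of _ _ _ _ "(*)"] prod.cong) (auto simp: A_def permutes_in_image)
  have hom: "comm_ring_hom (\<lambda>p. mpoly_eval p c)" for c :: "'n \<times> 'n multiset \<Rightarrow> complex"
    by unfold_locales auto
  have evM: "mpoly_eval M c = Determinant.det (map_mat (\<lambda>p. mpoly_eval p c) A)" for c
    unfolding M_def by (rule comm_ring_hom.hom_det[OF hom, symmetric])
  have M_Pol: "M \<in> Pol (cvars d)"
    unfolding M
  proof (intro Pol_sum Pol_mult Pol_prod)
    fix p a assume p: "p \<in> {p. p permutes {0..<N}}" and a: "a \<in> {0..<N}"
    then have "p a < N" using permutes_in_image[of p "{0..<N}" a] by auto
    then show "macaulay_entry d i0 (h a) (h (p a)) \<in> Pol (cvars d)"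
      using eval_macaulay_entry(1)[OF d hG hG] a by auto
  qed (auto simp: sign_def Pol_uminus)
  have *: "mpoly_eval M c = 0" if c: "c \<in> singular d" for c
  proof -
    obtain x where x: "x \<noteq> 0" "\<And>i. form_eval d c i x = 0" using c by (auto simp: singular_def)
    then obtain j where j: "x $ j \<noteq> 0" by (auto simp: Finite_Cartesian_Product.vec_eq_iff)
    define v where "v = Matrix.vec N (\<lambda>a. monom_at (h a) x)"
    let ?A = "map_mat (\<lambda>p. mpoly_eval p c) A"
    have "replicate_mset ?D j \<in> \<Gamma>" by (simp add: \<Gamma>_def)
    then obtain a where a: "a < N" "h a = replicate_mset ?D j" using h by (auto simp: bij_betw_def)
    then have "vec_index v a \<noteq> 0" using j by (simp add: v_def)
    then have v0: "v \<noteq> 0\<^sub>v N" using a by auto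
    have "?A *\<^sub>v v = 0\<^sub>v N"
    proof (rule eq_vecI)
      fix a assume "a < dim_vec (0\<^sub>v N :: complex Matrix.vec)"
      then have a: "a < N" by simp
      have "vec_index (?A *\<^sub>v v) a = (\<Sum>b = 0..<N. mpoly_eval (macaulay_entry d i0 (h a) (h b)) c * monom_at (h b) x)"
        using a by (simp add: scalar_prod_def A_def v_def)
      also have "\<dots> = (\<Sum>\<delta>\<in>\<Gamma>. mpoly_eval (macaulay_entry d i0 (h a) \<delta>) c * monom_at \<delta> x)"
        by (rule sum.reindex_bij_betw[OF h])
      also have "\<dots> = 0"
        using macaulay_row[OF d hG[OF a], of i0 c x] x(2) by (simp add: \<Gamma>_def)
      finally show "vec_index (?A *\<^sub>v v) a = vec_index (0\<^sub>v N) a" using a by simp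
    qed (simp add: A_def)
    moreover have "?A \<in> carrier_mat N N" "v \<in> carrier_vec N" using A by (auto simp: v_def)
    ultimately show ?thesis
      unfolding evM using det_0_iff_vec_prod_zero_field[of ?A N] v0 by blast
  qed
  define k where "k = card {a \<in> {0..<N}. macaulay_pick d i0 (h a) = i0}"
  from * have "M \<in> resideal d" using M_Pol by (simp add: resideal_def)
  moreover have "mpoly_eval M (Ecoef d) = 1"
  proof -
    have "map_mat (\<lambda>p. mpoly_eval p (Ecoef d)) A = 1\<^sub>m N"
    proof (rule eq_matI)
      fix a b assume "a < dim_row (1\<^sub>m N :: complex mat)" "b < dim_col (1\<^sub>m N :: complex mat)"
      then have ab: "a < N" "b < N" by auto
      then have "h b = h a \<longleftrightarrow> a = b" using h by (auto simp: bij_betw_def inj_on_def)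
      then show "map_mat (\<lambda>p. mpoly_eval p (Ecoef d)) A $$ (a, b) = 1\<^sub>m N $$ (a, b)"
        using ab eval_macaulay_entry(2)[OF d hG hG] by (simp add: A_def)
    qed (auto simp: A_def)
    then show ?thesis unfolding evM by simp
  qed
  moreover have "k \<le> d ^ (CARD('n) - 1)"
  proof -
    have "k = card (h ` {a \<in> {0..<N}. macaulay_pick d i0 (h a) = i0})"
      unfolding k_def using h by (intro card_image[symmetric]) (auto simp: bij_betw_def inj_on_def)
    also have "\<dots> \<le> card {\<gamma>. size \<gamma> = ?D \<and> macaulay_pick d i0 \<gamma> = i0}"
      using hG by (intro card_mono) (auto intro: finite_subset[OF _ finite_size_eq[of ?D]])
    also have "\<dots> \<le> d ^ (CARD('n) - 1)" by (rule card_macaulay_pick[OF d])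
    finally show ?thesis .
  qed
  moreover have "mpoly_eval M (\<lambda>v. (if fst v = i0 then t else 1) * c v) = t ^ k * mpoly_eval M c" for t c
  proof -
    let ?w = "\<lambda>a. if macaulay_pick d i0 (h a) = i0 then t else 1"
    have w: "(\<Prod>a = 0..<N. ?w a) = t ^ k"
      by (subst prod.inter_filter[symmetric]) (simp_all add: k_def)
    have sgn: "mpoly_eval (signof p) c = signof p" for c :: "'n \<times> 'n multiset \<Rightarrow> complex" and p :: "nat \<Rightarrow> nat"
      by (simp add: sign_def)
    have "mpoly_eval M (\<lambda>v. (if fst v = i0 then t else 1) * c v) =
      (\<Sum>p | p permutes {0..<N}. signof p *
         (\<Prod>a = 0..<N. ?w a * mpoly_eval (macaulay_entry d i0 (h a) (h (p a))) c))"
      unfolding M mpoly_eval_simps sgn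
    proof (intro sum.cong refl arg_cong2[of _ _ _ _ "(*)"] prod.cong)
      fix p a assume p: "p \<in> {p. p permutes {0..<N}}" and a: "a \<in> {0..<N}"
      then have "p a < N" using permutes_in_image[of p "{0..<N}" a] by auto
      then show "mpoly_eval (macaulay_entry d i0 (h a) (h (p a))) (\<lambda>v. (if fst v = i0 then t else 1) * c v)
        = ?w a * mpoly_eval (macaulay_entry d i0 (h a) (h (p a))) c"
        using eval_macaulay_entry(3)[OF d hG hG] a by auto
    qed
    also have "\<dots> = t ^ k * mpoly_eval M c"
      unfolding M mpoly_eval_simps sgn prod.distrib w sum_distrib_left
      by (intro sum.cong refl) (simp add: algebra_simps)
    finally show ?thesis .
  qed
  ultimately show ?thesis by (rule that)
qed

section \<open>The ideal of the singular systems\<close>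

lemma continuous_on_monom_at:
  fixes X :: "'b::topological_space \<Rightarrow> complex ^ 'n::finite"
  assumes "\<And>j. continuous_on S (\<lambda>\<xi>. X \<xi> $ j)"
  shows "continuous_on S (\<lambda>\<xi>. monom_at \<alpha> (X \<xi>))"
  by (induction \<alpha>) (auto intro!: continuous_on_mult assms)

lemma tendsto_monom_at:
  fixes X :: "'b \<Rightarrow> complex ^ 'n::finite"
  assumes "(X \<longlongrightarrow> l) F"
  shows "((\<lambda>n. monom_at \<alpha> (X n)) \<longlongrightarrow> monom_at \<alpha> l) F"
  by (induction \<alpha>) (auto intro!: tendsto_mult tendsto_vec_nth assms)

lemma norm_monom_at_le_1:
  fixes x :: "complex ^ 'n::finite"
  assumes "\<And>j. norm (x $ j) \<le> 1"
  shows "norm (monom_at \<alpha> x) \<le> 1"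
proof (induction \<alpha>)
  case (add j \<alpha>)
  then show ?case using mult_mono[OF assms[of j] add] by (simp add: norm_mult)
qed simp

lemma norm_vec_le_sum:
  fixes x :: "complex ^ 'n::finite"
  shows "norm x \<le> (\<Sum>j\<in>UNIV. norm (x $ j))"
  unfolding norm_vec_def by (rule L2_set_le_sum) simp

text \<open>Near the system \<open>x_i x_k^(d-1)\<close>, all forms but the \<open>k\<close>-th have a common zero with
  \<open>x_k = 1\<close>, which Brouwer's theorem produces; the coefficient of \<open>x_k^d\<close> in the \<open>k\<close>-th form can
  then be chosen to make the system singular.\<close>

lemma resideal_free_eq_0:
  fixes F :: "('n::finite \<times> 'n multiset, complex) mpoly"
  assumes d: "d > 0" and F: "F \<in> resideal d" "F \<in> Pol (cvars d - {(k, replicate_mset d k)})"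
  shows "F = 0"
proof -
  let ?y = "(k, replicate_mset d k)"
  \<comment> \<open>Form \<open>i \<noteq> k\<close> is \<open>x_i x_k^(d-1)\<close>, which is
    \<open>x_i\<close> on the chart \<open>x_k = 1\<close>; form \<open>k\<close> is 0.\<close>
  define c0 where "c0 = (\<lambda>(i, \<alpha>). if i \<noteq> k \<and> \<alpha> = add_mset i (replicate_mset (d - 1) k) then 1 else 0 :: complex)"
  define M where "M = real (card {\<alpha> :: 'n multiset. size \<alpha> = d}) + 1"
  \<comment> \<open>Forms within \<open>\<delta>\<close> of \<open>c0\<close> differ from
    \<open>\<xi> $ j\<close> by at most \<open>1 / n\<close> on the unit ball, so the
    \<open>n\<close> coordinates of \<open>\<Phi> \<xi>\<close> together contribute at most 1 to its
    norm.\<close>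
  define \<delta> where "\<delta> = 1 / (real CARD('n) * M)"
  have M: "M > 0" "real CARD('n) > 0" by (auto simp: M_def add_nonneg_pos)
  then have \<delta>: "\<delta> > 0" by (simp add: \<delta>_def)
  show ?thesis
  proof (rule infinite_box_zero[OF finite_cvars, where B = "\<lambda>v. ball (c0 v) \<delta>"])
    show "F \<in> Pol (cvars d)" using F by (simp add: resideal_def)
    show "infinite (ball (c0 v) \<delta>)" for v using uncountable_ball[OF \<delta>] countable_finite by blast
    fix a assume a: "\<And>v. v \<in> cvars d \<Longrightarrow> a v \<in> ball (c0 v) \<delta>"
    define X where "X \<xi> = (\<chi> j. if j = k then 1 else \<xi> $ j)" for \<xi> :: "complex ^ 'n"
    \<comment> \<open>At a fixed point all forms other than the \<open>k\<close>-th vanish.\<close>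
    define \<Phi> where "\<Phi> \<xi> = (\<chi> j. if j = k then 0 else \<xi> $ j - form_eval d a j (X \<xi>))" for \<xi>
    have c0: "form_eval d c0 j (X \<xi>) = \<xi> $ j" if "j \<noteq> k" for j \<xi>
    proof -
      have "form_eval d c0 j (X \<xi>) = monom_at (add_mset j (replicate_mset (d - 1) k)) (X \<xi>)"
        using that d by (simp add: form_eval_monom_at c0_def if_distrib[of "\<lambda>a. a * _"] sum.delta cong: if_cong)
      then show ?thesis using that by (simp add: X_def)
    qed
    have comp: "norm (\<Phi> \<xi> $ j) \<le> 1 / real CARD('n)" if "norm \<xi> \<le> 1" for \<xi> j
    proof (cases "j = k")
      case False
      have X1: "norm (X \<xi> $ i) \<le> 1" for i
        by (auto simp: X_def intro: order.trans[OF Finite_Cartesian_Product.norm_nth_le that])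
      have "\<Phi> \<xi> $ j = (\<Sum>\<alpha> | size \<alpha> = d. (c0 (j, \<alpha>) - a (j, \<alpha>)) * monom_at \<alpha> (X \<xi>))"
        using c0[OF False, of \<xi>] False
        by (simp add: \<Phi>_def form_eval_monom_at left_diff_distrib sum_subtractf)
      also have "norm \<dots> \<le> (\<Sum>\<alpha> | size \<alpha> = d. norm ((c0 (j, \<alpha>) - a (j, \<alpha>)) * monom_at \<alpha> (X \<xi>)))"
        by (rule norm_sum)
      also have "\<dots> \<le> (\<Sum>\<alpha> :: 'n multiset | size \<alpha> = d. \<delta>)"
      proof (rule sum_mono)
        fix \<alpha> :: "'n multiset" assume "\<alpha> \<in> {\<alpha>. size \<alpha> = d}"
        then have "norm (c0 (j, \<alpha>) - a (j, \<alpha>)) \<le> \<delta>"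
          using a[of "(j, \<alpha>)"] by (auto simp: cvars_def dist_norm)
        then show "norm ((c0 (j, \<alpha>) - a (j, \<alpha>)) * monom_at \<alpha> (X \<xi>)) \<le> \<delta>"
          using mult_mono[OF _ norm_monom_at_le_1[OF X1]] \<delta> by (fastforce simp: norm_mult)
      qed
      also have "\<dots> \<le> M * \<delta>" using \<delta> by (simp add: M_def algebra_simps)
      also have "\<dots> = 1 / real CARD('n)" using M by (simp add: \<delta>_def)
      finally show ?thesis .
    qed (simp add: \<Phi>_def)
    have "\<exists>\<xi>\<in>cball 0 1. \<Phi> \<xi> = \<xi>"
    proof (rule brouwer_ball)
      have "continuous_on S (\<lambda>\<xi>. X \<xi> $ j)" for S j
        by (cases "j = k") (auto simp: X_def intro!: continuous_intros)
      then have cf: "continuous_on S (\<lambda>\<xi>. form_eval d a i (X \<xi>))" for S i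
        unfolding form_eval_monom_at
        by (intro continuous_on_sum continuous_on_mult continuous_on_const continuous_on_monom_at)
      have "continuous_on S (\<lambda>\<xi>. \<Phi> \<xi> $ j)" for S j
        by (cases "j = k") (auto simp: \<Phi>_def intro!: continuous_intros cf)
      then have "continuous_on (cball 0 1) (\<lambda>\<xi>. \<chi> j. \<Phi> \<xi> $ j)"
        by (rule continuous_on_vec_lambda)
      then show "continuous_on (cball 0 1) \<Phi>" by (simp only: Finite_Cartesian_Product.vec_lambda_eta)
      have "norm (\<Phi> \<xi>) \<le> 1" if "norm \<xi> \<le> 1" for \<xi>
      proof -
        have "norm (\<Phi> \<xi>) \<le> (\<Sum>j\<in>(UNIV :: 'n set). 1 / real CARD('n))"
          by (rule order.trans[OF norm_vec_le_sum sum_mono]) (rule comp[OF that])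
        then show ?thesis by simp
      qed
      then show "\<Phi> \<in> cball 0 1 \<rightarrow> cball 0 1" by auto
    qed auto
    then obtain \<xi> where \<xi>: "\<Phi> \<xi> = \<xi>" by blast
    have zero: "form_eval d a j (X \<xi>) = 0" if "j \<noteq> k" for j
      using arg_cong[OF \<xi>, of "\<lambda>x. x $ j"] that by (simp add: \<Phi>_def)
    \<comment> \<open>Since \<open>X \<xi>\<close> has \<open>k\<close>-th coordinate 1, this change
      of one coefficient makes form \<open>k\<close> vanish there as well; \<open>F\<close> is free
      of that coefficient and keeps its value.\<close>
    define c where "c = (\<lambda>v. a v + 1 * (if v = ?y then - form_eval d a k (X \<xi>) else 0))"
    have "form_eval d c i (X \<xi>) = 0" for i
      unfolding c_def form_eval_lin form_eval_delta[OF size_replicate_mset]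
      using zero[of i] by (auto simp: X_def)
    moreover have "X \<xi> $ k = 1" by (simp add: X_def)
    then have "X \<xi> \<noteq> 0" by (metis zero_index zero_neq_one)
    ultimately have "c \<in> singular d" by (auto simp: singular_def)
    then have "mpoly_eval F c = 0" using F by (auto simp: resideal_def)
    moreover have "mpoly_eval F c = mpoly_eval F a"
      by (rule mpoly_eval_cong) (use F in \<open>auto simp: Pol_def c_def\<close>)
    ultimately show "mpoly_eval F a = 0" by simp
  qed
qed

lemma resideal_eval: "p \<in> resideal d \<Longrightarrow> c \<in> singular d \<Longrightarrow> mpoly_eval p c = 0"
  and resideal_Pol: "p \<in> resideal d \<Longrightarrow> p \<in> Pol (cvars d)"
  by (auto simp: resideal_def)

lemma zero_singular: "(\<lambda>_. 0) \<in> singular d"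
  unfolding singular_def form_eval_def by (auto intro!: exI[of _ "\<chi> i. 1"] simp: Finite_Cartesian_Product.vec_eq_iff)

text \<open>An element of minimal total degree generates the ideal.\<close>

lemma resideal_generator:
  assumes d: "d > 0"
  obtains R :: "('n::finite \<times> 'n multiset, complex) mpoly"
  where "R \<in> resideal d" "irreducible R" "mpoly_eval R (Ecoef d) = 1" "\<And>G. G \<in> resideal d \<Longrightarrow> R dvd G"
proof -
  let ?I = "resideal d :: ('n \<times> 'n multiset, complex) mpoly set"
  obtain M :: "('n \<times> 'n multiset, complex) mpoly" where M: "M \<in> resideal d" "mpoly_eval M (Ecoef d) = 1"
    using macaulay_det_ex[OF d] by metis
  then have "M \<noteq> 0" by auto
  then obtain S where S: "S \<in> ?I" "S \<noteq> 0" and Smin: "\<And>F. F \<in> ?I \<Longrightarrow> F \<noteq> 0 \<Longrightarrow> tdeg S \<le> tdeg F"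
    using ex_has_least_nat[of "\<lambda>F. F \<in> ?I \<and> F \<noteq> 0" M tdeg] M by blast
  \<comment> \<open>By primality one factor lies in the ideal and has the full minimal degree, so
    the other is constant.\<close>
  have irr: "irreducible R" if R: "R \<in> ?I" "R \<noteq> 0" "tdeg R = tdeg S" for R
  proof (rule irreducibleI)
    show "R \<noteq> 0" by fact
    show "\<not> R dvd 1"
    proof
      assume "R dvd 1"
      then obtain q where "1 = R * q" ..
      then have "mpoly_eval (R * q) (\<lambda>_. 0) = mpoly_eval (1 :: ('n \<times> 'n multiset, complex) mpoly) (\<lambda>_. 0)" by simp
      then have "mpoly_eval R (\<lambda>_. 0) * mpoly_eval q (\<lambda>_. 0) = 1" unfolding mpoly_eval_simps .
      then show False using resideal_eval[OF R(1) zero_singular] by simp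
    qed
    fix a b assume ab: "R = a * b"
    then have nz: "a \<noteq> 0" "b \<noteq> 0" using R by auto
    then have Pol: "a \<in> Pol (cvars d)" "b \<in> Pol (cvars d)"
      using Pol_factor[of a b "cvars d"] Pol_factor[of b a "cvars d"] resideal_Pol[OF R(1)] ab
      by (auto simp: mult.commute)
    have deg: "tdeg S = tdeg a + tdeg b" using R(3) nz by (simp add: ab tdeg_mult)
    consider "a \<in> ?I" | "b \<in> ?I" using resideal_prime[OF d Pol] R ab by auto
    then show "a dvd 1 \<or> b dvd 1"
      using Smin[of a] Smin[of b] nz deg by cases (auto simp: mpoly_unit_iff)
  qed
  \<comment> \<open>Otherwise eliminating one coefficient between \<open>R\<close> and
    \<open>G\<close> would give a nonzero ideal element free of it.\<close>
  have dvd: "R dvd G" if R: "R \<in> ?I" "R \<noteq> 0" "tdeg R = tdeg S" and G: "G \<in> ?I" for R G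
  proof (rule ccontr)
    assume n: "\<not> R dvd G"
    define k :: 'n where "k = undefined"
    define y where "y = (k, replicate_mset d k)"
    have ins: "insert y (cvars d - {y}) = cvars d" by (auto simp: y_def cvars_def)
    have "R \<notin> Pol (cvars d - {y})" using resideal_free_eq_0[OF d R(1)] R(2) by (auto simp: y_def)
    then obtain u v where uv: "u * R + v * G \<in> Pol (cvars d - {y})" "u * R + v * G \<noteq> 0"
      using bezout_free[of "cvars d - {y}" y R G] resideal_Pol[OF R(1)] resideal_Pol[OF G] irr[OF R] n
      unfolding ins by auto
    have "u * R + v * G \<in> ?I"
      using uv(1) R G by (auto simp: resideal_def intro: Pol_mono[of "cvars d - {y}"])
    then show False using resideal_free_eq_0[OF d] uv by (auto simp: y_def)
  qed
  define e where "e = mpoly_eval S (Ecoef d)"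
  obtain q where "M = S * q" using dvd[OF S refl M(1)] by (auto elim: dvdE)
  then have e: "e \<noteq> 0" using M(2) by (auto simp: e_def)
  define R where "R = mconst (inverse e) * S"
  have nz: "mconst (inverse e) \<noteq> (0 :: ('n \<times> 'n multiset, complex) mpoly)"
    using e by (metis inverse_nonzero_iff_nonzero lookup_single_eq lookup_zero)
  have R: "R \<in> ?I" using S by (auto simp: R_def resideal_def intro!: Pol_mult)
  have R0: "R \<noteq> 0" using mpoly_mult_eq_0[of "mconst (inverse e)" S] nz S by (auto simp: R_def)
  have Rt: "tdeg R = tdeg S" using nz S by (simp add: R_def tdeg_mult)
  show ?thesis
  proof (rule that[OF R irr[OF R R0 Rt] _ dvd[OF R R0 Rt]])
    show "mpoly_eval R (Ecoef d) = 1" using e by (simp add: R_def flip: e_def)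
  qed
qed

text \<open>The family \<open>D\<close> consists of partial derivatives. Only the directional
  derivatives matter, so structural induction with the sum and product rules replaces a formal
  definition.\<close>

lemma mpoly_derivs:
  fixes p :: "('v, complex) mpoly"
  assumes "finite V" "p \<in> Pol V"
  shows "\<exists>D. (\<forall>v. D v \<in> Pol V) \<and> (\<forall>c w. ((\<lambda>s. mpoly_eval p (\<lambda>v. c v + s * w v))
    has_field_derivative (\<Sum>v\<in>V. w v * mpoly_eval (D v) c)) (at 0))"
proof -
  let ?P = "\<lambda>p. p \<in> Pol V \<and> (\<exists>D. (\<forall>v. D v \<in> Pol V) \<and> (\<forall>c w. ((\<lambda>s. mpoly_eval p (\<lambda>v. c v + s * w v))
    has_field_derivative (\<Sum>v\<in>V. w v * mpoly_eval (D v) c)) (at 0)))"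
  have "mpoly_vars p \<subseteq> V" using assms by (simp add: Pol_def)
  then have "?P p"
  proof (induction rule: mpoly_induct)
    case (const a)
    show ?case by (intro conjI exI[of _ "\<lambda>_. 0"]) auto
  next
    case (var u)
    have "((\<lambda>s. c u + s * w u) has_field_derivative w u) (at 0)" for c w :: "'v \<Rightarrow> complex"
      by (auto intro!: derivative_eq_intros)
    moreover have "(\<Sum>v\<in>V. w v * mpoly_eval (if v = u then 1 else 0 :: ('v, complex) mpoly) c) = w u" for c w
      using var assms(1) by (subst sum.remove[of _ u]) (auto intro!: sum.neutral)
    ultimately show ?case using var
      by (intro conjI exI[of _ "\<lambda>v. if v = u then 1 else 0"]) (simp_all add: Pol_mvar)
  next
    case (add p q)
    then obtain D E where D: "\<forall>v. D v \<in> Pol V" "\<And>c w. ((\<lambda>s. mpoly_eval p (\<lambda>v. c v + s * w v))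
      has_field_derivative (\<Sum>v\<in>V. w v * mpoly_eval (D v) c)) (at 0)"
      and E: "\<forall>v. E v \<in> Pol V" "\<And>c w. ((\<lambda>s. mpoly_eval q (\<lambda>v. c v + s * w v))
      has_field_derivative (\<Sum>v\<in>V. w v * mpoly_eval (E v) c)) (at 0)" by blast
    have "((\<lambda>s. mpoly_eval (p + q) (\<lambda>v. c v + s * w v)) has_field_derivative
        (\<Sum>v\<in>V. w v * mpoly_eval (D v + E v) c)) (at 0)" for c w
      using DERIV_add[OF D(2)[of c w] E(2)[of c w]] by (simp add: sum.distrib algebra_simps)
    moreover have "\<forall>v. D v + E v \<in> Pol V" "p + q \<in> Pol V" using D E add by (auto intro: Pol_add)
    ultimately show ?case by (intro conjI exI[of _ "\<lambda>v. D v + E v"]) blast+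
  next
    case (mult p q)
    then obtain D E where D: "\<forall>v. D v \<in> Pol V" "\<And>c w. ((\<lambda>s. mpoly_eval p (\<lambda>v. c v + s * w v))
      has_field_derivative (\<Sum>v\<in>V. w v * mpoly_eval (D v) c)) (at 0)"
      and E: "\<forall>v. E v \<in> Pol V" "\<And>c w. ((\<lambda>s. mpoly_eval q (\<lambda>v. c v + s * w v))
      has_field_derivative (\<Sum>v\<in>V. w v * mpoly_eval (E v) c)) (at 0)" by blast
    have "((\<lambda>s. mpoly_eval (p * q) (\<lambda>v. c v + s * w v)) has_field_derivative
        (\<Sum>v\<in>V. w v * mpoly_eval (D v * q + E v * p) c)) (at 0)" for c w
      using DERIV_mult[OF D(2)[of c w] E(2)[of c w]]
      by (simp add: sum.distrib sum_distrib_left sum_distrib_right algebra_simps)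
    moreover have "\<forall>v. D v * q + E v * p \<in> Pol V" "p * q \<in> Pol V"
      using D E mult by (auto intro!: Pol_add Pol_mult)
    ultimately show ?case by (intro conjI exI[of _ "\<lambda>v. D v * q + E v * p"]) blast+
  qed
  then show ?thesis by blast
qed

section \<open>Homogeneity and roots\<close>

text \<open>Once the root 0 is split off no root is left, and a complex polynomial without roots is
  constant.\<close>

lemma complex_poly_no_nonzero_root:
  fixes g :: "complex poly"
  assumes "\<And>t. t \<noteq> 0 \<Longrightarrow> poly g t \<noteq> 0"
  obtains a k where "g = monom a k"
proof -
  have "g \<noteq> 0" using assms[of 1] by auto
  then obtain h where h: "g = [:- 0, 1:] ^ order 0 g * h" "\<not> [:- 0, 1:] dvd h"
    using order_decomp by blast
  have "poly h t \<noteq> 0" for t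
  proof (cases "t = 0")
    case True then show ?thesis using h(2) by (simp add: poly_eq_0_iff_dvd)
  next
    case False
    have "poly g t \<noteq> 0" using assms False by blast
    then show ?thesis by (subst (asm) h(1)) auto
  qed
  then obtain a where "h = [:a:]"
    using fundamental_theorem_of_algebra[of h] constant_degree[of h] degree_eq_zeroE[of h] by blast
  then have "g = monom a (order 0 g)" using h(1) by (simp add: monom_altdef)
  then show ?thesis by (rule that)
qed

lemma mpoly_eval_graded:
  "mpoly_eval p (\<lambda>v. t ^ w v * c v) = poly (map_poly (\<lambda>q. mpoly_eval q c) (graded w p)) t"
proof -
  have "poly (map_poly (\<lambda>q. mpoly_eval q c) (graded w p)) t = mpoly_eval (poly (graded w p) (mconst t)) c"
    using rhom_poly_map[OF rhom_eval, of "graded w p" "mconst t" c] by simp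
  also have "\<dots> = mpoly_eval p (\<lambda>v. t ^ w v * c v)"
    unfolding poly_graded mpoly_eval_msubst[of p]
    by (subst rhom_msubst_comp[OF rhom_eval]) (auto simp: mult.commute)
  finally show ?thesis ..
qed

text \<open>If two graded components \<open>p_j\<close>, \<open>p_l\<close> were nonzero, then at a point where \<open>p\<close>, \<open>p_j\<close> and \<open>p_l\<close>
  do not vanish the orbit polynomial would have a nonzero root.\<close>

lemma weighted_homogeneous:
  fixes p :: "('v, complex) mpoly"
  assumes "p \<noteq> 0" and nz: "\<And>c t. t \<noteq> 0 \<Longrightarrow> mpoly_eval p c \<noteq> 0 \<Longrightarrow> mpoly_eval p (\<lambda>v. t ^ w v * c v) \<noteq> 0"
  obtains k where "\<And>c t. mpoly_eval p (\<lambda>v. t ^ w v * c v) = t ^ k * mpoly_eval p c"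
proof -
  let ?f = "graded w p"
  define k where "k = Polynomial.degree ?f"
  have "coeff ?f j = 0" if "j \<noteq> k" for j
  proof (rule ccontr)
    assume j: "coeff ?f j \<noteq> 0"
    moreover have "coeff ?f k \<noteq> 0" using assms(1) by (simp add: k_def)
    ultimately have "p * coeff ?f j * coeff ?f k \<noteq> 0"
      using mpoly_mult_eq_0[of "p * coeff ?f j" "coeff ?f k"] mpoly_mult_eq_0[of p "coeff ?f j"] assms(1) by blast
    then obtain c where "mpoly_eval (p * coeff ?f j * coeff ?f k) c \<noteq> 0"
      using mpoly_eqI[of "p * coeff ?f j * coeff ?f k" 0] by auto
    then have c: "mpoly_eval p c \<noteq> 0" "mpoly_eval (coeff ?f j) c \<noteq> 0" "mpoly_eval (coeff ?f k) c \<noteq> 0" by auto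
    let ?g = "map_poly (\<lambda>q. mpoly_eval q c) ?f"
    obtain a l where g: "?g = monom a l"
      using complex_poly_no_nonzero_root[of ?g] nz[OF _ c(1)] by (metis mpoly_eval_graded)
    have "coeff ?g j \<noteq> 0" "coeff ?g k \<noteq> 0" using c by (auto simp: coeff_map_poly)
    then show False unfolding g using that by (auto split: if_splits)
  qed
  then have f: "?f = monom (coeff ?f k) k" by (intro poly_eqI) auto
  have "p = poly ?f 1" by simp
  also have "\<dots> = coeff ?f k" by (subst f) (simp add: poly_monom)
  finally have fm: "?f = monom p k" using f by simp
  then have "mpoly_eval p (\<lambda>v. t ^ w v * c v) = t ^ k * mpoly_eval p c" for c t
    unfolding mpoly_eval_graded by (simp add: map_poly_monom poly_monom fm)
  then show ?thesis by (rule that)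
qed

text \<open>Up to a power of the variable, \<open>r\<close> is \<open>q\<close> with its
  coefficients reversed. Multiplication by \<open>t ^ degree q\<close> turns the hypothesis into an
  identity of polynomials, where degrees and leading coefficients can be compared.\<close>

lemma poly_reverse_degree:
  fixes r q :: "complex poly"
  assumes rq: "\<And>t. t \<noteq> 0 \<Longrightarrow> poly r t = t ^ N * poly q (inverse t)"
  shows "Polynomial.degree r \<le> N"
    and "poly q 0 \<noteq> 0 \<Longrightarrow> Polynomial.degree r = N \<and> lead_coeff r = poly q 0"
proof -
  let ?m = "Polynomial.degree q"
  have "poly (monom 1 ?m * r - monom 1 N * reflect_poly q) t = 0" if "t \<noteq> 0" for t
    using that rq[OF that] by (simp add: poly_monom poly_reflect_poly_nz)
  then have "UNIV - {0} \<subseteq> {t. poly (monom 1 ?m * r - monom 1 N * reflect_poly q) t = 0}" by blast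
  moreover have "infinite (UNIV - {0 :: complex})" by (simp add: infinite_UNIV_char_0)
  ultimately have "monom 1 ?m * r - monom 1 N * reflect_poly q = 0"
    using finite_subset poly_roots_finite by blast
  then have eq: "monom 1 ?m * r = monom 1 N * reflect_poly q" by simp
  have deg: "r \<noteq> 0 \<Longrightarrow> ?m + Polynomial.degree r = N + Polynomial.degree (reflect_poly q)"
  proof -
    assume "r \<noteq> 0"
    moreover from this have "q \<noteq> 0" using eq by auto
    ultimately show ?thesis
      using arg_cong[OF eq, of Polynomial.degree] by (simp add: degree_mult_eq degree_monom_eq)
  qed
  then show "Polynomial.degree r \<le> N"
    using degree_reflect_poly_le[of q] by (cases "r = 0") auto
  assume q0: "poly q 0 \<noteq> 0"
  then have "q \<noteq> 0" by auto
  then have "r \<noteq> 0" using eq by auto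
  then have "Polynomial.degree r = N" using deg q0 by (simp add: poly_0_coeff_0)
  moreover have "lead_coeff r = lead_coeff (reflect_poly q)"
    using arg_cong[OF eq, of lead_coeff] by (simp add: lead_coeff_mult degree_monom_eq)
  moreover have "lead_coeff (reflect_poly q) = poly q 0"
    using q0 by (simp add: coeff_reflect_poly poly_0_coeff_0)
  ultimately show "Polynomial.degree r = N \<and> lead_coeff r = poly q 0" by simp
qed

text \<open>As \<open>c + t e = t (e + c / t)\<close>, the behaviour of the pencil at infinity is
  that of \<open>p\<close> at \<open>e\<close>, where it does not vanish.\<close>

lemma homogeneous_pencil:
  fixes p :: "('v, complex) mpoly"
  assumes hom: "\<And>c t. mpoly_eval p (\<lambda>v. t * c v) = t ^ N * mpoly_eval p c" and e: "mpoly_eval p e \<noteq> 0"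
  shows "Polynomial.degree (along (\<lambda>v. [:c v, e v:]) p) = N"
    and "lead_coeff (along (\<lambda>v. [:c v, e v:]) p) = mpoly_eval p e"
proof -
  let ?r = "along (\<lambda>v. [:c v, e v:]) p" and ?q = "along (\<lambda>v. [:e v, c v:]) p"
  have *: "poly ?r t = t ^ N * poly ?q (inverse t)" if "t \<noteq> 0" for t
  proof -
    have "(\<lambda>v. c v + t * e v) = (\<lambda>v. t * (e v + inverse t * c v))"
      using that by (auto simp: algebra_simps)
    then show ?thesis using hom[of t "\<lambda>v. e v + inverse t * c v"] by simp
  qed
  have q0: "poly ?q 0 = mpoly_eval p e" by simp
  show "Polynomial.degree ?r = N" "lead_coeff ?r = mpoly_eval p e"
    using poly_reverse_degree(2)[OF *] e unfolding q0 by blast+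
qed

section \<open>Roots of small modulus and limits of singular systems\<close>

lemma prod_mset_norm_ge:
  fixes A :: "complex multiset"
  assumes "\<And>x. x \<in># A \<Longrightarrow> norm x \<ge> m" "m \<ge> 0"
  shows "norm (\<Prod>x\<in>#A. x) \<ge> m ^ size A"
  using assms by (induction A) (auto simp: norm_mult intro!: mult_mono)

text \<open>The moduli of the \<open>N\<close> roots multiply to the bound, so the
  \<open>N\<close>-th power of the smallest does not exceed it.\<close>

lemma small_root_ex:
  fixes r :: "complex poly"
  assumes "Polynomial.degree r = N" "N > 0"
  obtains t where "poly r t = 0" "norm t ^ N \<le> norm (poly r 0) / norm (lead_coeff r)"
proof -
  have r0: "lead_coeff r \<noteq> 0" using assms by auto
  obtain A where A: "size A = N" "r = Polynomial.smult (lead_coeff r) (\<Prod>x\<in>#A. [:-x, 1:])"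
    using alg_closed_imp_factorization[of r] assms r0 by auto
  then have "set_mset A \<noteq> {}" using assms by auto
  then obtain t where t: "t \<in># A" "\<And>x. x \<in># A \<Longrightarrow> norm t \<le> norm x"
    using ex_min_if_finite[of "norm ` set_mset A"] by (auto simp: not_less)
  show ?thesis
  proof (rule that)
    show "poly r t = 0"
      using t(1) by (subst A(2)) (auto simp: poly_prod_mset prod_mset_zero_iff image_iff intro!: bexI[of _ t])
    have "poly r 0 = lead_coeff r * (\<Prod>x\<in>#A. - x)"
      by (subst A(2)) (simp add: poly_prod_mset)
    then have "norm (poly r 0) / norm (lead_coeff r) = norm (\<Prod>x\<in>#image_mset uminus A. x)"
      using r0 by (simp add: norm_mult)
    also have "\<dots> \<ge> norm t ^ size (image_mset uminus A)"
      by (rule prod_mset_norm_ge) (use t in auto)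
    finally show "norm t ^ N \<le> norm (poly r 0) / norm (lead_coeff r)" using A by simp
  qed
qed

lemma irreducible_iso:
  fixes f :: "'a::comm_ring_1 \<Rightarrow> 'a"
  assumes "rhom f" "rhom g" "\<And>p. g (f p) = p" "\<And>p. f (g p) = p" "irreducible p"
  shows "irreducible (f p)"
proof (rule irreducibleI)
  have unit: "h q dvd 1" if "rhom h" "q dvd 1" for h :: "'a \<Rightarrow> 'a" and q
  proof -
    obtain s where "1 = q * s" using \<open>q dvd 1\<close> ..
    then have "1 = h q * h s" using rhom_simps(1,3)[OF \<open>rhom h\<close>] by metis
    then show ?thesis ..
  qed
  show "f p \<noteq> 0" using assms(3)[of p] assms(5) rhom_simps(4)[OF assms(2)] by (auto simp: irreducible_def)
  show "\<not> f p dvd 1" using unit[OF assms(2), of "f p"] assms(3,5) by (auto simp: irreducible_def)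
  fix a b assume "f p = a * b"
  then have "p = g a * g b" using assms(3)[of p] rhom_simps(3)[OF assms(2)] by metis
  then have "g a dvd 1 \<or> g b dvd 1" using assms(5) irreducibleD by blast
  then show "a dvd 1 \<or> b dvd 1" using unit[OF assms(1), of "g a"] unit[OF assms(1), of "g b"] assms(4) by auto
qed

text \<open>By homogeneity the common zeros can be taken on the unit sphere, where a subsequence
  converges to a common zero of the limit.\<close>

lemma singular_closed:
  fixes c :: "nat \<Rightarrow> 'n::finite \<times> 'n multiset \<Rightarrow> complex"
  assumes "\<And>n. c n \<in> singular d" "\<And>v. (\<lambda>n. c n v) \<longlonglongrightarrow> c0 v"
  shows "c0 \<in> singular d"
proof -
  have "\<exists>x. norm x = 1 \<and> (\<forall>i. form_eval d (c n) i x = 0)" for n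
  proof -
    obtain y :: "complex ^ 'n" where y: "y \<noteq> 0" "\<forall>i. form_eval d (c n) i y = 0"
      using assms(1)[of n] by (auto simp: singular_def)
    let ?z = "complex_of_real (inverse (norm y))"
    have "norm (?z *s y) = norm (inverse (norm y) *\<^sub>R y)"
      by (rule arg_cong[of _ _ norm]) (simp add: Finite_Cartesian_Product.vec_eq_iff, simp add: scaleR_conv_of_real)
    then have "norm (?z *s y) = 1" using y(1) by simp
    then show ?thesis using y(2) by (intro exI[of _ "?z *s y"]) (simp add: form_eval_scale)
  qed
  then obtain x :: "nat \<Rightarrow> complex ^ 'n" where x: "\<And>n. norm (x n) = 1" "\<And>n i. form_eval d (c n) i (x n) = 0"
    by metis
  have "seq_compact (sphere (0 :: complex ^ 'n) 1)" using compact_sphere compact_imp_seq_compact by blast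
  moreover have "\<forall>n. x n \<in> sphere 0 1" using x by simp
  ultimately obtain l r where l: "l \<in> sphere 0 1" "strict_mono r" "(x \<circ> r) \<longlonglongrightarrow> l"
    using seq_compactE by metis
  have "form_eval d c0 i l = 0" for i
  proof -
    have cr: "(\<lambda>n. c (r n) v) \<longlonglongrightarrow> c0 v" for v
      using LIMSEQ_subseq_LIMSEQ[OF assms(2) l(2)] by (simp add: o_def)
    have "(\<lambda>n. form_eval d (c (r n)) i ((x \<circ> r) n)) \<longlonglongrightarrow> form_eval d c0 i l"
      unfolding form_eval_monom_at
      by (intro tendsto_sum tendsto_mult cr tendsto_monom_at l(3))
    then show ?thesis using x(2) by (simp add: o_def LIMSEQ_const_iff)
  qed
  moreover have "l \<noteq> 0" using l(1) by auto
  ultimately show ?thesis by (auto simp: singular_def)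
qed

section \<open>Existence and uniqueness of the resultant\<close>

context
  fixes d :: nat and R :: "('n::finite \<times> 'n multiset, complex) mpoly"
  assumes d: "d > 0" and R_ideal: "R \<in> resideal d" and R_irr: "irreducible R"
    and R_E: "mpoly_eval R (Ecoef d) = 1" and R_dvd: "\<And>G. G \<in> resideal d \<Longrightarrow> R dvd G"
begin

lemma R_zero_of_dvd: "R dvd G \<Longrightarrow> mpoly_eval R c = 0 \<Longrightarrow> mpoly_eval G c = 0"
  by (auto elim!: dvdE)

text \<open>The zeros of \<open>R\<close> are not yet known to be singular, so their invariance
  under scaling comes from divisibility: the polynomial \<open>R (a / t)\<close> in \<open>a\<close>
  also lies in the ideal, hence is a multiple of \<open>R\<close>, and a zero of \<open>R\<close> at
  \<open>t c\<close> forces one at \<open>c\<close>.\<close>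

lemma R_homogeneous:
  obtains N where "\<And>c t. mpoly_eval R (\<lambda>v. t * c v) = t ^ N * mpoly_eval R c"
proof -
  have "mpoly_eval R (\<lambda>v. t ^ 1 * c v) \<noteq> 0" if t: "t \<noteq> 0" and c: "mpoly_eval R c \<noteq> 0" for t c
  proof
    assume z: "mpoly_eval R (\<lambda>v. t ^ 1 * c v) = 0"
    define Q where "Q = msubst mconst (\<lambda>v. mconst (inverse t) * mvar v) R"
    have ev: "mpoly_eval Q a = mpoly_eval R (\<lambda>v. inverse t * a v)" for a
      unfolding Q_def mpoly_eval_msubst[of R] by (subst rhom_msubst_comp[OF rhom_eval]) auto
    have "Q \<in> resideal d"
      unfolding resideal_def
    proof (intro CollectI conjI ballI)
      show "Q \<in> Pol (cvars d)"
        unfolding Q_def by (rule msubst_Pol[OF resideal_Pol[OF R_ideal]]) (auto intro: Pol_mult Pol_mvar)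
      show "mpoly_eval Q a = 0" if "a \<in> singular d" for a
        unfolding ev by (rule resideal_eval[OF R_ideal singular_scale[OF that]])
    qed
    then have "mpoly_eval Q (\<lambda>v. t ^ 1 * c v) = 0" using R_zero_of_dvd[OF R_dvd] z by blast
    then show False using c t by (simp add: ev flip: mult.assoc)
  qed
  moreover have "R \<noteq> 0" using R_irr by (auto simp: irreducible_def)
  ultimately obtain N where "\<And>c t. mpoly_eval R (\<lambda>v. t ^ 1 * c v) = t ^ N * mpoly_eval R c"
    using weighted_homogeneous[of R "\<lambda>_. 1"] by blast
  then show ?thesis by (intro that[of N]) simp
qed

text \<open>On the singular systems the partial derivatives of \<open>R\<close> with respect to the coefficients of
  one form are proportional to the monomials at the common zero, which recovers the zero.\<close>

lemma R_deriv_zero: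
  fixes k :: 'n
  obtains G where "G \<in> Pol (cvars d)" "\<not> R dvd G"
    "\<And>c. mpoly_eval R c = 0 \<Longrightarrow> mpoly_eval G c \<noteq> 0 \<Longrightarrow> c \<in> singular d"
proof -
  obtain D where D: "\<And>v. D v \<in> Pol (cvars d)" and deriv: "\<And>c w. ((\<lambda>s. mpoly_eval R (\<lambda>v. c v + s * w v))
    has_field_derivative (\<Sum>v\<in>cvars d. w v * mpoly_eval (D v) c)) (at 0)"
    using mpoly_derivs[OF finite_cvars resideal_Pol[OF R_ideal]] by blast
  define y where "y = (k, replicate_mset d k)"
  have yV: "y \<in> cvars d" by (simp add: y_def cvars_def)
  have mem_cvars: "(i, \<alpha>) \<in> cvars d \<longleftrightarrow> size \<alpha> = d" for i :: 'n and \<alpha> by (simp add: cvars_def)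
  have sum_delta: "(\<Sum>v\<in>cvars d. (if v = u then a else 0) * f v) = a * f u" if "u \<in> cvars d"
    for u :: "'n \<times> 'n multiset" and a and f :: "_ \<Rightarrow> complex"
    using that by (simp add: if_distrib[of "\<lambda>a. a * _"] sum.delta cong: if_cong)
  \<comment> \<open>The two parts of the direction \<open>?w\<close> cancel at \<open>x\<close>, so
    \<open>x\<close> remains a common zero along the line. Hence \<open>R\<close> vanishes on the
    line and its derivative in this direction is 0.\<close>
  have ratio: "monom_at \<beta> x * mpoly_eval (D (k, \<alpha>)) c = monom_at \<alpha> x * mpoly_eval (D (k, \<beta>)) c"
    if x: "x \<noteq> 0" "\<And>i. form_eval d c i x = 0" and sz: "size \<alpha> = d" "size \<beta> = d" for c x \<alpha> \<beta>
  proof -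
    let ?w = "\<lambda>v. (if v = (k, \<alpha>) then monom_at \<beta> x else 0) + (- 1) * (if v = (k, \<beta>) then monom_at \<alpha> x else 0)"
    have "form_eval d ?w i x = 0" for i
      unfolding form_eval_lin form_eval_delta[OF sz(1)] form_eval_delta[OF sz(2)] by simp
    then have "form_eval d (\<lambda>v. c v + s * ?w v) i x = 0" for i s
      unfolding form_eval_lin[of d c s ?w i x] using x(2) by simp
    then have "(\<lambda>v. c v + s * ?w v) \<in> singular d" for s
      unfolding singular_def using x(1) by blast
    then have "mpoly_eval R (\<lambda>v. c v + s * ?w v) = 0" for s
      using resideal_eval[OF R_ideal] by blast
    then have "((\<lambda>s. 0) has_field_derivative (\<Sum>v\<in>cvars d. ?w v * mpoly_eval (D v) c)) (at 0)"
      using deriv[of c ?w] by simp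
    then have "(\<Sum>v\<in>cvars d. ?w v * mpoly_eval (D v) c) = 0"
      using DERIV_unique DERIV_const by blast
    also have "(\<Sum>v\<in>cvars d. ?w v * mpoly_eval (D v) c) =
      (\<Sum>v\<in>cvars d. (if v = (k, \<alpha>) then monom_at \<beta> x else 0) * mpoly_eval (D v) c) -
      (\<Sum>v\<in>cvars d. (if v = (k, \<beta>) then monom_at \<alpha> x else 0) * mpoly_eval (D v) c)"
      unfolding sum_subtractf[symmetric] by (intro sum.cong refl) (simp add: algebra_simps)
    also have "\<dots> = monom_at \<beta> x * mpoly_eval (D (k, \<alpha>)) c - monom_at \<alpha> x * mpoly_eval (D (k, \<beta>)) c"
      using sz sum_delta[of "(k, \<alpha>)"] sum_delta[of "(k, \<beta>)"] by (simp add: mem_cvars)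
    finally show ?thesis by simp
  qed
  \<comment> \<open>The monomials \<open>x_j x_k^(d-1)\<close>. The derivatives in these
    coefficients form the vector \<open>P c\<close>, a multiple of \<open>x\<close> whenever
    \<open>x\<close> is a nonzero common zero of \<open>c\<close>.\<close>
  define a where "a j = add_mset j (replicate_mset (d - 1) k)" for j
  have size_a: "size (a j) = d" for j using d by (simp add: a_def)
  have a_k: "a k = replicate_mset d k" using d by (cases d) (simp_all add: a_def)
  define P where "P c = (\<chi> j. mpoly_eval (D (k, a j)) c)" for c
  \<comment> \<open>Form \<open>i\<close> evaluated at the vector \<open>P\<close>. It vanishes on
    singular systems, so \<open>R\<close> divides it, and at every zero \<open>c\<close> of
    \<open>R\<close> the vector \<open>P c\<close> is a common zero, nonzero if \<open>D y\<close>
    is nonzero at \<open>c\<close>.\<close>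
  define Q where "Q i = (\<Sum>\<alpha> | size \<alpha> = d. mvar (i, \<alpha>) * (\<Prod>j\<in>#\<alpha>. D (k, a j)))" for i
  have Q_eval: "mpoly_eval (Q i) c = form_eval d c i (P c)" for i c
  proof -
    have "mpoly_eval (\<Prod>j\<in>#\<alpha>. D (k, a j)) c = monom_at \<alpha> (P c)" for \<alpha>
      by (induction \<alpha>) (auto simp: P_def)
    then show ?thesis by (simp add: Q_def form_eval_monom_at)
  qed
  have Q_ideal: "Q i \<in> resideal d" for i
    unfolding resideal_def
  proof (intro CollectI conjI ballI)
    have "(\<Prod>j\<in>#\<alpha>. D (k, a j)) \<in> Pol (cvars d)" for \<alpha>
      by (induction \<alpha>) (auto intro: Pol_mult D)
    then show "Q i \<in> Pol (cvars d)"
      unfolding Q_def by (auto intro!: Pol_sum Pol_mult Pol_mvar simp: cvars_def)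
    fix c :: "'n \<times> 'n multiset \<Rightarrow> complex" assume "c \<in> singular d"
    then obtain x where x: "x \<noteq> 0" "\<And>i. form_eval d c i x = 0" by (auto simp: singular_def)
    obtain l where l: "x $ l \<noteq> 0" using x(1) by (auto simp: Finite_Cartesian_Product.vec_eq_iff)
    define b where "b = replicate_mset d l"
    have b: "size b = d" "monom_at b x \<noteq> 0" using l by (auto simp: b_def)
    have "P c $ j = (x $ k ^ (d - 1) * mpoly_eval (D (k, b)) c / monom_at b x) * x $ j" for j
      using ratio[OF x size_a b(1), of j] b(2) by (simp add: P_def a_def field_simps)
    then have "P c = (x $ k ^ (d - 1) * mpoly_eval (D (k, b)) c / monom_at b x) *s x"
      by (simp add: Finite_Cartesian_Product.vec_eq_iff)
    then show "mpoly_eval (Q i) c = 0" unfolding Q_eval by (simp add: form_eval_scale x)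
  qed
  have sing: "c \<in> singular d" if "mpoly_eval R c = 0" "mpoly_eval (D y) c \<noteq> 0" for c
  proof -
    have "form_eval d c i (P c) = 0" for i
      using R_zero_of_dvd[OF R_dvd[OF Q_ideal] that(1)] by (simp add: Q_eval)
    moreover have "P c $ k \<noteq> 0" using that(2) by (simp add: P_def a_k y_def)
    then have "P c \<noteq> 0" by auto
    ultimately show ?thesis by (auto simp: singular_def)
  qed
  \<comment> \<open>Otherwise, on each line in direction \<open>y\<close>, the derivative of
    \<open>R\<close> would be a multiple of \<open>R\<close>; for reasons of degree \<open>R\<close>
    would be constant there, hence free of \<open>y\<close>.\<close>
  have "\<not> R dvd D y"
  proof
    assume "R dvd D y"
    then obtain q where q: "D y = R * q" ..
    have const: "mpoly_eval R (c(y := t)) = mpoly_eval R c" for c t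
    proof -
      define \<gamma> where "\<gamma> v = [:c v, if v = y then 1 else 0:]" for v
      let ?L = "along \<gamma> R"
      have L: "poly ?L s = mpoly_eval R (\<lambda>v. c v + s * (if v = y then 1 else 0))" for s
        by (simp add: \<gamma>_def)
      have "poly (pderiv ?L) s = poly (?L * along \<gamma> q) s" for s
      proof -
        let ?c = "\<lambda>v. c v + s * (if v = y then 1 else 0)"
        have "((\<lambda>h. poly ?L (s + h)) has_field_derivative mpoly_eval (D y) ?c) (at 0)"
          using deriv[of ?c "\<lambda>v. if v = y then 1 else 0"]
          unfolding L sum_delta[OF yV] by (simp add: algebra_simps)
        then have "(poly ?L has_field_derivative mpoly_eval (D y) ?c) (at s)"
          using DERIV_at_within_shift[of "poly ?L" _ s 0 UNIV] by simp
        then have "poly (pderiv ?L) s = mpoly_eval (D y) ?c" using DERIV_unique poly_DERIV by blast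
        then show ?thesis by (simp add: q \<gamma>_def)
      qed
      then have eq: "pderiv ?L = ?L * along \<gamma> q" using poly_eq_poly_eq_iff by blast
      have "pderiv ?L = 0"
      proof (rule ccontr)
        assume n: "pderiv ?L \<noteq> 0"
        then have "?L \<noteq> 0" "along \<gamma> q \<noteq> 0" using eq by auto
        then have "Polynomial.degree (pderiv ?L) \<ge> Polynomial.degree ?L"
          unfolding eq by (simp add: degree_mult_eq)
        moreover have "Polynomial.degree ?L \<noteq> 0" using n pderiv_eq_0_iff by blast
        ultimately show False by (simp add: degree_pderiv)
      qed
      then have "Polynomial.degree ?L = 0" by (simp add: pderiv_eq_0_iff)
      then obtain b where "?L = [:b:]" by (rule degree_eq_zeroE)
      then have "poly ?L (t - c y) = poly ?L 0" by simp
      moreover have "(\<lambda>v. c v + (t - c y) * (if v = y then 1 else 0)) = c(y := t)" by auto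
      ultimately show ?thesis unfolding L by simp
    qed
    have "R = msubst mconst (mvar(y := 0)) R"
    proof (rule mpoly_eqI)
      fix c :: "'n \<times> 'n multiset \<Rightarrow> complex"
      have "mpoly_eval (msubst mconst (mvar(y := 0)) R) c = mpoly_eval R (c(y := 0))"
        unfolding mpoly_eval_msubst[of R]
        by (subst rhom_msubst_comp[OF rhom_eval]) (auto intro!: msubst_cong)
      then show "mpoly_eval R c = mpoly_eval (msubst mconst (mvar(y := 0)) R) c" using const by simp
    qed
    moreover have "msubst mconst (mvar(y := 0)) R \<in> Pol (cvars d - {y})"
      by (rule msubst_Pol[OF resideal_Pol[OF R_ideal]]) (auto intro: Pol_mvar)
    ultimately have "R \<in> Pol (cvars d - {y})" by simp
    then have "R = 0" using resideal_free_eq_0[OF d R_ideal] by (simp add: y_def)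
    then show False using R_irr by (simp add: irreducible_def)
  qed
  with D sing show ?thesis by (intro that[of "D y"])
qed

text \<open>Points of the zero set of \<open>R\<close> are limits of singular systems: eliminating the pencil parameter
  from \<open>R\<close> and \<open>G\<close> gives a polynomial \<open>H\<close>, and off its zero set every root of \<open>R (c + t E)\<close>
  is singular.\<close>

lemma R_zero_iff: "mpoly_eval R c0 = 0 \<longleftrightarrow> c0 \<in> singular d"
proof
  assume "c0 \<in> singular d" then show "mpoly_eval R c0 = 0" by (rule resideal_eval[OF R_ideal])
next
  assume c0: "mpoly_eval R c0 = 0"
  define k :: 'n where "k = undefined"
  obtain G where G: "G \<in> Pol (cvars d)" "\<not> R dvd G"
    "\<And>c. mpoly_eval R c = 0 \<Longrightarrow> mpoly_eval G c \<noteq> 0 \<Longrightarrow> c \<in> singular d"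
    using R_deriv_zero by blast
  obtain N where hom: "\<And>c t. mpoly_eval R (\<lambda>v. t * c v) = t ^ N * mpoly_eval R c"
    using R_homogeneous by blast
  let ?E = "Ecoef d" and ?V = "cvars d :: ('n \<times> 'n multiset) set"
  define r where "r c = along (\<lambda>v. [:c v, ?E v:]) R" for c
  have r: "Polynomial.degree (r c) = N" "lead_coeff (r c) = 1" for c
    using homogeneous_pencil[OF hom, of ?E c] R_E unfolding r_def by auto
  have r_eval: "poly (r c) t = mpoly_eval R (\<lambda>v. c v + t * ?E v)" for c t by (simp add: r_def)
  have "N \<noteq> 0"
  proof
    assume "N = 0"
    then obtain a where a: "r c0 = [:a:]" using r(1)[of c0] by (auto elim: degree_eq_zeroE)
    then show False using r(2)[of c0] r_eval[of c0 0] c0 by simp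
  qed
  then have N: "N > 0" by simp
  \<comment> \<open>The size \<open>d + 1\<close> keeps \<open>\<tau>\<close> outside
    \<open>cvars d\<close>, so that it can serve as the parameter of the pencil.\<close>
  define \<tau> where "\<tau> = (k, replicate_mset (d + 1) k)"
  have \<tau>: "\<tau> \<notin> ?V" by (simp add: \<tau>_def cvars_def)
  \<comment> \<open>The shift \<open>c + e \<tau> E\<close> has the inverse \<open>sh (- e)\<close>,
    so the shifted \<open>R\<close> is still irreducible.\<close>
  define sh where "sh e = msubst mconst (\<lambda>v. if v \<in> ?V then mvar v + mconst (e * ?E v) * mvar \<tau> else mvar v)" for e
  have sh_eval: "mpoly_eval (sh e p) a = mpoly_eval p (\<lambda>v. if v \<in> ?V then a v + e * ?E v * a \<tau> else a v)" for e p a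
    unfolding sh_def mpoly_eval_msubst[of p]
    by (subst rhom_msubst_comp[OF rhom_eval]) (auto intro!: msubst_cong)
  have rh: "rhom (sh e)" for e unfolding sh_def by (rule rhom_msubst) simp
  have inv: "sh (- e) (sh e p) = p" for e p
    by (rule mpoly_eqI) (auto simp: sh_eval \<tau> intro!: mpoly_eval_cong)
  have inv': "sh 1 (sh (- 1) p) = p" for p using inv[of "-1" p] by simp
  have shV: "sh 1 p \<in> Pol (insert \<tau> ?V)" if "p \<in> Pol ?V" for p
    unfolding sh_def by (rule msubst_Pol[OF that]) (auto intro!: Pol_add Pol_mult Pol_mvar)
  have ev_t: "mpoly_eval (sh 1 p) (c(\<tau> := t)) = mpoly_eval p (\<lambda>v. c v + t * ?E v)" if "p \<in> Pol ?V" for p c t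
    unfolding sh_eval by (rule mpoly_eval_cong) (use that \<tau> in \<open>auto simp: Pol_def\<close>)
  have RV: "R \<in> Pol ?V" by (rule resideal_Pol[OF R_ideal])
  have irr: "irreducible (sh 1 R)"
    using irreducible_iso[OF rh rh inv inv' R_irr] .
  have notin: "sh 1 R \<notin> Pol ?V"
  proof
    assume "sh 1 R \<in> Pol ?V"
    then have "mpoly_eval (sh 1 R) (c0(\<tau> := t)) = mpoly_eval (sh 1 R) (c0(\<tau> := 0))" for t
      by (intro mpoly_eval_cong) (use \<tau> in \<open>auto simp: Pol_def\<close>)
    then have "poly (r c0) t = 0" for t
      unfolding ev_t[OF RV] r_eval using c0 by simp
    then have "r c0 = 0" using poly_all_0_iff_0 by blast
    then show False using r(2)[of c0] by simp
  qed
  have ndvd: "\<not> sh 1 R dvd sh 1 G"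
  proof
    assume "sh 1 R dvd sh 1 G"
    then obtain q where "sh 1 G = sh 1 R * q" ..
    then have "G = R * sh (- 1) q" using inv[of 1 G] inv[of 1 R] rhom_simps(3)[OF rh] by metis
    then show False using G(2) by simp
  qed
  obtain u v where H: "u * sh 1 R + v * sh 1 G \<in> Pol ?V" "u * sh 1 R + v * sh 1 G \<noteq> 0"
    using bezout_free[OF finite_cvars \<tau> shV[OF RV] irr notin shV[OF G(1)] ndvd] by blast
  define H where "H = u * sh 1 R + v * sh 1 G"
  \<comment> \<open>\<open>H\<close> is free of \<open>\<tau>\<close>. At a root \<open>t\<close>
    its summand with \<open>R\<close> vanishes, so the summand with \<open>G\<close> does
    not.\<close>
  have key: "(\<lambda>v. c v + t * ?E v) \<in> singular d"
    if "mpoly_eval H c \<noteq> 0" "poly (r c) t = 0" for c t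
  proof (rule G(3))
    show R0: "mpoly_eval R (\<lambda>v. c v + t * ?E v) = 0" using that(2) by (simp add: r_eval)
    have "mpoly_eval H c = mpoly_eval H (c(\<tau> := t))"
      by (rule mpoly_eval_cong) (use H(1) \<tau> in \<open>auto simp: Pol_def H_def\<close>)
    also have "\<dots> = mpoly_eval v (c(\<tau> := t)) * mpoly_eval G (\<lambda>v. c v + t * ?E v)"
      using R0 by (simp add: H_def ev_t[OF RV] ev_t[OF G(1)])
    finally show "mpoly_eval G (\<lambda>v. c v + t * ?E v) \<noteq> 0" using that(1) by auto
  qed
  \<comment> \<open>On the line from \<open>c0\<close> to \<open>b\<close> the polynomial
    \<open>H\<close> has finitely many zeros, so points \<open>c n\<close> tending to
    \<open>c0\<close> can avoid them.\<close>
  obtain b where b: "mpoly_eval H b \<noteq> 0" using H(2) mpoly_eqI[of H 0] by (auto simp: H_def)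
  define \<gamma> where "\<gamma> v = [:c0 v, b v - c0 v:]" for v
  have "poly (along \<gamma> H) 1 \<noteq> 0" using b by (simp add: \<gamma>_def)
  then have Hnz: "along \<gamma> H \<noteq> 0" by (metis poly_0)
  define \<sigma> where "\<sigma> n = complex_of_real (inverse (real (Suc n)))" for n
  have \<sigma>0: "\<sigma> \<longlonglongrightarrow> 0"
    unfolding \<sigma>_def using tendsto_of_real[OF LIMSEQ_inverse_real_of_nat, where 'a = complex]
    by (simp only: of_real_0)
  have "inj \<sigma>" by (auto simp: inj_def \<sigma>_def)
  then have "finite (\<sigma> -` {s. poly (along \<gamma> H) s = 0})"
    using finite_vimageI poly_roots_finite[OF Hnz] by blast
  then obtain m where m: "\<And>n. n \<in> \<sigma> -` {s. poly (along \<gamma> H) s = 0} \<Longrightarrow> n < m"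
    using finite_nat_set_iff_bounded by metis
  define s where "s n = \<sigma> (n + m)" for n
  have s0: "s \<longlonglongrightarrow> 0" unfolding s_def using \<sigma>0 by (rule LIMSEQ_ignore_initial_segment)
  define c where "c n v = poly (\<gamma> v) (s n)" for n v
  have Hc: "mpoly_eval H (c n) \<noteq> 0" for n
  proof -
    have "poly (along \<gamma> H) (s n) \<noteq> 0" using m[of "n + m"] by (auto simp: s_def)
    then show ?thesis by (simp add: c_def[abs_def])
  qed
  \<comment> \<open>The pencil is monic with constant term \<open>R (c n)\<close>, which tends to
    \<open>R c0 = 0\<close>; hence the chosen roots tend to 0.\<close>
  have "\<exists>t. poly (r (c n)) t = 0 \<and> norm t ^ N \<le> norm (mpoly_eval R (c n))" for n
    using small_root_ex[OF r(1) N, of "c n"] r(2)[of "c n"] r(1)[of "c n"] by (auto simp: r_eval)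
  then obtain t where t: "\<And>n. poly (r (c n)) (t n) = 0" "\<And>n. norm (t n) ^ N \<le> norm (mpoly_eval R (c n))"
    by metis
  have cc: "(\<lambda>n. c n v) \<longlonglongrightarrow> c0 v" for v
    using tendsto_add[OF tendsto_const tendsto_mult_left_zero[OF s0, of "b v - c0 v"], of "c0 v"]
    by (simp add: c_def \<gamma>_def)
  have "(\<lambda>n. poly (along \<gamma> R) (s n)) \<longlonglongrightarrow> poly (along \<gamma> R) 0"
    by (rule isCont_tendsto_compose[OF poly_isCont s0])
  then have "(\<lambda>n. mpoly_eval R (c n)) \<longlonglongrightarrow> 0" using c0 by (simp add: c_def[abs_def] \<gamma>_def)
  then have "(\<lambda>n. norm (mpoly_eval R (c n))) \<longlonglongrightarrow> 0" by (rule tendsto_norm_zero)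
  then have "(\<lambda>n. norm (t n) ^ N) \<longlonglongrightarrow> 0"
    by (rule tendsto_sandwich[OF always_eventually always_eventually tendsto_const, rotated 2]) (use t in auto)
  then have "(\<lambda>n. root N (norm (t n) ^ N)) \<longlonglongrightarrow> root N 0" by (rule tendsto_real_root)
  then have "t \<longlonglongrightarrow> 0" using N by (simp add: real_root_power_cancel tendsto_norm_zero_iff)
  then have "(\<lambda>n. c n v + t n * ?E v) \<longlonglongrightarrow> c0 v" for v
    using tendsto_add[OF cc[of v] tendsto_mult_left_zero[of t _ "?E v"]] by simp
  then show "c0 \<in> singular d"
    using singular_closed[of "\<lambda>n v. c n v + t n * ?E v" d c0] key[OF Hc t(1)] by blast
qed

lemma is_resultant_R: "is_resultant d R"
  unfolding is_resultant_def
  using resideal_Pol[OF R_ideal] R_irr R_E R_zero_iff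
  by (auto simp: Pol_def cvars_def Ecoef_def singular_def)

text \<open>\<open>R'\<close> lies in the ideal, so it is a multiple of \<open>R\<close>;
  irreducibility makes the cofactor constant, and the common value at \<open>Ecoef d\<close> makes
  it 1.\<close>

lemma resultant_unique:
  assumes "is_resultant d R'"
  shows "R' = R"
proof -
  have R': "R' \<in> Pol (cvars d)" "irreducible R'" "mpoly_eval R' (Ecoef d) = 1"
    "\<And>c. mpoly_eval R' c = 0 \<longleftrightarrow> c \<in> singular d"
    using assms by (auto simp: is_resultant_def Pol_def cvars_def Ecoef_def singular_def)
  then have "R' \<in> resideal d" by (simp add: resideal_def)
  then obtain q where q: "R' = R * q" using R_dvd by (auto elim: dvdE)
  then have "q dvd 1" using R'(2) R_irr by (auto simp: irreducible_def)
  then obtain a where a: "q = mconst a" by (auto simp: mpoly_unit_iff elim: tdeg_eq_0)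
  have "a = 1" using R'(3) R_E by (simp add: q a)
  then show ?thesis using q a by simp
qed

end

text \<open>The divisibility clause is kept because the upper degree bound compares the resultant
  with Macaulay's determinants.\<close>

theorem is_resultant_resultant:
  assumes d: "d > 0"
  shows "is_resultant d (resultant d :: ('n::finite \<times> 'n multiset, complex) mpoly) \<and>
    (\<forall>G \<in> resideal d. (resultant d :: ('n \<times> 'n multiset, complex) mpoly) dvd G)"
proof (rule resideal_generator[OF d, where 'n = 'n])
  fix R :: "('n \<times> 'n multiset, complex) mpoly"
  assume R: "R \<in> resideal d" "irreducible R" "mpoly_eval R (Ecoef d) = 1" "\<And>G. G \<in> resideal d \<Longrightarrow> R dvd G"
  have "resultant d = R"
    unfolding resultant_def
  proof (rule the_equality)
    show "is_resultant d R" by (rule is_resultant_R[OF d R])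
    show "R' = R" if "is_resultant d R'" for R' by (rule resultant_unique[OF d R that])
  qed
  then show ?thesis using is_resultant_R[OF d R] R(4) by simp
qed

section \<open>Degrees and eigenvalues\<close>

text \<open>The coefficients are powers \<open>s ^ h j\<close> with distinct exponents. Each pair of
  distinct points gives a nonzero polynomial in \<open>s\<close>, and some \<open>s\<close> avoids
  the roots of all of them.\<close>

lemma separating_linear_form:
  fixes S :: "(complex ^ 'n::finite) set"
  assumes "finite S"
  obtains a :: "'n \<Rightarrow> complex" where "inj_on (\<lambda>x. \<Sum>j\<in>UNIV. a j * x $ j) S"
proof -
  obtain h :: "'n \<Rightarrow> nat" where h: "inj h" using finite_imp_inj_to_nat_seg[of "UNIV :: 'n set"] by auto
  define q where "q x y = (\<Sum>j\<in>UNIV. monom (x $ j - y $ j) (h j))" for x y :: "complex ^ 'n"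
  have q: "q x y \<noteq> 0" if "x \<noteq> y" for x y
  proof -
    obtain j where j: "x $ j \<noteq> y $ j" using \<open>x \<noteq> y\<close> by (auto simp: Finite_Cartesian_Product.vec_eq_iff)
    have "coeff (q x y) (h j) = (\<Sum>i\<in>UNIV. if i = j then x $ i - y $ i else 0)"
      unfolding q_def coeff_sum by (intro sum.cong refl) (use h in \<open>auto simp: inj_def\<close>)
    then have "coeff (q x y) (h j) \<noteq> 0" using j by simp
    then show ?thesis by auto
  qed
  let ?D = "{p \<in> S \<times> S. fst p \<noteq> snd p}"
  have "(\<Prod>p\<in>?D. q (fst p) (snd p)) \<noteq> 0" using assms q by (auto simp: prod_zero_iff)
  then obtain s where s: "poly (\<Prod>p\<in>?D. q (fst p) (snd p)) s \<noteq> 0" using poly_all_0_iff_0 by blast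
  have "inj_on (\<lambda>x. \<Sum>j\<in>UNIV. s ^ h j * x $ j) S"
  proof (rule inj_onI, rule ccontr)
    fix x y assume xy: "x \<in> S" "y \<in> S" "(\<Sum>j\<in>UNIV. s ^ h j * x $ j) = (\<Sum>j\<in>UNIV. s ^ h j * y $ j)" "x \<noteq> y"
    have "poly (q x y) s = (\<Sum>j\<in>UNIV. s ^ h j * x $ j) - (\<Sum>j\<in>UNIV. s ^ h j * y $ j)"
      by (simp add: q_def poly_sum poly_monom algebra_simps sum_subtractf)
    then have "poly (q x y) s = 0" using xy by simp
    then show False using s xy assms by (auto simp: poly_prod)
  qed
  then show ?thesis by (rule that)
qed

section \<open>Degrees of the resultant in rows and columns\<close>

context
  fixes d :: nat and R :: "('n::finite \<times> 'n multiset, complex) mpoly"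
  assumes d: "d > 0" and R_Pol: "R \<in> Pol (cvars d)" and R_E: "mpoly_eval R (Ecoef d) = 1"
    and R_zero: "\<And>c. mpoly_eval R c = 0 \<longleftrightarrow> c \<in> singular d"
    and R_dvd: "\<And>G. G \<in> resideal d \<Longrightarrow> R dvd G"
begin

lemma R_nonzero: "R \<noteq> 0"
  using R_E by auto

text \<open>Multiplying one form by a nonzero number leaves the common zeros unchanged, so
  \<open>weighted_homogeneous\<close> applies.\<close>

lemma row_homogeneous_ex:
  obtains k where "\<And>c t. mpoly_eval R (\<lambda>v. (if fst v = i then t else 1) * c v) = t ^ k * mpoly_eval R c"
proof -
  let ?w = "\<lambda>v :: 'n \<times> 'n multiset. if fst v = i then 1 else 0 :: nat"
  have "mpoly_eval R (\<lambda>v. t ^ ?w v * c v) \<noteq> 0" if t: "t \<noteq> 0" and c: "mpoly_eval R c \<noteq> 0" for t c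
  proof -
    have "form_eval d (\<lambda>v. t ^ ?w v * c v) j x = (if j = i then t else 1) * form_eval d c j x" for j x
      by (simp add: form_eval_monom_at sum_distrib_left mult.assoc)
    then have "(\<lambda>v. t ^ ?w v * c v) \<in> singular d \<longleftrightarrow> c \<in> singular d"
      using t unfolding singular_def by (simp add: if_distrib[of "\<lambda>a. a * _"] cong: if_cong) (metis mult_eq_0_iff)
    then show ?thesis using c R_zero by simp
  qed
  then obtain k where k: "\<And>c t. mpoly_eval R (\<lambda>v. t ^ ?w v * c v) = t ^ k * mpoly_eval R c"
    using weighted_homogeneous[of R ?w] R_nonzero by blast
  have "(\<lambda>v. t ^ ?w v * c v) = (\<lambda>v. (if fst v = i then t else 1) * c v)" for t and c :: "'n \<times> 'n multiset \<Rightarrow> complex"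
    by auto
  then show ?thesis using k by (intro that[of k]) metis
qed

text \<open>The forms \<open>x_j^d - x_i^d\<close>, \<open>j \<noteq> i\<close>, have \<open>d^(n-1)\<close> common zeros with \<open>x_i = 1\<close>; on them the
  \<open>i\<close>-th form \<open>t x_i^d - x_i^(d-1) L(x)\<close> vanishes for \<open>d^(n-1)\<close> different values of \<open>t\<close>.\<close>

lemma row_degree_lower:
  assumes hom: "\<And>c t. mpoly_eval R (\<lambda>v. (if fst v = i then t else 1) * c v) = t ^ k * mpoly_eval R c"
  shows "d ^ (CARD('n) - 1) \<le> k"
proof -
  let ?T = "(UNIV - {i}) \<rightarrow>\<^sub>E {z :: complex. z ^ d = 1}"
  define pt where "pt f = (\<chi> j. if j = i then 1 else f j)" for f :: "'n \<Rightarrow> complex"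
  have fin: "finite ?T" using d by (intro finite_PiE) (auto intro: finite_roots_unity)
  have cardT: "card ?T = d ^ (CARD('n) - 1)" using d by (simp add: card_PiE card_roots_unity_eq)
  have inj: "inj_on pt ?T"
  proof (rule inj_onI)
    fix f g assume fg: "f \<in> ?T" "g \<in> ?T" "pt f = pt g"
    have "f j = g j" if "j \<noteq> i" for j
      using arg_cong[OF fg(3), of "\<lambda>x. x $ j"] that by (simp add: pt_def)
    then show "f = g" using fg(1,2) by (intro PiE_ext) auto
  qed
  obtain a where a: "inj_on (\<lambda>x. \<Sum>j\<in>UNIV. a j * x $ j) (pt ` ?T)"
    using separating_linear_form[of "pt ` ?T"] fin by blast
  define L where "L x = (\<Sum>j\<in>UNIV. a j * x $ j)" for x :: "complex ^ 'n"
  define b where "b = (\<lambda>(j, \<alpha>). if j = i then - (\<Sum>l\<in>UNIV. if \<alpha> = add_mset l (replicate_mset (d - 1) i) then a l else 0)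
    else (if \<alpha> = replicate_mset d j then 1 else 0) - (if \<alpha> = replicate_mset d i then 1 else 0))"
  define e where "e = (\<lambda>v. if v = (i, replicate_mset d i) then 1 else 0 :: complex)"
  have b_other: "form_eval d b j x = x $ j ^ d - x $ i ^ d" if "j \<noteq> i" for j x
    using that by (simp add: form_eval_monom_at b_def left_diff_distrib sum_subtractf
        if_distrib[of "\<lambda>a. a * _"] sum.delta cong: if_cong)
  have b_i: "form_eval d b i x = - (x $ i ^ (d - 1) * L x)" for x
  proof -
    have "form_eval d b i x = - (\<Sum>\<alpha> | size \<alpha> = d. \<Sum>l\<in>UNIV.
        (if \<alpha> = add_mset l (replicate_mset (d - 1) i) then a l else 0) * monom_at \<alpha> x)"
      by (simp add: form_eval_monom_at b_def sum_distrib_right sum_negf)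
    also have "\<dots> = - (\<Sum>l\<in>UNIV. \<Sum>\<alpha> | size \<alpha> = d.
        (if \<alpha> = add_mset l (replicate_mset (d - 1) i) then a l else 0) * monom_at \<alpha> x)"
      by (subst sum.swap) simp
    also have "\<dots> = - (\<Sum>l\<in>UNIV. a l * (x $ l * x $ i ^ (d - 1)))"
      using d by (simp add: if_distrib[of "\<lambda>a. a * _"] sum.delta cong: if_cong)
    finally show ?thesis by (simp add: L_def sum_distrib_left algebra_simps)
  qed
  have e_eval: "form_eval d e j x = (if j = i then x $ i ^ d else 0)" for j x
    unfolding e_def by (subst form_eval_delta) auto
  define r where "r = along (\<lambda>v. [:b v, e v:]) R"
  have r_eval: "poly r t = mpoly_eval R (\<lambda>v. b v + t * e v)" for t by (simp add: r_def)
  have pow: "x $ i ^ d = x $ i * x $ i ^ (d - 1)" for x :: "complex ^ 'n" using d by (cases d) auto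
  have roots: "poly r t = 0 \<longleftrightarrow> t \<in> L ` pt ` ?T" for t
  proof -
    have ev: "form_eval d (\<lambda>v. b v + t * e v) j x =
      (if j = i then x $ i ^ (d - 1) * (t * x $ i - L x) else x $ j ^ d - x $ i ^ d)" for j x
      unfolding form_eval_lin e_eval using b_i b_other by (auto simp: pow algebra_simps)
    have "(\<lambda>v. b v + t * e v) \<in> singular d \<longleftrightarrow> t \<in> L ` pt ` ?T"
    proof
      assume "(\<lambda>v. b v + t * e v) \<in> singular d"
      then obtain x where x: "x \<noteq> 0" "\<And>j. form_eval d (\<lambda>v. b v + t * e v) j x = 0" by (auto simp: singular_def)
      have xj: "x $ j ^ d = x $ i ^ d" for j using x(2)[of j] by (cases "j = i") (auto simp: ev)
      have xi: "x $ i \<noteq> 0"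
      proof
        assume "x $ i = 0"
        then have "x $ j = 0" for j using xj[of j] d by (simp add: zero_power)
        then show False using x(1) by (simp add: Finite_Cartesian_Product.vec_eq_iff)
      qed
      define f where "f = restrict (\<lambda>j. x $ j / x $ i) (UNIV - {i})"
      have f: "f \<in> ?T" using xi xj by (auto simp: f_def power_divide)
      have "pt f = inverse (x $ i) *s x"
        using xi by (auto simp: pt_def f_def Finite_Cartesian_Product.vec_eq_iff field_simps)
      then have "L (pt f) = inverse (x $ i) * L x" by (simp add: L_def sum_distrib_left algebra_simps)
      moreover have "t * x $ i = L x" using x(2)[of i] xi by (simp add: ev)
      ultimately have "x $ i * t = x $ i * L (pt f)" using xi by (simp add: mult.commute)
      then have "t = L (pt f)" using xi by simp
      then show "t \<in> L ` pt ` ?T" using f by blast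
    next
      assume "t \<in> L ` pt ` ?T"
      then obtain f where f: "f \<in> ?T" "t = L (pt f)" by blast
      have "pt f $ i = 1" by (simp add: pt_def)
      moreover have "(pt f $ j) ^ d = 1" if "j \<noteq> i" for j using f(1) that by (auto simp: pt_def)
      ultimately have "form_eval d (\<lambda>v. b v + t * e v) j (pt f) = 0" for j
        unfolding ev by (simp add: f(2))
      moreover have "pt f \<noteq> 0" using \<open>pt f $ i = 1\<close> by auto
      ultimately show "(\<lambda>v. b v + t * e v) \<in> singular d" by (auto simp: singular_def)
    qed
    then show ?thesis unfolding r_eval R_zero .
  qed
  have "infinite (UNIV - L ` pt ` ?T)" using fin by (simp add: infinite_UNIV_char_0 Diff_infinite_finite)
  then obtain t where "t \<notin> L ` pt ` ?T" by (metis Diff_iff ex_in_conv finite.emptyI)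
  then have "r \<noteq> 0" using roots[of t] by auto
  then have "card (L ` pt ` ?T) \<le> Polynomial.degree r"
    using card_poly_roots_bound[of r] roots by (simp add: Collect_mem_eq)
  moreover have "card (L ` pt ` ?T) = d ^ (CARD('n) - 1)"
    using card_image[OF a] card_image[OF inj] cardT by (simp add: L_def)
  \<comment> \<open>Only row \<open>i\<close> contains \<open>t\<close>; dividing this row by
    \<open>t\<close> reverses \<open>r\<close> up to the factor \<open>t ^ k\<close>.\<close>
  moreover have "Polynomial.degree r \<le> k"
  proof (rule poly_reverse_degree(1))
    let ?q = "along (\<lambda>v. if fst v = i then [:e v, b v:] else [:b v:]) R"
    fix t :: complex assume t: "t \<noteq> 0"
    have "(\<lambda>v. b v + t * e v) = (\<lambda>v. (if fst v = i then t else 1) *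
        (if fst v = i then e v + inverse t * b v else b v))"
      using t by (auto simp: e_def algebra_simps)
    moreover have "(\<lambda>v. poly (if fst v = i then [:e v, b v:] else [:b v:]) (inverse t)) =
        (\<lambda>v. if fst v = i then e v + inverse t * b v else b v)" by auto
    ultimately show "poly r t = t ^ k * poly ?q (inverse t)"
      unfolding r_eval poly_along by (simp only: hom)
  qed
  ultimately show ?thesis by simp
qed

text \<open>\<open>R\<close> divides Macaulay's determinant \<open>M\<close> for form
  \<open>i\<close>. Comparing powers of the row factor at \<open>Ecoef d\<close> gives
  \<open>k \<le> K \<le> d^(n-1)\<close>, and \<open>row_degree_lower\<close> gives the
  converse.\<close>

lemma row_homogeneous:
  "mpoly_eval R (\<lambda>v. (if fst v = i then t else 1) * c v) = t ^ d ^ (CARD('n) - 1) * mpoly_eval R c"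
proof -
  obtain k where k: "\<And>c t. mpoly_eval R (\<lambda>v. (if fst v = i then t else 1) * c v) = t ^ k * mpoly_eval R c"
    using row_homogeneous_ex by blast
  obtain M K where M: "M \<in> resideal d" "mpoly_eval M (Ecoef d) = 1" "K \<le> d ^ (CARD('n) - 1)"
    "\<And>t c. mpoly_eval M (\<lambda>v. (if fst v = i then t else 1) * c v) = t ^ K * mpoly_eval M c"
    by (rule macaulay_det_ex[OF d]) blast
  obtain q where q: "M = R * q" using R_dvd[OF M(1)] ..
  define qp where "qp = along (\<lambda>v. if fst v = i then [:0, Ecoef d v:] else [:Ecoef d v:]) q"
  have "poly (monom 1 K) t = poly (monom 1 k * qp) t" for t
  proof -
    have "(\<lambda>v. poly (if fst v = i then [:0, Ecoef d v:] else [:Ecoef d v:]) t) =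
      (\<lambda>v. (if fst v = i then t else 1) * Ecoef d v)" by auto
    then have "poly qp t = mpoly_eval q (\<lambda>v. (if fst v = i then t else 1) * Ecoef d v)"
      by (simp add: qp_def)
    then show ?thesis
      using M(4)[of t "Ecoef d"] k[of t "Ecoef d"] M(2) R_E by (simp add: q poly_monom)
  qed
  then have eq: "monom 1 K = monom 1 k * qp" using poly_eq_poly_eq_iff by blast
  then have "qp \<noteq> 0" by (metis mult_zero_right monom_eq_0_iff zero_neq_one)
  then have "K = k + Polynomial.degree qp"
    using arg_cong[OF eq, of Polynomial.degree] by (simp add: degree_mult_eq degree_monom_eq)
  then have "k = d ^ (CARD('n) - 1)" using row_degree_lower[OF k] M(3) by simp
  then show ?thesis using k by simp
qed

lemma rows_scaled:
  "mpoly_eval R (\<lambda>v. s (fst v) * c v) = (\<Prod>i\<in>UNIV. s i) ^ d ^ (CARD('n) - 1) * mpoly_eval R c"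
proof -
  have "mpoly_eval R (\<lambda>v. (if fst v \<in> I then s (fst v) else 1) * c v) =
    (\<Prod>i\<in>I. s i) ^ d ^ (CARD('n) - 1) * mpoly_eval R c" for I
  proof (induction I rule: infinite_finite_induct)
    case (insert i I)
    have "(\<lambda>v. (if fst v \<in> insert i I then s (fst v) else 1) * c v) =
      (\<lambda>v. (if fst v = i then s i else 1) * ((if fst v \<in> I then s (fst v) else 1) * c v))"
      using insert by auto
    then show ?case using insert row_homogeneous by (simp add: power_mult_distrib)
  qed auto
  from this[of UNIV] show ?thesis by simp
qed

lemma R_scaled: "mpoly_eval R (\<lambda>v. t * c v) = t ^ (CARD('n) * d ^ (CARD('n) - 1)) * mpoly_eval R c"
  using rows_scaled[of "\<lambda>_. t" c] by (simp add: power_mult)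

text \<open>This scaling is the substitution of \<open>t x_j\<close> for \<open>x_j\<close>, which
  moves common zeros bijectively if \<open>t \<noteq> 0\<close>. On \<open>Ecoef d\<close> it acts
  like multiplication of row \<open>j\<close> by \<open>t ^ d\<close>, which yields the
  exponent.\<close>

lemma column_homogeneous:
  "mpoly_eval R (\<lambda>v. t ^ count (snd v) j * c v) = t ^ (d * d ^ (CARD('n) - 1)) * mpoly_eval R c"
proof -
  let ?w = "\<lambda>v :: 'n \<times> 'n multiset. count (snd v) j"
  have "mpoly_eval R (\<lambda>v. t ^ ?w v * c v) \<noteq> 0" if t: "t \<noteq> 0" and c: "mpoly_eval R c \<noteq> 0" for t c
  proof
    assume "mpoly_eval R (\<lambda>v. t ^ ?w v * c v) = 0"
    then obtain x where x: "x \<noteq> 0" "\<And>i. form_eval d (\<lambda>v. t ^ ?w v * c v) i x = 0"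
      unfolding R_zero by (auto simp: singular_def)
    define y where "y = (\<chi> l. if l = j then t * x $ l else x $ l)"
    have "monom_at \<alpha> y = t ^ count \<alpha> j * monom_at \<alpha> x" for \<alpha>
      by (induction \<alpha>) (auto simp: y_def algebra_simps)
    then have "form_eval d c i y = form_eval d (\<lambda>v. t ^ ?w v * c v) i x" for i
      by (simp add: form_eval_monom_at algebra_simps)
    moreover have "y \<noteq> 0"
    proof
      assume "y = 0"
      then have "y $ l = 0" for l by simp
      then have "x $ l = 0" for l using t by (auto simp: y_def split: if_splits) (metis mult_eq_0_iff)
      then show False using x(1) by (simp add: Finite_Cartesian_Product.vec_eq_iff)
    qed
    ultimately have "c \<in> singular d" using x(2) by (auto simp: singular_def)
    then show False using c R_zero by simp
  qed
  then obtain k where k: "\<And>c t. mpoly_eval R (\<lambda>v. t ^ ?w v * c v) = t ^ k * mpoly_eval R c"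
    using weighted_homogeneous[of R ?w] R_nonzero by blast
  have "(\<lambda>v. 2 ^ ?w v * Ecoef d v) = (\<lambda>v. (if fst v = j then 2 ^ d else 1) * Ecoef d v)"
    by (auto simp: Ecoef_def)
  then have "(2 :: complex) ^ k = (2 ^ d) ^ d ^ (CARD('n) - 1)"
    using k[of 2 "Ecoef d"] row_homogeneous[of j "2 ^ d" "Ecoef d"] R_E by simp
  then have "norm ((2 :: complex) ^ k) = norm ((2 :: complex) ^ (d * d ^ (CARD('n) - 1)))"
    by (simp add: power_mult)
  then have "(2 :: real) ^ k = 2 ^ (d * d ^ (CARD('n) - 1))" by (simp add: norm_power)
  then have "k = d * d ^ (CARD('n) - 1)" by simp
  then show ?thesis using k by simp
qed

lemma columns_scaled:
  "mpoly_eval R (\<lambda>v. (\<Prod>j\<in>#snd v. s j) * c v) = (\<Prod>j\<in>UNIV. s j) ^ (d * d ^ (CARD('n) - 1)) * mpoly_eval R c"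
proof -
  have "mpoly_eval R (\<lambda>v. (\<Prod>j\<in>J. s j ^ count (snd v) j) * c v) =
    (\<Prod>j\<in>J. s j) ^ (d * d ^ (CARD('n) - 1)) * mpoly_eval R c" for J
  proof (induction J rule: infinite_finite_induct)
    case (insert j J)
    have "(\<lambda>v. (\<Prod>j\<in>insert j J. s j ^ count (snd v) j) * c v) =
      (\<lambda>v. s j ^ count (snd v) j * ((\<Prod>j\<in>J. s j ^ count (snd v) j) * c v))"
      using insert by (simp add: mult.assoc)
    then show ?case using insert column_homogeneous by (simp add: power_mult_distrib)
  qed auto
  moreover have "(\<Prod>j\<in>#\<alpha>. s j) = (\<Prod>j\<in>UNIV. s j ^ count \<alpha> j)" for \<alpha>
  proof (induction \<alpha>)
    case (add x \<alpha>)
    have "(\<Prod>j\<in>UNIV. s j ^ count (add_mset x \<alpha>) j) = (\<Prod>j\<in>UNIV. (if j = x then s j else 1) * s j ^ count \<alpha> j)"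
      by (intro prod.cong) auto
    then show ?case using add by (simp add: prod.distrib)
  qed simp
  ultimately show ?thesis by simp
qed

text \<open>The gradient is found one coordinate at a time. A diagonal move multiplies a single row
  by \<open>1 + s\<close>, so row homogeneity gives the value explicitly.\<close>

lemma R_deriv_E:
  "((\<lambda>s. mpoly_eval R (\<lambda>v. Ecoef d v + s * w v)) has_field_derivative
     of_nat (d ^ (CARD('n) - 1)) * (\<Sum>i\<in>UNIV. w (i, replicate_mset d i))) (at 0)"
proof -
  let ?E = "Ecoef d" and ?K = "d ^ (CARD('n) - 1)"
  obtain D where deriv: "\<And>c w. ((\<lambda>s. mpoly_eval R (\<lambda>v. c v + s * w v))
    has_field_derivative (\<Sum>v\<in>cvars d. w v * mpoly_eval (D v) c)) (at 0)"
    using mpoly_derivs[OF finite_cvars R_Pol] by blast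
  have D_eq: "mpoly_eval (D u) ?E = y"
    if "u \<in> cvars d" "((\<lambda>s. mpoly_eval R (\<lambda>v. ?E v + s * (if v = u then 1 else 0))) has_field_derivative y) (at 0)"
    for u y
  proof -
    have "(\<Sum>v\<in>cvars d. (if v = u then 1 else 0) * mpoly_eval (D v) ?E) = y"
      using DERIV_unique[OF deriv that(2)] .
    then show ?thesis using that(1) by (simp add: if_distrib[of "\<lambda>a. a * _"] sum.delta cong: if_cong)
  qed
  have diag: "mpoly_eval (D (i, replicate_mset d i)) ?E = of_nat ?K" for i
  proof (rule D_eq)
    have "(\<lambda>v. ?E v + s * (if v = (i, replicate_mset d i) then 1 else 0)) =
        (\<lambda>v. (if fst v = i then 1 + s else 1) * ?E v)" for s
      by (auto simp: Ecoef_def)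
    then have "mpoly_eval R (\<lambda>v. ?E v + s * (if v = (i, replicate_mset d i) then 1 else 0)) = (1 + s) ^ ?K" for s
      using row_homogeneous[of i "1 + s" ?E] R_E by simp
    moreover have "((\<lambda>s. (1 + s) ^ ?K) has_field_derivative of_nat ?K) (at (0::complex))"
      by (auto intro!: derivative_eq_intros)
    ultimately show "((\<lambda>s. mpoly_eval R (\<lambda>v. ?E v + s * (if v = (i, replicate_mset d i) then 1 else 0)))
      has_field_derivative of_nat ?K) (at 0)" by simp
  qed (simp add: cvars_def)
  have offdiag: "mpoly_eval (D (i, \<alpha>)) ?E = 0" if \<alpha>: "size \<alpha> = d" "\<alpha> \<noteq> replicate_mset d i" for i \<alpha>
  proof (rule D_eq)
    have "\<exists>j. j \<in># \<alpha> \<and> j \<noteq> i"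
    proof (rule ccontr)
      assume "\<not> ?thesis"
      then have "set_mset \<alpha> \<subseteq> {i}" by auto
      then have "\<alpha> = replicate_mset (size \<alpha>) i" using set_mset_subset_singletonD by metis
      then show False using \<alpha> by simp
    qed
    \<comment> \<open>At a common zero the forms \<open>l \<noteq> i\<close> force
      \<open>x_l = 0\<close>. As \<open>\<alpha>\<close> contains \<open>j \<noteq> i\<close>, its
      monomial vanishes, and form \<open>i\<close> leaves \<open>x_i^d = 0\<close>.\<close>
    then obtain j where j: "j \<in># \<alpha>" "j \<noteq> i" by blast
    let ?e = "\<lambda>v. if v = (i, \<alpha>) then 1 else 0 :: complex"
    define L where "L = along (\<lambda>v. [:?E v, ?e v:]) R"
    have L: "poly L s = mpoly_eval R (\<lambda>v. ?E v + s * ?e v)" for s by (simp add: L_def)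
    have "poly L s \<noteq> 0" for s
      unfolding L R_zero
    proof
      assume "(\<lambda>v. ?E v + s * ?e v) \<in> singular d"
      then obtain x where x: "x \<noteq> 0" "\<And>l. form_eval d (\<lambda>v. ?E v + s * ?e v) l x = 0"
        by (auto simp: singular_def)
      have f: "form_eval d (\<lambda>v. ?E v + s * ?e v) l x = x $ l ^ d + s * (if l = i then monom_at \<alpha> x else 0)" for l
        unfolding form_eval_lin form_eval_delta[OF \<alpha>(1)] form_eval_Ecoef by simp
      have 1: "x $ l = 0" if "l \<noteq> i" for l using x(2)[of l] d that unfolding f by simp
      have "monom_at \<alpha> x = 0"
        using j(1) 1[OF j(2)] unfolding monom_at_def by (auto simp: prod_mset_zero_iff image_iff)
      then have "x $ i = 0" using x(2)[of i] d unfolding f by simp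
      with 1 have "x $ l = 0" for l by (cases "l = i") auto
      then show False using x(1) by (simp add: Finite_Cartesian_Product.vec_eq_iff)
    qed
    then obtain a where a: "L = [:a:]"
      using fundamental_theorem_of_algebra[of L] constant_degree[of L] degree_eq_zeroE[of L] by blast
    show "((\<lambda>s. mpoly_eval R (\<lambda>v. ?E v + s * ?e v)) has_field_derivative 0) (at 0)"
      unfolding L[symmetric] a by simp
  qed (use \<alpha> in \<open>simp add: cvars_def\<close>)
  have "(\<Sum>v\<in>cvars d. w v * mpoly_eval (D v) ?E) =
    (\<Sum>v\<in>(\<lambda>i. (i, replicate_mset d i)) ` UNIV. w v * mpoly_eval (D v) ?E)"
  proof (rule sum.mono_neutral_right[OF finite_cvars])
    show "(\<lambda>i. (i, replicate_mset d i)) ` UNIV \<subseteq> cvars d" by (auto simp: cvars_def)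
    show "\<forall>v\<in>cvars d - (\<lambda>i. (i, replicate_mset d i)) ` UNIV. w v * mpoly_eval (D v) ?E = 0"
    proof
      fix v :: "'n \<times> 'n multiset" assume "v \<in> cvars d - (\<lambda>i. (i, replicate_mset d i)) ` UNIV"
      then have "mpoly_eval (D (fst v, snd v)) ?E = 0"
        by (intro offdiag) (auto simp: cvars_def image_iff)
      then show "w v * mpoly_eval (D v) ?E = 0" by simp
    qed
  qed
  also have "\<dots> = (\<Sum>i\<in>UNIV. w (i, replicate_mset d i) * of_nat ?K)"
    by (subst sum.reindex) (auto simp: inj_on_def diag)
  finally show ?thesis using deriv[of ?E w] by (simp add: sum_distrib_left mult.commute)
qed

section \<open>The eigenvalues as roots of a pencil\<close>

lemma coeff_prod_mset_linear:
  fixes B :: "complex multiset"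
  shows "coeff (\<Prod>x\<in>#B. [:1, - x:]) 0 = 1" "coeff (\<Prod>x\<in>#B. [:1, - x:]) (Suc 0) = - (\<Sum>x\<in>#B. x)"
  by (induction B) (auto simp: coeff_mult)

text \<open>\<open>B\<close> lists the roots of the monic polynomial \<open>R (t E - A)\<close> with
  multiplicity. Their product is read off at \<open>t = 0\<close>. Their sum comes from the reversed
  pencil \<open>R (E - s A)\<close>, the product of the factors \<open>1 - s x\<close>, whose
  derivative at 0 is known from \<open>R_deriv_E\<close>.\<close>

lemma eigenvalue_multiset:
  obtains B where "size B = CARD('n) * d ^ (CARD('n) - 1)" "mpoly_eval R A = (\<Prod>x\<in>#B. x)"
    "(\<Sum>x\<in>#B. x) = of_nat (d ^ (CARD('n) - 1)) * (\<Sum>i\<in>UNIV. A (i, replicate_mset d i))"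
    "\<And>x. x \<in># B \<Longrightarrow> (\<lambda>v. x * Ecoef d v - A v) \<in> singular d"
proof -
  let ?E = "Ecoef d"
  define N where "N = CARD('n) * d ^ (CARD('n) - 1)"
  define r where "r = along (\<lambda>v. [:- A v, ?E v:]) R"
  have r_eval: "poly r t = mpoly_eval R (\<lambda>v. - A v + t * ?E v)" for t by (simp add: r_def)
  have r: "Polynomial.degree r = N" "lead_coeff r = 1"
    using homogeneous_pencil[OF R_scaled, of ?E "\<lambda>v. - A v"] R_E by (simp_all add: r_def N_def)
  have "r \<noteq> 0" using r(2) by auto
  then obtain B where B: "size B = N" "r = (\<Prod>x\<in>#B. [:-x, 1:])"
    using alg_closed_imp_factorization[of r] r by auto
  have r_prod: "poly r t = (\<Prod>x\<in>#B. t - x)" for t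
    unfolding B(2) poly_prod_mset by simp
  have size_B: "(\<Prod>x\<in>#C. - x) = (- 1) ^ size C * (\<Prod>x\<in>#C. x)" for C :: "complex multiset"
    by (induction C) auto
  have "(- 1) ^ N * mpoly_eval R A = poly r 0"
    using R_scaled[of "- 1" A] by (simp add: r_eval N_def)
  also have "\<dots> = (- 1) ^ N * (\<Prod>x\<in>#B. x)" using size_B[of B] B(1) by (simp add: r_prod)
  finally have prod: "mpoly_eval R A = (\<Prod>x\<in>#B. x)" by simp
  define q where "q = along (\<lambda>v. [:?E v, - A v:]) R"
  have q_eval: "poly q s = mpoly_eval R (\<lambda>v. ?E v + s * - A v)" for s by (simp add: q_def)
  have scaleC: "(\<Prod>x\<in>#C. 1 - s * x) = s ^ size C * (\<Prod>x\<in>#C. inverse s - x)"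
    if "s \<noteq> 0" for s and C :: "complex multiset"
    using that by (induction C) (auto simp: field_simps)
  have "poly q s = poly (\<Prod>x\<in>#B. [:1, - x:]) s" if s: "s \<noteq> 0" for s
  proof -
    have "(\<lambda>v. ?E v + s * - A v) = (\<lambda>v. s * (- A v + inverse s * ?E v))"
      using s by (auto simp: algebra_simps)
    then have "poly q s = s ^ N * poly r (inverse s)"
      unfolding q_eval r_eval using R_scaled[of s "\<lambda>v. - A v + inverse s * ?E v"] by (simp add: N_def)
    also have "\<dots> = (\<Prod>x\<in>#B. 1 - s * x)" using scaleC[OF s, of B] B(1) by (simp add: r_prod)
    finally show ?thesis by (simp add: poly_prod_mset)
  qed
  then have "UNIV - {0} \<subseteq> {s. poly (q - (\<Prod>x\<in>#B. [:1, - x:])) s = 0}" by auto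
  moreover have "infinite (UNIV - {0 :: complex})" by (simp add: infinite_UNIV_char_0)
  ultimately have "q - (\<Prod>x\<in>#B. [:1, - x:]) = 0" using finite_subset poly_roots_finite by blast
  then have q: "q = (\<Prod>x\<in>#B. [:1, - x:])" by simp
  have "(poly q has_field_derivative poly (pderiv q) 0) (at 0)" by (rule poly_DERIV)
  then have "((\<lambda>s. mpoly_eval R (\<lambda>v. ?E v + s * - A v)) has_field_derivative poly (pderiv q) 0) (at 0)"
    by (simp only: ext[of "poly q", OF q_eval])
  then have "poly (pderiv q) 0 = of_nat (d ^ (CARD('n) - 1)) * (\<Sum>i\<in>UNIV. - A (i, replicate_mset d i))"
    using DERIV_unique R_deriv_E[of "\<lambda>v. - A v"] by blast
  moreover have "poly (pderiv q) 0 = - (\<Sum>x\<in>#B. x)"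
    unfolding q by (simp add: poly_0_coeff_0 coeff_pderiv coeff_prod_mset_linear)
  ultimately have "(\<Sum>x\<in>#B. x) = of_nat (d ^ (CARD('n) - 1)) * (\<Sum>i\<in>UNIV. A (i, replicate_mset d i))"
    by (simp add: sum_negf)
  moreover have "(\<lambda>v. x * ?E v - A v) \<in> singular d" if "x \<in># B" for x
  proof -
    have "poly r x = 0" using that by (auto simp: r_prod prod_mset_zero_iff image_iff intro!: bexI[of _ x])
    then have "(\<lambda>v. - A v + x * ?E v) \<in> singular d" by (simp add: r_eval R_zero)
    then show ?thesis by (simp add: algebra_simps)
  qed
  ultimately show ?thesis using that B(1) prod by (simp add: N_def)
qed

end

section \<open>Tensors\<close>

lemma mset_eq_replicate_iff: "mset js = replicate_mset n i \<longleftrightarrow> js = replicate n i"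
proof
  assume eq: "mset js = replicate_mset n i"
  then have "length js = n" by (metis size_mset size_replicate_mset)
  moreover have "j = i" if "j \<in> set js" for j using that eq by (metis in_replicate_mset set_mset_mset)
  ultimately show "js = replicate n i" by (intro replicate_eqI) auto
qed simp

lemma finite_length_eq [simp]: "finite {js :: 'n::finite list. length js = k}"
  using finite_lists_length_eq[of "UNIV :: 'n set" k] by simp

lemma identity_tensor_Cons:
  "length js = k \<Longrightarrow> identity_tensor (i # js) = (if js = replicate k i then 1 else 0)"
  by (auto simp: identity_tensor_def intro!: replicate_eqI)

lemma eigenpair_iff:
  "eigenpair m T \<mu> x \<longleftrightarrow> x \<noteq> 0 \<and>
     (\<forall>i. tensor_apply m (\<lambda>is. complex_of_real (T is)) x $ i = \<mu> * x $ i ^ (m - 1))"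
proof -
  have "tensor_apply m (\<lambda>is. \<mu> * identity_tensor is - complex_of_real (T is)) x $ i =
    \<mu> * x $ i ^ (m - 1) - tensor_apply m (\<lambda>is. complex_of_real (T is)) x $ i" for i
  proof -
    have "(\<Sum>js | length js = m - 1. identity_tensor (i # js) * (\<Prod>j\<leftarrow>js. x $ j)) =
      (\<Sum>js | length js = m - 1. if js = replicate (m - 1) i then x $ i ^ (m - 1) else 0)"
      by (intro sum.cong refl) (auto simp: identity_tensor_Cons[where k = "m - 1"] prod_list_replicate)
    also have "\<dots> = x $ i ^ (m - 1)" by (simp add: sum.delta)
    finally have "(\<Sum>js | length js = m - 1. \<mu> * identity_tensor (i # js) * (\<Prod>j\<leftarrow>js. x $ j)) = \<mu> * x $ i ^ (m - 1)"
      unfolding mult.assoc sum_distrib_left[symmetric] by (rule arg_cong)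
    then show ?thesis by (simp add: tensor_apply_def left_diff_distrib sum_subtractf)
  qed
  then show ?thesis by (auto simp: eigenpair_def Finite_Cartesian_Product.vec_eq_iff)
qed

lemma tensor_apply_complex_vec:
  "tensor_apply m (\<lambda>is. complex_of_real (T is)) (complex_vec x) $ i = complex_of_real (tensor_apply m T x $ i)"
proof -
  have "(\<Prod>j\<leftarrow>js. complex_of_real (x $ j)) = complex_of_real (\<Prod>j\<leftarrow>js. x $ j)" for js
    by (induction js) auto
  then show ?thesis by (simp add: tensor_apply_def complex_vec_def)
qed

lemma tensor_coeffs_diag:
  "tensor_coeffs m T (i, replicate_mset (m - 1) i) = T (i # replicate (m - 1) i)"
proof -
  have "{js. length js = m - 1 \<and> mset js = replicate_mset (m - 1) i} = {replicate (m - 1) i}"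
    by (auto simp: mset_eq_replicate_iff)
  then show ?thesis by (simp add: tensor_coeffs_def)
qed

text \<open>A real eigenvector \<open>x\<close> for \<open>r\<close> satisfies
  \<open>x \<bullet> S x = r * (\<Sum>i. x_i^m)\<close>. For even \<open>m\<close> the sum is
  positive, so \<open>r < 0\<close> contradicts positive semidefiniteness.\<close>

lemma eigenvalue_nonneg:
  fixes S :: "('n::finite, real) tensor"
  assumes "m \<ge> 2" "even m" "psd_tensor m S"
    and real: "\<And>\<mu>. tensor_eigenvalue m S \<mu> \<Longrightarrow> \<mu> \<in> \<real>"
    and neg: "\<And>r. r < 0 \<Longrightarrow> tensor_eigenvalue m S (complex_of_real r) \<Longrightarrow>
      \<exists>x :: real ^ 'n. eigenpair m S (complex_of_real r) (complex_vec x)"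
    and eig: "tensor_eigenvalue m S \<mu>"
  shows "\<exists>r\<ge>0. \<mu> = complex_of_real r"
proof -
  obtain r where r: "\<mu> = complex_of_real r" using real[OF eig] by (auto elim: Reals_cases)
  have "r \<ge> 0"
  proof (rule ccontr)
    assume "\<not> r \<ge> 0"
    then have "r < 0" by simp
    then obtain x where x: "eigenpair m S (complex_of_real r) (complex_vec x)"
      using neg[OF _ eig[unfolded r]] by blast
    have "complex_of_real (tensor_apply m S x $ i) = complex_of_real (r * x $ i ^ (m - 1))" for i
      using x unfolding eigenpair_iff tensor_apply_complex_vec by (simp add: complex_vec_def)
    then have Sx: "tensor_apply m S x $ i = r * x $ i ^ (m - 1)" for i by (simp only: of_real_eq_iff)
    have "x \<bullet> tensor_apply m S x = (\<Sum>i\<in>UNIV. r * x $ i ^ m)"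
      unfolding inner_vec_def
    proof (intro sum.cong refl)
      fix i show "x $ i \<bullet> tensor_apply m S x $ i = r * x $ i ^ m"
        using assms(1) Sx[of i] by (cases m) simp_all
    qed
    also have "\<dots> = r * (\<Sum>i\<in>UNIV. x $ i ^ m)" by (simp add: sum_distrib_left)
    finally have eq: "x \<bullet> tensor_apply m S x = r * (\<Sum>i\<in>UNIV. x $ i ^ m)" .
    have nonneg: "r * (\<Sum>i\<in>UNIV. x $ i ^ m) \<ge> 0"
      using assms(3) unfolding psd_tensor_def eq[symmetric] by blast
    obtain i where i: "x $ i \<noteq> 0"
    proof -
      have "complex_vec x \<noteq> 0" using x by (simp add: eigenpair_def)
      then show ?thesis using that by (auto simp: complex_vec_def Finite_Cartesian_Product.vec_eq_iff)
    qed
    have "(\<Sum>i\<in>UNIV. x $ i ^ m) > 0"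
      by (rule sum_pos2[of _ i]) (use i assms(2) in \<open>auto simp: zero_less_power_eq zero_le_even_power\<close>)
    then show False using nonneg \<open>r < 0\<close> by (simp add: zero_le_mult_iff)
  qed
  then show ?thesis using r by blast
qed

text \<open>Each factor satisfies \<open>x \<le> exp (x - 1)\<close>. For numbers with mean 1 the
  bound is 1, which is the inequality of arithmetic and geometric means in the form needed.\<close>

lemma prod_le_exp_sum:
  fixes B :: "real multiset"
  assumes "\<And>x. x \<in># B \<Longrightarrow> x \<ge> 0"
  shows "0 \<le> (\<Prod>x\<in>#B. x) \<and> (\<Prod>x\<in>#B. x) \<le> exp ((\<Sum>x\<in>#B. x) - real (size B))"
  using assms
proof (induction B)
  case (add x B)
  have "x * (\<Prod>x\<in>#B. x) \<le> exp (x - 1) * exp ((\<Sum>x\<in>#B. x) - real (size B))"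
    using add exp_ge_add_one_self[of "x - 1"] by (intro mult_mono) auto
  also have "\<dots> = exp ((\<Sum>x\<in>#add_mset x B. x) - real (size (add_mset x B)))"
    by (simp add: algebra_simps flip: exp_add)
  finally show ?case using add by simp
qed simp

lemma resultant_props:
  assumes d: "d > 0"
  defines "R \<equiv> (resultant d :: ('n::finite \<times> 'n multiset, complex) mpoly)"
  shows "R \<in> Pol (cvars d)" "mpoly_eval R (Ecoef d) = 1"
    "\<And>c. mpoly_eval R c = 0 \<longleftrightarrow> c \<in> singular d" "\<And>G. G \<in> resideal d \<Longrightarrow> R dvd G"
  using is_resultant_resultant[OF d, where 'n = 'n]
  by (auto simp: R_def is_resultant_def Pol_def cvars_def Ecoef_def singular_def)

text \<open>Stated for an arbitrary diagonal so that it covers both tensors: for \<open>T\<close> it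
  gives a real nonnegative value, and for \<open>K\<close>, whose diagonal entries are 1, the
  exponential is 1.\<close>

lemma Edet_eigenvalues:
  fixes S :: "('n::finite, real) tensor"
  assumes m: "m \<ge> 2"
    and eig: "\<And>\<mu>. tensor_eigenvalue m S \<mu> \<Longrightarrow> \<exists>r\<ge>0. \<mu> = complex_of_real r"
  obtains p where "Edet m S = complex_of_real p" "p \<ge> 0"
    "p \<le> exp (real ((m - 1) ^ (CARD('n) - 1)) * (\<Sum>i\<in>UNIV. S (replicate m i) - 1))"
proof -
  define d where "d = m - 1"
  have d: "d > 0" using m by (simp add: d_def)
  have mi: "i # replicate d i = replicate m i" for i :: 'n using m by (cases m) (simp_all add: d_def)
  let ?A = "tensor_coeffs m (\<lambda>is. complex_of_real (S is))"
  obtain B where B: "size B = CARD('n) * d ^ (CARD('n) - 1)" "mpoly_eval (resultant d) ?A = (\<Prod>x\<in>#B. x)"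
    "(\<Sum>x\<in>#B. x) = of_nat (d ^ (CARD('n) - 1)) * (\<Sum>i\<in>UNIV. ?A (i, replicate_mset d i))"
    "\<And>x. x \<in># B \<Longrightarrow> (\<lambda>v. x * Ecoef d v - ?A v) \<in> singular d"
    using eigenvalue_multiset[OF d resultant_props[OF d]] by blast
  have nonneg: "\<exists>r\<ge>0. \<mu> = complex_of_real r" if mem: "\<mu> \<in># B" for \<mu>
  proof (rule eig)
    obtain x where x: "x \<noteq> 0" "\<And>i. form_eval d (\<lambda>v. \<mu> * Ecoef d v - ?A v) i x = 0"
      using B(4)[OF mem] by (auto simp: singular_def)
    have "form_eval d (\<lambda>v. \<mu> * Ecoef d v - ?A v) i x = \<mu> * x $ i ^ d - form_eval d ?A i x" for i
      unfolding form_eval_Ecoef[symmetric]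
      by (simp add: form_eval_monom_at left_diff_distrib sum_subtractf sum_distrib_left mult.assoc)
    then have "eigenpair m S \<mu> x"
      unfolding eigenpair_iff using x by (simp add: d_def flip: form_eval_tensor_coeffs)
    then show "tensor_eigenvalue m S \<mu>" by (auto simp: tensor_eigenvalue_def)
  qed
  have A_diag: "?A (i, replicate_mset d i) = complex_of_real (S (replicate m i))" for i
    using tensor_coeffs_diag[of m "\<lambda>is. complex_of_real (S is)" i] unfolding d_def[symmetric] mi .
  define C where "C = image_mset Re B"
  have BC: "B = image_mset complex_of_real C"
    unfolding C_def multiset.map_comp
    by (rule multiset.map_ident_strong[symmetric]) (use nonneg in force)
  have prodC: "(\<Prod>x\<in>#image_mset complex_of_real C. x) = complex_of_real (\<Prod>x\<in>#C. x)"
    and sumC: "(\<Sum>x\<in>#image_mset complex_of_real C. x) = complex_of_real (\<Sum>x\<in>#C. x)" for C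
    by (induction C) auto
  have "complex_of_real (\<Sum>x\<in>#C. x) =
    complex_of_real (real (d ^ (CARD('n) - 1)) * (\<Sum>i\<in>UNIV. S (replicate m i)))"
    using B(3) unfolding BC sumC by (simp add: A_diag)
  then have sum: "(\<Sum>x\<in>#C. x) = real (d ^ (CARD('n) - 1)) * (\<Sum>i\<in>UNIV. S (replicate m i))"
    by (simp only: of_real_eq_iff)
  have C: "0 \<le> (\<Prod>x\<in>#C. x)" "(\<Prod>x\<in>#C. x) \<le> exp ((\<Sum>x\<in>#C. x) - real (size C))"
    using prod_le_exp_sum[of C] nonneg by (force simp: C_def)+
  have "(\<Sum>x\<in>#C. x) - real (size C) = real (d ^ (CARD('n) - 1)) * (\<Sum>i\<in>UNIV. S (replicate m i) - 1)"
    using B(1) size_image_mset[of Re B] unfolding sum C_def[symmetric]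
    by (simp add: sum_subtractf algebra_simps)
  then show ?thesis
    using that[of "\<Prod>x\<in>#C. x"] C B(2) unfolding BC prodC Edet_def d_def by simp
qed

section \<open>Diagonal scaling of tensors and the determinant bound\<close>

lemma mat_tensor_mat_diag:
  fixes T :: "('n::finite, real) tensor"
  shows "mat_tensor_mat (\<chi> i j. if i = j then s i else 0) T (\<chi> i j. if i = j then s i else 0) (i # js) =
    s i * T (i # js) * (\<Prod>j\<leftarrow>js. s j)"
proof -
  have P: "(\<Prod>k<length js. if is ! k = js ! k then s (is ! k) else 0) = (if is = js then \<Prod>j\<leftarrow>js. s j else 0)"
    if len: "length is = length js" for "is"
  proof (cases "is = js")
    case True
    then show ?thesis by (simp add: prod.list_conv_set_nth atLeast0LessThan)
  next
    case False
    then obtain k where "k < length js" "is ! k \<noteq> js ! k" using len by (auto simp: list_eq_iff_nth_eq)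
    then show ?thesis using False by (auto intro!: prod_zero bexI[of _ k])
  qed
  have "mat_tensor_mat (\<chi> i j. if i = j then s i else 0) T (\<chi> i j. if i = j then s i else 0) (i # js) =
    (\<Sum>l\<in>UNIV. \<Sum>is | length is = length js. if l = i \<and> is = js then s i * T (i # js) * (\<Prod>j\<leftarrow>js. s j) else 0)"
    by (simp add: P, intro sum.cong refl) auto
  also have "\<dots> = (\<Sum>l\<in>UNIV. if l = i then s i * T (i # js) * (\<Prod>j\<leftarrow>js. s j) else 0)"
    by (intro sum.cong refl) (simp add: sum.delta)
  finally show ?thesis by simp
qed

text \<open>The product of the \<open>s j\<close> depends on \<open>js\<close> only through
  \<open>mset js\<close>, so it leaves the sum that collects equal monomials: the coefficients
  undergo a row scaling and a column scaling.\<close>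

lemma tensor_coeffs_scaled:
  fixes T K :: "('n::finite, real) tensor"
  assumes K: "\<And>i js. length js = m - 1 \<Longrightarrow> K (i # js) = s i * T (i # js) * (\<Prod>j\<leftarrow>js. s j)"
  shows "tensor_coeffs m (\<lambda>is. complex_of_real (K is)) v =
    complex_of_real (s (fst v)) * ((\<Prod>j\<in>#snd v. complex_of_real (s j)) *
      tensor_coeffs m (\<lambda>is. complex_of_real (T is)) v)"
proof -
  obtain i \<alpha> where v: "v = (i, \<alpha>)" by fastforce
  have "complex_of_real (\<Prod>j\<leftarrow>js. s j) = (\<Prod>j\<in>#mset js. complex_of_real (s j))" for js
    by (induction js) auto
  then show ?thesis
    unfolding v tensor_coeffs_def prod.case fst_conv snd_conv sum_distrib_left
    by (intro sum.cong refl) (auto simp: K algebra_simps)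
qed

text \<open>\<open>Edet\<close> has complex values because the resultant is a complex polynomial;
  hence the conclusion says that the value is real and bounds its real part.\<close>

theorem theorem10p1:
  fixes T K :: "('n::finite, real) tensor" and D :: "real ^ 'n ^ 'n" and m :: nat
  assumes "CARD('n) \<ge> 2" and "m \<ge> 2" and "even m"
    and "symmetric_tensor m T" and "psd_tensor m T"
    and "D = diag_matrix m T" and "invertible D"
    and "K = mat_tensor_mat (diag_powr D (- 1 / real m)) T (diag_powr D (- 1 / real m))"
    and "\<And>S (r::real). S \<in> {T, K} \<Longrightarrow> r < 0 \<Longrightarrow> tensor_eigenvalue m S (complex_of_real r) \<Longrightarrow>
           \<exists>x :: real ^ 'n. eigenpair m S (complex_of_real r) (complex_vec x)"
    and "\<And>S (\<mu>::complex). S \<in> {T, K} \<Longrightarrow> tensor_eigenvalue m S \<mu> \<Longrightarrow> \<mu> \<in> \<real>"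
  shows "Edet m T \<in> \<real> \<and> 0 \<le> Re (Edet m T) \<and>
         Re (Edet m T) \<le> (\<Prod>i\<in>UNIV. T (replicate m i)) ^ ((m - 1) ^ (CARD('n) - 1))"
proof -
  define d where "d = m - 1"
  have d: "d > 0" and dm: "m = Suc d" using assms(2) by (simp_all add: d_def)
  define t where "t i = T (replicate m i)" for i
  define s where "s i = t i powr (- 1 / real m)" for i
  have t_nonneg: "t i \<ge> 0" for i
  proof -
    have "tensor_apply m T (axis i 1) $ i = (\<Sum>js | length js = m - 1. if js = replicate (m - 1) i then t i else 0)"
      unfolding tensor_apply_def Finite_Cartesian_Product.vec_lambda_beta
    proof (intro sum.cong refl)
      fix js :: "'n list" assume js: "js \<in> {js. length js = m - 1}"
      show "T (i # js) * (\<Prod>j\<leftarrow>js. axis i 1 $ j) = (if js = replicate (m - 1) i then t i else 0)"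
      proof (cases "js = replicate (m - 1) i")
        case True
        then show ?thesis by (simp add: t_def dm prod_list_replicate)
      next
        case False
        then obtain j where "j \<in> set js" "j \<noteq> i" using js by (auto intro: replicate_eqI)
        then have "0 \<in> set (map (\<lambda>j. axis i (1::real) $ j) js)" by (auto simp: image_iff axis_def)
        then show ?thesis using False by (simp add: prod_list_zero_iff)
      qed
    qed
    then have "axis i 1 \<bullet> tensor_apply m T (axis i 1) = t i"
      by (simp add: sum.delta inner_axis')
    then show ?thesis using assms(5) by (metis psd_tensor_def)
  qed
  have "t i \<noteq> 0" for i
  proof -
    have "Determinants.det D = (\<Prod>i\<in>UNIV. D $ i $ i)"
      by (rule det_diagonal) (simp add: assms(6) diag_matrix_def)
    then have "(\<Prod>i\<in>UNIV. D $ i $ i) \<noteq> 0" using assms(7) by (simp add: invertible_det_nz)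
    then show ?thesis by (simp add: assms(6) diag_matrix_def t_def)
  qed
  then have t: "t i > 0" for i using t_nonneg[of i] by (simp add: less_le)
  have s_pow: "s i ^ m = inverse (t i)" for i
  proof -
    have "s i ^ m = t i powr (- 1)"
      using assms(2) t[of i] by (simp add: s_def powr_powr flip: powr_realpow)
    then show ?thesis using t[of i] by (simp add: powr_minus)
  qed
  have Ds: "diag_powr D (- 1 / real m) = (\<chi> i j. if i = j then s i else 0)"
    unfolding diag_powr_def assms(6) diag_matrix_def s_def t_def
    by (simp add: Finite_Cartesian_Product.vec_eq_iff)
  have K: "K (i # js) = s i * T (i # js) * (\<Prod>j\<leftarrow>js. s j)" for i js
    unfolding assms(8) Ds by (rule mat_tensor_mat_diag)
  have K_diag: "K (replicate m i) = 1" for i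
    using K[of i "replicate d i"] s_pow[of i] t[of i] by (simp add: dm prod_list_replicate t_def field_simps)
  \<comment> \<open>The form of \<open>K\<close> at \<open>x\<close> is the form of \<open>T\<close>
    at the vector with entries \<open>s i * x $ i\<close>.\<close>
  have K_psd: "psd_tensor m K"
    unfolding psd_tensor_def
  proof
    fix x :: "real ^ 'n"
    define y where "y = (\<chi> i. s i * x $ i)"
    have prod_y: "(\<Prod>j\<leftarrow>js. y $ j) = (\<Prod>j\<leftarrow>js. s j) * (\<Prod>j\<leftarrow>js. x $ j)" for js
      by (induction js) (auto simp: y_def)
    have "tensor_apply m K x $ i = s i * tensor_apply m T y $ i" for i
      unfolding tensor_apply_def by (simp add: K prod_y sum_distrib_left algebra_simps)
    then have "x \<bullet> tensor_apply m K x = y \<bullet> tensor_apply m T y"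
      by (simp add: inner_vec_def y_def algebra_simps)
    then show "x \<bullet> tensor_apply m K x \<ge> 0" using assms(5) by (simp add: psd_tensor_def)
  qed
  have eigT: "\<exists>r\<ge>0. \<mu> = complex_of_real r" if "tensor_eigenvalue m T \<mu>" for \<mu>
    by (rule eigenvalue_nonneg[OF assms(2,3,5)]) (use assms(9,10) that in auto)
  have eigK: "\<exists>r\<ge>0. \<mu> = complex_of_real r" if "tensor_eigenvalue m K \<mu>" for \<mu>
    by (rule eigenvalue_nonneg[OF assms(2,3) K_psd]) (use assms(9,10) that in auto)
  obtain p where p: "Edet m T = complex_of_real p" "p \<ge> 0"
    by (rule Edet_eigenvalues[OF assms(2) eigT])
  obtain q where q: "Edet m K = complex_of_real q" "q \<ge> 0" "q \<le> 1"
  proof (rule Edet_eigenvalues[OF assms(2) eigK])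
    fix q assume "Edet m K = complex_of_real q" "q \<ge> 0"
      "q \<le> exp (real ((m - 1) ^ (CARD('n) - 1)) * (\<Sum>i\<in>UNIV. K (replicate m i) - 1))"
    moreover have "(\<Sum>i\<in>UNIV. K (replicate m i) - 1) = 0" by (simp add: K_diag)
    ultimately show thesis using that by simp
  qed
  let ?k = "d ^ (CARD('n) - 1)"
  have "tensor_coeffs m (\<lambda>is. complex_of_real (K is)) =
    (\<lambda>v. complex_of_real (s (fst v)) * ((\<Prod>j\<in>#snd v. complex_of_real (s j)) *
      tensor_coeffs m (\<lambda>is. complex_of_real (T is)) v))"
    using tensor_coeffs_scaled[of m K s T] K by blast
  then have "Edet m K = (\<Prod>i\<in>UNIV. complex_of_real (s i)) ^ ?k * ((\<Prod>i\<in>UNIV. complex_of_real (s i)) ^ (d * ?k) * Edet m T)"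
    unfolding Edet_def d_def[symmetric]
    using rows_scaled[OF d resultant_props[OF d], of "\<lambda>i. complex_of_real (s i)"]
      columns_scaled[OF d resultant_props[OF d], of "\<lambda>i. complex_of_real (s i)"] by simp
  then have "complex_of_real q = complex_of_real ((\<Prod>i\<in>UNIV. s i) ^ ?k * ((\<Prod>i\<in>UNIV. s i) ^ (d * ?k) * p))"
    by (simp add: p q)
  then have "q = (\<Prod>i\<in>UNIV. s i) ^ ?k * ((\<Prod>i\<in>UNIV. s i) ^ (d * ?k) * p)" by (simp only: of_real_eq_iff)
  \<comment> \<open>The row exponent \<open>?k\<close> and the column exponent \<open>d * ?k\<close>
    add up to \<open>m * ?k\<close>, so the \<open>m\<close>-th roots contained in \<open>s\<close>
    disappear.\<close>
  also have "\<dots> = ((\<Prod>i\<in>UNIV. s i) ^ m) ^ ?k * p"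
    by (simp add: dm power_add power_mult_distrib flip: power_mult)
  also have "(\<Prod>i\<in>UNIV. s i) ^ m = inverse (\<Prod>i\<in>UNIV. t i)"
    by (simp add: prod_power_distrib s_pow flip: prod_inversef)
  finally have "q = inverse (\<Prod>i\<in>UNIV. t i) ^ ?k * p" .
  moreover have "(\<Prod>i\<in>UNIV. t i) > 0" by (intro prod_pos) (use t in auto)
  moreover have "p = x ^ l * q" if "q = inverse x ^ l * p" "x > 0" for x :: real and l
    using that by (simp add: power_inverse)
  ultimately have "p = (\<Prod>i\<in>UNIV. t i) ^ ?k * q" by blast
  also have "\<dots> \<le> (\<Prod>i\<in>UNIV. t i) ^ ?k"
    using q t_nonneg by (intro mult_left_le) (auto intro!: zero_le_power prod_nonneg)
  finally show ?thesis using p by (simp add: t_def d_def)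
qed

end
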